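(* Let $k$ be a field and let $\Delta$ be a simplicial complex on the vertex set $[n]=\{1,\dots,n\}$. Let $A=k[\Delta]$ be its Stanley--Reisner ring, of Krull dimension $d\ge 2$. Suppose that $\operatorname{indeg} A=d$. If $e(A)\le d$, then $A$ has $d$-linear resolution. In particular, $\operatorname{rt}(A)=d$.
   Context: A simplicial complex $\Delta$ on $[n]$ is a family of subsets of $[n]$ (faces) closed under taking subsets, with $\{i\}\in\Delta$ for all $i\in[n]$. The Stanley--Reisner ring is $k[\Delta]=S/I_\Delta$, where $S=k[X_1,\dots,X_n]$ with $\deg X_i=1$ and $I_\Delta$ is generated by all squarefree monomials $X_{i_1}\cdots X_{i_p}$ with $\{i_1,\dots,i_p\}\notin\Delta$. The dimension of a face $F$ is $|F|-1$, facets are maximal faces, and $\dim k[\Delta]=\dim\Delta+1=d$. The multiplicity $e(A)$ equals the number of facets $F$ of $\Delta$ with $\dim F=d-1$. Let $\beta_{i,j}(A)$ be the graded Betti numbers of $A$ over $S$ (from the graded minimal free resolution of $A$ over $S$). The initial degree is $\operatorname{indeg} A=\min\{j:\beta_{1,j}(A)\ne 0\}$, the relation type is $\operatorname{rt}(A)=\max\{j:\beta_{1,j}(A)\neq 0\}$, and the Castelnuovo--Mumford regularity is $\operatorname{reg} A=\max\{j-i:\beta_{i,j}(A)\ne 0\}$. One always has $\operatorname{reg} A\ge \operatorname{indeg} A-1$; $A$ has linear resolution if equality holds, and $A$ has $q$-linear resolution if moreover $\operatorname{indeg} A=q$. *)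

theory Defs
  imports
    "HOL-Library.Poly_Mapping"
    "HOL-Library.Extended_Real"
    "HOL-Computational_Algebra.Polynomial"
    "HOL-Algebra.QuotRing"
    "HOL-Algebra.Embedded_Algebras"
begin

text \<open>A monomial is its exponent vector \<open>nat \<Rightarrow>\<^sub>0 nat\<close>; a polynomial is its coefficient function.\<close>

type_synonym 'k mpoly = "(nat \<Rightarrow>\<^sub>0 nat) \<Rightarrow>\<^sub>0 'k"

definition poly_ring :: "nat \<Rightarrow> 'k::field mpoly ring" where
  "poly_ring n =
    \<lparr>carrier = {p. \<forall>t \<in> Poly_Mapping.keys p. Poly_Mapping.keys t \<subseteq> {1..n}},
     mult = (*), one = 1, zero = 0, add = (+)\<rparr>"

definition indeterminate :: "nat \<Rightarrow> 'k::field mpoly" where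
  "indeterminate i = Poly_Mapping.single (Poly_Mapping.single i 1) 1"

definition const_poly :: "'k::field \<Rightarrow> 'k mpoly" where
  "const_poly c = Poly_Mapping.single 0 c"

definition total_degree :: "(nat \<Rightarrow>\<^sub>0 nat) \<Rightarrow> nat" where
  "total_degree t = (\<Sum>i \<in> Poly_Mapping.keys t. Poly_Mapping.lookup t i)"

definition poly_component :: "nat \<Rightarrow> nat \<Rightarrow> 'k::field mpoly set" where
  "poly_component n m =
    {p \<in> carrier (poly_ring n). \<forall>t \<in> Poly_Mapping.keys p. total_degree t = m}"

definition irrelevant_ideal :: "nat \<Rightarrow> 'k::field mpoly set" where
  "irrelevant_ideal n = genideal (poly_ring n) (indeterminate ` {1..n})"


text \<open>
  An \<open>\<nat>\<close>-graded module over \<^term>\<open>poly_ring n\<close>. Since records for modules extend records for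
  rings, the same record also carries graded algebras; for a mere module the fields
  \<^const>\<open>mult\<close> and \<^const>\<open>one\<close> are meaningless.
\<close>

record ('a, 'm) graded_module = "('a, 'm) module" +
  component :: "nat \<Rightarrow> 'm set"

definition graded_quotient ::
    "nat \<Rightarrow> 'k::field mpoly set \<Rightarrow> ('k mpoly, 'k mpoly set) graded_module" where
  "graded_quotient n I = (let S = poly_ring n; Q = S Quot I in
    \<lparr>carrier = carrier Q, mult = mult Q, one = one Q, zero = zero Q, add = add Q,
     smult = (\<lambda>p a. (I +>\<^bsub>S\<^esub> p) \<otimes>\<^bsub>Q\<^esub> a),
     component = (\<lambda>m. (\<lambda>p. I +>\<^bsub>S\<^esub> p) ` poly_component n m)\<rparr>)"

text \<open>
  The free module \<open>\<Oplus>\<^bsub>b<r\<^esub> S(-\<delta> b)\<close>; an element is its coordinate vector, padded with zeros,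
  and the \<open>b\<close>-th basis vector has degree \<open>\<delta> b\<close>.
\<close>

definition graded_free ::
    "nat \<Rightarrow> nat \<Rightarrow> (nat \<Rightarrow> nat) \<Rightarrow> ('k::field mpoly, nat \<Rightarrow> 'k mpoly) graded_module" where
  "graded_free n r \<delta> =
    \<lparr>carrier = {f. (\<forall>b<r. f b \<in> carrier (poly_ring n)) \<and> (\<forall>b\<ge>r. f b = 0)},
     mult = undefined, one = undefined, zero = (\<lambda>b. 0), add = (\<lambda>f g b. f b + g b),
     smult = (\<lambda>p f b. p * f b),
     component = (\<lambda>m. {f. (\<forall>b<r. f b = 0 \<or> (\<delta> b \<le> m \<and> f b \<in> poly_component n (m - \<delta> b)))
                          \<and> (\<forall>b\<ge>r. f b = 0)})\<rparr>"

definition graded_hom ::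
    "nat \<Rightarrow> ('k::field mpoly, 'm) graded_module \<Rightarrow> ('k mpoly, 'l) graded_module
      \<Rightarrow> ('m \<Rightarrow> 'l) set" where
  "graded_hom n M N =
    {h \<in> carrier M \<rightarrow> carrier N.
      (\<forall>x \<in> carrier M. \<forall>y \<in> carrier M. h (x \<oplus>\<^bsub>M\<^esub> y) = h x \<oplus>\<^bsub>N\<^esub> h y) \<and>
      (\<forall>p \<in> carrier (poly_ring n). \<forall>x \<in> carrier M. h (p \<odot>\<^bsub>M\<^esub> x) = p \<odot>\<^bsub>N\<^esub> h x) \<and>
      (\<forall>m. h ` component M m \<subseteq> component N m)}"

text \<open>
  \<open>\<dots> \<rightarrow> F\<^sub>2 \<rightarrow> F\<^sub>1 \<rightarrow> F\<^sub>0 \<rightarrow> M \<rightarrow> 0\<close> with \<open>F\<^sub>i = \<Oplus>\<^bsub>b<r i\<^esub> S(-\<delta> i b)\<close>, differentials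
  \<open>\<phi> i : F\<^bsub>i+1\<^esub> \<rightarrow> F\<^sub>i\<close> and augmentation \<open>\<epsilon> : F\<^sub>0 \<rightarrow> M\<close>; the last condition is minimality,
  \<open>\<phi> i (F\<^bsub>i+1\<^esub>) \<subseteq> \<mm>F\<^sub>i\<close>.
\<close>

definition minimal_graded_free_resolution ::
    "nat \<Rightarrow> ('k::field mpoly, 'm) graded_module \<Rightarrow> (nat \<Rightarrow> nat) \<Rightarrow> (nat \<Rightarrow> nat \<Rightarrow> nat)
      \<Rightarrow> (nat \<Rightarrow> (nat \<Rightarrow> 'k mpoly) \<Rightarrow> (nat \<Rightarrow> 'k mpoly)) \<Rightarrow> ((nat \<Rightarrow> 'k mpoly) \<Rightarrow> 'm) \<Rightarrow> bool" where
  "minimal_graded_free_resolution n M r \<delta> \<phi> \<epsilon> \<longleftrightarrow>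
    (let F = (\<lambda>i. graded_free n (r i) (\<delta> i)) in
      \<epsilon> \<in> graded_hom n (F 0) M \<and>
      (\<forall>i. \<phi> i \<in> graded_hom n (F (Suc i)) (F i)) \<and>
      \<epsilon> ` carrier (F 0) = carrier M \<and>
      {f \<in> carrier (F 0). \<epsilon> f = \<zero>\<^bsub>M\<^esub>} = \<phi> 0 ` carrier (F 1) \<and>
      (\<forall>i. {f \<in> carrier (F (Suc i)). \<phi> i f = \<zero>\<^bsub>F i\<^esub>}
             = \<phi> (Suc i) ` carrier (F (Suc (Suc i)))) \<and>
      (\<forall>i. \<forall>f \<in> carrier (F (Suc i)). \<forall>b<r i. \<phi> i f b \<in> irrelevant_ideal n))"

text \<open>
  The number of basis elements of degree \<open>j\<close> in the \<open>i\<close>-th term of the minimal graded free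
  resolution. The choice is harmless: for a finitely generated graded module the resolution exists
  and is unique up to isomorphism.
\<close>

definition betti :: "nat \<Rightarrow> ('k::field mpoly, 'm) graded_module \<Rightarrow> nat \<Rightarrow> nat \<Rightarrow> nat" where
  "betti n M =
    (SOME \<beta>. \<exists>r \<delta> \<phi> \<epsilon>. minimal_graded_free_resolution n M r \<delta> \<phi> \<epsilon> \<and>
       (\<forall>i j. \<beta> i j = card {b. b < r i \<and> \<delta> i b = j}))"

text \<open>
  Minima and maxima are taken in extended number types, so that an empty set of degrees gives
  \<open>indeg = \<infinity>\<close> and never an accidental value.
\<close>

definition indeg :: "nat \<Rightarrow> ('k::field mpoly, 'm) graded_module \<Rightarrow> enat" where
  "indeg n M = Inf {enat j | j. betti n M 1 j \<noteq> 0}"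

definition relation_type :: "nat \<Rightarrow> ('k::field mpoly, 'm) graded_module \<Rightarrow> enat" where
  "relation_type n M = Sup {enat j | j. betti n M 1 j \<noteq> 0}"

definition regularity :: "nat \<Rightarrow> ('k::field mpoly, 'm) graded_module \<Rightarrow> ereal" where
  "regularity n M = Sup {ereal (real j - real i) | i j. betti n M i j \<noteq> 0}"

definition has_linear_resolution :: "nat \<Rightarrow> ('k::field mpoly, 'm) graded_module \<Rightarrow> bool" where
  "has_linear_resolution n M \<longleftrightarrow> regularity n M = ereal_of_enat (indeg n M) - 1"

definition has_q_linear_resolution ::
    "nat \<Rightarrow> nat \<Rightarrow> ('k::field mpoly, 'm) graded_module \<Rightarrow> bool" where
  "has_q_linear_resolution q n M \<longleftrightarrow> has_linear_resolution n M \<and> indeg n M = enat q"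


definition krull_dim :: "('a, 'b) ring_scheme \<Rightarrow> enat" where
  "krull_dim R = Sup {enat l | l. \<exists>P. (\<forall>i\<le>l. primeideal (P i) R) \<and> (\<forall>i<l. P i \<subset> P (Suc i))}"

text \<open>The dimension of \<open>A\<^sub>m\<close> over the image of the coefficient field \<open>k\<close> in the graded algebra \<open>A\<close>.\<close>

definition hilbert_function :: "('k::field mpoly, 'm) graded_module \<Rightarrow> nat \<Rightarrow> nat" where
  "hilbert_function A m =
    ring.dim A (range (\<lambda>c. const_poly c \<odot>\<^bsub>A\<^esub> \<one>\<^bsub>A\<^esub>)) (component A m)"

definition hilbert_polynomial :: "('k::field mpoly, 'm) graded_module \<Rightarrow> rat poly" where
  "hilbert_polynomial A =
    (THE P. \<exists>N. \<forall>m\<ge>N. of_nat (hilbert_function A m) = poly P (of_nat m))"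

text \<open>
  In dimension \<open>d \<ge> 1\<close> the Hilbert polynomial has degree \<open>d - 1\<close>, and \<open>e(A)\<close> is \<open>(d - 1)!\<close> times its
  leading coefficient. (In dimension \<open>0\<close> this formula does not give the multiplicity.)
\<close>

definition algebra_multiplicity :: "('k::field mpoly, 'm) graded_module \<Rightarrow> rat" where
  "algebra_multiplicity A =
    fact (degree (hilbert_polynomial A)) * lead_coeff (hilbert_polynomial A)"


definition simplicial_complex :: "nat \<Rightarrow> nat set set \<Rightarrow> bool" where
  "simplicial_complex n \<Delta> \<longleftrightarrow>
    \<Delta> \<subseteq> Pow {1..n} \<and> (\<forall>F \<in> \<Delta>. \<forall>G. G \<subseteq> F \<longrightarrow> G \<in> \<Delta>) \<and> (\<forall>i \<in> {1..n}. {i} \<in> \<Delta>)"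

definition stanley_reisner_ideal :: "nat \<Rightarrow> nat set set \<Rightarrow> 'k::field mpoly set" where
  "stanley_reisner_ideal n \<Delta> =
    genideal (poly_ring n) {\<Prod>i\<in>G. indeterminate i | G. G \<subseteq> {1..n} \<and> G \<notin> \<Delta>}"

definition stanley_reisner_ring ::
    "nat \<Rightarrow> nat set set \<Rightarrow> ('k::field mpoly, 'k mpoly set) graded_module" where
  "stanley_reisner_ring n \<Delta> = graded_quotient n (stanley_reisner_ideal n \<Delta>)"

end

theory Submission
  imports Defs "HOL-Library.Function_Algebras"
begin

text \<open>
  Let \<open>f\<close> be the number of faces with \<open>d\<close> vertices. As \<open>f \<le> d\<close>, every such face \<open>F\<close> has a
  codimension one face \<open>E\<close> that lies in no other face with \<open>d\<close> vertices, so \<open>\<Delta>\<close> can be reduced to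
  the empty complex by successively removing intervals \<open>[E, F]\<close> with \<open>card E \<le> d - 1\<close>. Algebraically
  this filters \<open>k[\<Delta>]\<close> by shifted polynomial rings \<open>S/(X\<^sub>v : v \<notin> F)(- card E)\<close>, whose Koszul homology
  \<open>H\<^sub>i\<close> lives in degree \<open>i + card E\<close>. Hence the Koszul homology \<open>H\<^sub>i\<close> of \<open>k[\<Delta>]\<close> vanishes in degrees
  above \<open>i + d - 1\<close>, and by dimension shifting along a minimal resolution this bounds the degrees
  of its basis elements, so \<open>reg k[\<Delta>] \<le> d - 1\<close>; the reverse inequality follows from \<open>indeg k[\<Delta>] = d\<close>.
  The Krull dimension only enters through the bound \<open>card F \<le> d\<close>, which comes from chains of face
  primes, and the multiplicity through \<open>e = f\<close>. That a minimal resolution exists at all follows by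
  linear algebra, since the syzygies of a squarefree monomial ideal are again determined by their
  squarefree multidegrees.
\<close>

section \<open>Polynomials and monomial ideals\<close>

text \<open>Phrasing cycles and boundaries through chains over \<open>S\<close> modulo a subset
  gives one formalism for ideals and for submodules of free modules; connecting maps become explicit
  liftings of chains. The definition of \<open>betti\<close> by choice shapes the last section: the
  chosen numbers carry information only if some minimal resolution with finite ranks in every step
  exists, so one is constructed. The degree bound is proved for every minimal resolution, hence for
  the chosen one. Finite ranks come from the fact that there are only \<open>2^n\<close> supports,
  each with a finite-dimensional space of coordinate vectors. Relations between squarefree
  generators are again of this form, so the construction can be iterated. The constant
  \<open>d\<close> in \<open>e(A) \<le> d\<close> is the number of codimension one faces of a set
  with \<open>d\<close> elements, and the regularity bound \<open>d - 1\<close> is the largest size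
  of the bottom of a removed interval.\<close>

abbreviation "keys \<equiv> Poly_Mapping.keys"
abbreviation "lookup \<equiv> Poly_Mapping.lookup"
abbreviation "single \<equiv> Poly_Mapping.single"

lemma keys_add_nat: "keys (s + t) = keys s \<union> keys (t :: 'a \<Rightarrow>\<^sub>0 nat)"
  by (auto simp: in_keys_iff lookup_add)

lemma total_degree_superset:
  assumes "finite A" "keys t \<subseteq> A"
  shows "total_degree t = (\<Sum>i\<in>A. lookup t i)"
  unfolding total_degree_def using assms
  by (intro sum.mono_neutral_left) (auto simp: in_keys_iff)

lemma total_degree_add: "total_degree (s + t) = total_degree s + total_degree t"
proof -
  have "total_degree u = (\<Sum>i\<in>keys s \<union> keys t. lookup u i)" if "u \<in> {s, t, s + t}" for u
    using that by (intro total_degree_superset) (auto simp: keys_add_nat)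
  then show ?thesis by (simp add: lookup_add sum.distrib)
qed

lemma total_degree_0 [simp]: "total_degree 0 = 0"
  by (simp add: total_degree_def)

definition sqfree :: "nat set \<Rightarrow> (nat \<Rightarrow>\<^sub>0 nat)" where
  "sqfree E = (\<Sum>i\<in>E. single i 1)"

lemma lookup_sqfree: "finite E \<Longrightarrow> lookup (sqfree E) i = (if i \<in> E then 1 else 0)"
  by (simp add: sqfree_def lookup_sum lookup_single when_def)

lemma keys_sqfree [simp]: "finite E \<Longrightarrow> keys (sqfree E) = E"
  by (auto simp: in_keys_iff lookup_sqfree split: if_splits)

lemma total_degree_sqfree [simp]: "finite E \<Longrightarrow> total_degree (sqfree E) = card E"
  by (simp add: total_degree_def lookup_sqfree)

lemma sqfree_empty [simp]: "sqfree {} = 0"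
  by (simp add: sqfree_def)

lemma sqfree_singleton [simp]: "sqfree {v} = single v 1"
  by (simp add: sqfree_def)

lemma sqfree_diff:
  assumes "finite T" "S \<subseteq> T"
  shows "sqfree (T - S) + sqfree S = sqfree T"
  unfolding sqfree_def by (rule sum.subset_diff[OF assms(2,1), symmetric])

lemma minus_sqfree:
  assumes "finite E" "E \<subseteq> keys u"
  shows "u - sqfree E + sqfree E = u"
proof (rule poly_mapping_eqI)
  fix i
  show "lookup (u - sqfree E + sqfree E) i = lookup u i"
    using assms by (auto simp: lookup_add lookup_minus lookup_sqfree in_keys_iff subset_iff)
qed

lemma lookup_single_mult:
  fixes p :: "('a::cancel_comm_monoid_add) \<Rightarrow>\<^sub>0 'b::comm_semiring_1"
  shows "lookup (single s c * p) (s + t) = c * lookup p t"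
proof -
  show ?thesis
    by (simp add: lookup_mult lookup_single when_mult)
qed

lemma lookup_single_mult_if:
  fixes p :: "('a \<Rightarrow>\<^sub>0 nat) \<Rightarrow>\<^sub>0 'b::comm_semiring_1"
  shows "lookup (single s c * p) u = (if \<exists>t. u = s + t then c * lookup p (u - s) else 0)"
proof (cases "\<exists>t. u = s + t")
  case True
  then show ?thesis by (auto simp: lookup_single_mult)
next
  case False
  then show ?thesis by (simp add: lookup_mult lookup_single when_mult)
qed

lemma in_keys_single_multD:
  fixes p :: "('a \<Rightarrow>\<^sub>0 nat) \<Rightarrow>\<^sub>0 'b::comm_semiring_1"
  assumes "u \<in> keys (single s c * p)"
  obtains t where "t \<in> keys p" "u = s + t"
proof -
  from assms obtain t where "u = s + t" "c * lookup p t \<noteq> 0"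
    by (auto simp: in_keys_iff lookup_single_mult_if split: if_splits)
  then show thesis using that[of t] by (metis in_keys_iff mult_zero_right)
qed

text \<open>Division by the monomial is precomposition of the coefficient function with adding
  \<open>s\<close>.\<close>

lemma monomial_dividesI:
  fixes p :: "('a \<Rightarrow>\<^sub>0 nat) \<Rightarrow>\<^sub>0 'b::comm_semiring_1"
  assumes "\<And>u. u \<in> keys p \<Longrightarrow> \<exists>t. u = s + t"
  obtains q where "p = single s 1 * q"
proof
  have "lookup (Poly_Mapping.map_key ((+) s) p) t = lookup p (s + t)" for t
    by (simp add: map_key.rep_eq)
  then show "p = single s 1 * Poly_Mapping.map_key ((+) s) p"
    using assms by (intro poly_mapping_eqI) (auto simp: lookup_single_mult_if in_keys_iff)
qed

definition restrict_poly :: "('a \<Rightarrow> bool) \<Rightarrow> ('a \<Rightarrow>\<^sub>0 'b::zero) \<Rightarrow> ('a \<Rightarrow>\<^sub>0 'b)" where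
  "restrict_poly P p = Poly_Mapping.mapp (\<lambda>t c. if P t then c else 0) p"

lemma lookup_restrict_poly: "lookup (restrict_poly P p) t = (if P t then lookup p t else 0)"
  by (auto simp: restrict_poly_def lookup_mapp in_keys_iff when_def)

lemma keys_restrict_poly: "keys (restrict_poly P p) = {t \<in> keys p. P t}"
  by (auto simp: in_keys_iff lookup_restrict_poly split: if_splits)

lemma poly_ring_simps [simp]:
  "mult (poly_ring n) = (*)" "one (poly_ring n) = 1" "zero (poly_ring n) = 0" "add (poly_ring n) = (+)"
  by (simp_all add: poly_ring_def)

lemma poly_carrier_iff: "p \<in> carrier (poly_ring n) \<longleftrightarrow> (\<forall>t\<in>keys p. keys t \<subseteq> {1..n})"
  by (simp add: poly_ring_def)

lemma poly_carrier_iff_lookup: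
  "p \<in> carrier (poly_ring n) \<longleftrightarrow> (\<forall>t. \<not> keys t \<subseteq> {1..n} \<longrightarrow> lookup p t = 0)"
  by (auto simp: poly_carrier_iff in_keys_iff)

lemma poly_carrier_closed [simp, intro]:
  "0 \<in> carrier (poly_ring n)" "1 \<in> carrier (poly_ring n)"
  "p \<in> carrier (poly_ring n) \<Longrightarrow> - p \<in> carrier (poly_ring n)"
  "p \<in> carrier (poly_ring n) \<Longrightarrow> q \<in> carrier (poly_ring n) \<Longrightarrow> p + q \<in> carrier (poly_ring n)"
  "p \<in> carrier (poly_ring n) \<Longrightarrow> q \<in> carrier (poly_ring n) \<Longrightarrow> p - q \<in> carrier (poly_ring n)"
  by (auto simp: poly_carrier_iff_lookup lookup_add lookup_minus lookup_one when_def)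

lemma poly_carrier_mult [simp, intro]:
  assumes "p \<in> carrier (poly_ring n)" "q \<in> carrier (poly_ring n)"
  shows "p * q \<in> carrier (poly_ring n)"
  unfolding poly_carrier_iff
proof
  fix t assume "t \<in> keys (p * q)"
  then obtain a b where "t = a + b" "a \<in> keys p" "b \<in> keys q"
    using keys_mult[of p q] by blast
  with assms show "keys t \<subseteq> {1..n}"
    by (auto simp: keys_add_nat poly_carrier_iff)
qed

lemma poly_carrier_sum [intro]:
  "(\<And>i. i \<in> I \<Longrightarrow> f i \<in> carrier (poly_ring n)) \<Longrightarrow> sum f I \<in> carrier (poly_ring n)"
  by (induction I rule: infinite_finite_induct) auto

lemma poly_carrier_single [simp, intro]: "keys s \<subseteq> {1..n} \<Longrightarrow> single s c \<in> carrier (poly_ring n)"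
  by (auto simp: poly_carrier_iff)

lemma poly_carrier_indeterminate [simp, intro]:
  "v \<in> {1..n} \<Longrightarrow> indeterminate v \<in> carrier (poly_ring n)"
  by (simp add: indeterminate_def)

text \<open>Here \<Gamma> lists the supports that survive in the quotient, so membership is tested
  coefficient by coefficient and \<Gamma> can shrink along a filtration. All variables are allowed;
  the ideal of \<open>poly_ring n\<close> is the intersection with its carrier.\<close>

definition mon_ideal :: "nat set set \<Rightarrow> 'k::field mpoly set" where
  "mon_ideal \<Gamma> = {p. \<forall>t. keys t \<in> \<Gamma> \<longrightarrow> lookup p t = 0}"

lemma mon_ideal_closed [simp, intro]:
  "0 \<in> mon_ideal \<Gamma>"
  "p \<in> mon_ideal \<Gamma> \<Longrightarrow> - p \<in> mon_ideal \<Gamma>"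
  "p \<in> mon_ideal \<Gamma> \<Longrightarrow> q \<in> mon_ideal \<Gamma> \<Longrightarrow> p + q \<in> mon_ideal \<Gamma>"
  "p \<in> mon_ideal \<Gamma> \<Longrightarrow> q \<in> mon_ideal \<Gamma> \<Longrightarrow> p - q \<in> mon_ideal \<Gamma>"
  by (auto simp: mon_ideal_def lookup_add lookup_minus)

lemma mon_ideal_sum [intro]: "(\<And>i. i \<in> I \<Longrightarrow> f i \<in> mon_ideal \<Gamma>) \<Longrightarrow> sum f I \<in> mon_ideal \<Gamma>"
  by (induction I rule: infinite_finite_induct) auto

lemma mon_ideal_mono: "\<Gamma>' \<subseteq> \<Gamma> \<Longrightarrow> mon_ideal \<Gamma> \<subseteq> mon_ideal \<Gamma>'"
  by (auto simp: mon_ideal_def)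

lemma mon_ideal_empty [simp]: "mon_ideal {} = UNIV"
  by (auto simp: mon_ideal_def)

definition down_closed :: "nat set set \<Rightarrow> bool" where
  "down_closed \<Gamma> \<longleftrightarrow> (\<forall>F\<in>\<Gamma>. \<forall>G. G \<subseteq> F \<longrightarrow> G \<in> \<Gamma>)"

lemma down_closedD: "down_closed \<Gamma> \<Longrightarrow> F \<in> \<Gamma> \<Longrightarrow> G \<subseteq> F \<Longrightarrow> G \<in> \<Gamma>"
  by (auto simp: down_closed_def)

lemma down_closed_Pow [simp]: "down_closed (Pow F)"
  by (auto simp: down_closed_def)

lemma mon_ideal_mult [intro]:
  assumes "down_closed \<Gamma>" "p \<in> mon_ideal \<Gamma>"
  shows "q * p \<in> mon_ideal \<Gamma>"
  unfolding mon_ideal_def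
proof safe
  fix t :: "nat \<Rightarrow>\<^sub>0 nat" assume t: "keys t \<in> \<Gamma>"
  show "lookup (q * p) t = 0"
  proof (rule ccontr)
    assume "lookup (q * p) t \<noteq> 0"
    then obtain a b where ab: "t = a + b" "b \<in> keys p"
      using keys_mult[of q p] by (auto simp: in_keys_iff)
    then have "keys b \<in> \<Gamma>"
      using t down_closedD[OF assms(1) t, of "keys b"] by (auto simp: keys_add_nat)
    with assms(2) ab show False by (auto simp: mon_ideal_def in_keys_iff)
  qed
qed

section \<open>Koszul chains\<close>

text \<open>The sign of sorting the product of \<open>e\<^sub>v\<close> and
  \<open>e\<^sub>\<tau>\<close>: the factor \<open>e\<^sub>v\<close> moves past the smaller elements
  of \<tau>.\<close>

definition ksign :: "nat \<Rightarrow> nat set \<Rightarrow> 'a::comm_ring_1" where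
  "ksign v \<tau> = (-1) ^ card {w \<in> \<tau>. w < v}"

text \<open>
  Koszul chains on the variables \<open>X\<^sub>1, \<dots>, X\<^sub>n\<close>: the value at \<open>\<sigma>\<close> is the coefficient of
  \<open>e\<^sub>\<sigma>\<close> in the exterior algebra, and \<open>e\<^sub>\<sigma>\<close> has degree \<open>card \<sigma>\<close>.
\<close>

definition kdiff :: "nat \<Rightarrow> (nat set \<Rightarrow> 'k::field mpoly) \<Rightarrow> nat set \<Rightarrow> 'k mpoly" where
  "kdiff n z \<tau> = (\<Sum>v\<in>{1..n} - \<tau>. ksign v \<tau> * (indeterminate v * z (insert v \<tau>)))"

text \<open>Exterior multiplication by \<open>e\<^sub>v\<close> from the left, read off at each
  basis element.\<close>

definition kwedge :: "nat \<Rightarrow> (nat set \<Rightarrow> 'k::field mpoly) \<Rightarrow> nat set \<Rightarrow> 'k mpoly" where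
  "kwedge v y \<sigma> = (if v \<in> \<sigma> then ksign v (\<sigma> - {v}) * y (\<sigma> - {v}) else 0)"

definition kchain :: "nat \<Rightarrow> nat \<Rightarrow> nat \<Rightarrow> (nat set \<Rightarrow> 'k::field mpoly) \<Rightarrow> bool" where
  "kchain n i j z \<longleftrightarrow> (\<forall>\<sigma>. \<forall>t\<in>keys (z \<sigma>).
     keys t \<subseteq> {1..n} \<and> \<sigma> \<subseteq> {1..n} \<and> card \<sigma> = i \<and> total_degree t + i = j)"

lemma ksign_insert:
  assumes "u \<notin> \<tau>"
  shows "ksign v (insert u \<tau>) = (if u < v then - ksign v \<tau> else ksign v \<tau>)"
proof (cases "u < v")
  case True
  then have "{w \<in> insert u \<tau>. w < v} = insert u {w \<in> \<tau>. w < v}" by auto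
  moreover have "finite {w \<in> \<tau>. w < v}" by (rule finite_subset[of _ "{..<v}"]) auto
  ultimately show ?thesis using assms True by (simp add: ksign_def)
next
  case False
  then have "{w \<in> insert u \<tau>. w < v} = {w \<in> \<tau>. w < v}" by auto
  then show ?thesis using False by (simp add: ksign_def)
qed

lemma ksign_square [simp]: "ksign v \<tau> * ksign v \<tau> = 1"
  by (simp add: ksign_def flip: power_mult_distrib)

lemma ksign_square_left [simp]: "ksign v \<tau> * (ksign v \<tau> * x) = x"
  by (simp flip: mult.assoc)

lemma ksign_swap:
  assumes "u \<noteq> v" "u \<notin> \<tau>" "v \<notin> \<tau>"
  shows "ksign u (insert v \<tau>) * ksign v \<tau> = - (ksign v (insert u \<tau>) * ksign u \<tau>)"
  using assms by (auto simp: ksign_insert)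

text \<open>The terms cancel in pairs. Showing that the sum equals its own negative would prove
  nothing in characteristic two, hence the induction on \<open>A\<close>.\<close>

lemma sum_antisymmetric_eq_0:
  fixes g :: "'a \<Rightarrow> 'a \<Rightarrow> 'b::ab_group_add"
  assumes "finite A" "\<And>u v. u \<in> A \<Longrightarrow> v \<in> A \<Longrightarrow> u \<noteq> v \<Longrightarrow> g u v = - g v u"
  shows "(\<Sum>u\<in>A. \<Sum>v\<in>A - {u}. g u v) = 0"
  using assms
proof (induction A rule: finite_induct)
  case (insert x A)
  have "(\<Sum>v\<in>insert x A - {u}. g u v) = g u x + (\<Sum>v\<in>A - {u}. g u v)" if "u \<in> A" for u
  proof -
    have "insert x A - {u} = insert x (A - {u})" using that insert.hyps by auto
    then show ?thesis using insert.hyps by simp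
  qed
  then have "(\<Sum>u\<in>A. \<Sum>v\<in>insert x A - {u}. g u v)
      = (\<Sum>u\<in>A. g u x) + (\<Sum>u\<in>A. \<Sum>v\<in>A - {u}. g u v)"
    by (simp add: sum.distrib)
  also have "(\<Sum>u\<in>A. \<Sum>v\<in>A - {u}. g u v) = 0"
    by (rule insert.IH) (rule insert.prems, auto)
  also have "(\<Sum>u\<in>A. g u x) = (\<Sum>u\<in>A. - g x u)"
  proof (intro sum.cong refl)
    fix u assume "u \<in> A"
    then show "g u x = - g x u" using insert.hyps by (intro insert.prems) auto
  qed
  finally show ?case using insert.hyps by (simp add: sum_negf)
qed auto

lemma kdiff_kdiff: "kdiff n (kdiff n z) \<tau> = 0"
proof -
  define A where "A = {1..n} - \<tau>"
  define g where "g = (\<lambda>u v. ksign u \<tau> * (indeterminate u *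
      (ksign v (insert u \<tau>) * (indeterminate v * z (insert v (insert u \<tau>))))))"
  have "kdiff n (kdiff n z) \<tau> = (\<Sum>u\<in>A. \<Sum>v\<in>A - {u}. g u v)"
  proof -
    have "{1..n} - insert u \<tau> = A - {u}" for u by (auto simp: A_def)
    then show ?thesis
      by (simp add: kdiff_def sum_distrib_left g_def A_def)
  qed
  also have "\<dots> = 0"
  proof (rule sum_antisymmetric_eq_0)
    fix u v assume uv: "u \<in> A" "v \<in> A" "u \<noteq> v"
    have "g u v = (ksign v (insert u \<tau>) * ksign u \<tau>)
        * (indeterminate u * indeterminate v * z (insert u (insert v \<tau>)))"
      by (simp add: g_def insert_commute mult_ac)
    also have "ksign v (insert u \<tau>) * ksign u \<tau> = (- (ksign u (insert v \<tau>) * ksign v \<tau>) :: 'a mpoly)"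
      using uv by (intro ksign_swap) (auto simp: A_def)
    finally show "g u v = - g v u"
      by (simp add: g_def mult_ac)
  qed (simp add: A_def)
  finally show ?thesis .
qed

lemma kdiff_add: "kdiff n (\<lambda>\<sigma>. y \<sigma> + z \<sigma>) \<tau> = kdiff n y \<tau> + kdiff n z \<tau>"
  by (simp add: kdiff_def distrib_left sum.distrib)

lemma kdiff_diff: "kdiff n (\<lambda>\<sigma>. y \<sigma> - z \<sigma>) \<tau> = kdiff n y \<tau> - kdiff n z \<tau>"
  by (simp add: kdiff_def right_diff_distrib sum_subtractf)

lemma kdiff_mult: "kdiff n (\<lambda>\<sigma>. c * z \<sigma>) \<tau> = c * kdiff n z \<tau>"
  by (simp add: kdiff_def sum_distrib_left mult_ac)

lemma kdiff_in_mon_ideal: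
  "down_closed \<Gamma> \<Longrightarrow> (\<And>\<sigma>. z \<sigma> \<in> mon_ideal \<Gamma>) \<Longrightarrow> kdiff n z \<tau> \<in> mon_ideal \<Gamma>"
  unfolding kdiff_def by (intro mon_ideal_sum mon_ideal_mult) auto

lemma kwedge_in_mon_ideal:
  "down_closed \<Gamma> \<Longrightarrow> (\<And>\<sigma>. z \<sigma> \<in> mon_ideal \<Gamma>) \<Longrightarrow> kwedge v z \<tau> \<in> mon_ideal \<Gamma>"
  unfolding kwedge_def by (auto intro!: mon_ideal_mult)

text \<open>Multiplication by \<open>X\<^sub>v\<close> is null-homotopic on the Koszul complex, with
  exterior multiplication by \<open>e\<^sub>v\<close> as the homotopy. Consequently
  \<open>X\<^sub>v\<close> annihilates Koszul homology.\<close>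

lemma kdiff_kwedge:
  assumes v: "v \<in> {1..n}"
  shows "kdiff n (kwedge v y) \<tau> + kwedge v (kdiff n y) \<tau> = indeterminate v * y \<tau>"
proof (cases "v \<in> \<tau>")
  case False
  have "kdiff n (kwedge v y) \<tau> = (\<Sum>u\<in>{1..n} - \<tau>. if u = v then indeterminate v * y \<tau> else 0)"
    unfolding kdiff_def
  proof (intro sum.cong refl)
    fix u assume "u \<in> {1..n} - \<tau>"
    then show "ksign u \<tau> * (indeterminate u * kwedge v y (insert u \<tau>))
        = (if u = v then indeterminate v * y \<tau> else 0)"
      using False by (auto simp: kwedge_def mult_ac)
  qed
  also have "\<dots> = indeterminate v * y \<tau>" using v False by simp
  finally show ?thesis using False by (simp add: kwedge_def)
next
  case True
  define \<rho> where "\<rho> = \<tau> - {v}"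
  have \<tau>: "\<tau> = insert v \<rho>" and nin: "v \<notin> \<rho>" using True by (auto simp: \<rho>_def)
  \<comment> \<open>The summand for \<open>v\<close> itself yields the right-hand side; the
    remaining ones cancel against the other composite.\<close>
  have set: "{1..n} - \<rho> = insert v ({1..n} - \<tau>)" using v \<tau> nin by auto
  have "kwedge v (kdiff n y) \<tau>
      = ksign v \<rho> * (ksign v \<rho> * (indeterminate v * y \<tau>)
        + (\<Sum>u\<in>{1..n} - \<tau>. ksign u \<rho> * (indeterminate u * y (insert u \<rho>))))"
    unfolding kdiff_def kwedge_def \<rho>_def[symmetric] set using True
    by (simp add: \<tau>)
  also have "\<dots> = indeterminate v * y \<tau>
      + (\<Sum>u\<in>{1..n} - \<tau>. ksign v \<rho> * ksign u \<rho> * (indeterminate u * y (insert u \<rho>)))"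
    by (simp add: distrib_left sum_distrib_left mult_ac)
  also have "(\<Sum>u\<in>{1..n} - \<tau>. ksign v \<rho> * ksign u \<rho> * (indeterminate u * y (insert u \<rho>)))
      = - kdiff n (kwedge v y) \<tau>"
    unfolding kdiff_def sum_negf[symmetric]
  proof (intro sum.cong refl)
    fix u assume u: "u \<in> {1..n} - \<tau>"
    then have uv: "u \<noteq> v" "u \<notin> \<rho>" using \<tau> by auto
    have "insert u \<tau> - {v} = insert u \<rho>" using uv by (auto simp: \<rho>_def)
    then have "kwedge v y (insert u \<tau>) = ksign v (insert u \<rho>) * y (insert u \<rho>)"
      using True by (simp add: kwedge_def)
    moreover have "ksign v \<rho> * ksign u \<rho> = (- (ksign u \<tau> * ksign v (insert u \<rho>)) :: 'a mpoly)"
      unfolding \<tau> using uv nin by (auto simp: ksign_insert)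
    ultimately show "ksign v \<rho> * ksign u \<rho> * (indeterminate u * y (insert u \<rho>))
        = - (ksign u \<tau> * (indeterminate u * kwedge v y (insert u \<tau>)))"
      by (simp add: mult_ac)
  qed
  finally show ?thesis by simp
qed

lemma ksign_eq: "ksign v \<tau> = (1 :: 'a::comm_ring_1) \<or> ksign v \<tau> = (-1 :: 'a)"
  unfolding ksign_def by (cases "even (card {w \<in> \<tau>. w < v})") auto

lemma keys_ksign_mult: "keys (ksign v \<tau> * p) = keys (p :: 'k::field mpoly)"
  using ksign_eq[of v \<tau>, where 'a = "'k mpoly"] by (auto simp: in_keys_iff)

lemma kchainD:
  assumes "kchain n i j z" "t \<in> keys (z \<sigma>)"
  shows "keys t \<subseteq> {1..n}" "\<sigma> \<subseteq> {1..n}" "card \<sigma> = i" "total_degree t + i = j"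
  using assms by (auto simp: kchain_def)

lemma kchain_0 [simp]: "kchain n i j (\<lambda>_. 0)"
  by (simp add: kchain_def)

lemma kchain_add:
  assumes "kchain n i j y" "kchain n i j z"
  shows "kchain n i j (\<lambda>\<sigma>. y \<sigma> + z \<sigma>)"
proof -
  have "t \<in> keys (y \<sigma>) \<or> t \<in> keys (z \<sigma>)" if "t \<in> keys (y \<sigma> + z \<sigma>)" for t \<sigma>
    using that by (auto simp: in_keys_iff lookup_add)
  then show ?thesis using assms unfolding kchain_def by blast
qed

lemma kchain_diff:
  assumes "kchain n i j y" "kchain n i j z"
  shows "kchain n i j (\<lambda>\<sigma>. y \<sigma> - z \<sigma>)"
proof -
  have "t \<in> keys (y \<sigma>) \<or> t \<in> keys (z \<sigma>)" if "t \<in> keys (y \<sigma> - z \<sigma>)" for t \<sigma>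
    using that by (auto simp: in_keys_iff lookup_minus)
  then show ?thesis using assms unfolding kchain_def by blast
qed

lemma keys_indeterminate_mult:
  assumes "u \<in> keys (indeterminate v * p)"
  obtains t where "t \<in> keys p" "u = single v 1 + t"
  using assms unfolding indeterminate_def by (rule in_keys_single_multD)

lemma total_degree_single [simp]: "total_degree (single v 1) = 1"
  by (simp add: total_degree_def)

lemma kchain_kdiff:
  assumes "kchain n (Suc i) j w"
  shows "kchain n i j (kdiff n w)"
  unfolding kchain_def
proof safe
  fix \<tau> t assume "t \<in> keys (kdiff n w \<tau>)"
  then obtain v where v: "v \<in> {1..n} - \<tau>"
    "t \<in> keys (ksign v \<tau> * (indeterminate v * w (insert v \<tau>)))"
    unfolding kdiff_def in_keys_iff lookup_sum by (metis (no_types, lifting) sum.neutral)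
  then obtain s where s: "s \<in> keys (w (insert v \<tau>))" "t = single v 1 + s"
    unfolding keys_ksign_mult by (metis keys_indeterminate_mult)
  note c = kchainD[OF assms s(1)]
  show "x \<in> {1..n}" if "x \<in> keys t" for x
    using that c(1) v s by (auto simp: keys_add_nat)
  show "x \<in> {1..n}" if "x \<in> \<tau>" for x using that c(2) by auto
  have "finite (insert v \<tau>)" by (rule finite_subset[OF c(2)]) simp
  then have "finite \<tau>" by simp
  then show "card \<tau> = i" using c(3) v by simp
  show "total_degree t + i = j" using c(4) s by (simp add: total_degree_add del: One_nat_def)
qed

lemma kchain_kwedge:
  assumes "kchain n i j y" "v \<in> {1..n}"
  shows "kchain n (Suc i) (Suc j) (kwedge v y)"
  unfolding kchain_def
proof (intro allI ballI)
  fix \<sigma> t assume "t \<in> keys (kwedge v y \<sigma>)"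
  then have t: "v \<in> \<sigma>" "t \<in> keys (y (\<sigma> - {v}))"
    by (auto simp: kwedge_def keys_ksign_mult split: if_splits)
  note c = kchainD[OF assms(1) t(2)]
  have "finite (\<sigma> - {v})" by (rule finite_subset[OF c(2)]) simp
  then have "finite \<sigma>" by simp
  then have "card \<sigma> = Suc i" using card.remove[of \<sigma> v] t c(3) by metis
  moreover have "\<sigma> \<subseteq> {1..n}" using c(2) assms(2) by blast
  ultimately show "keys t \<subseteq> {1..n} \<and> \<sigma> \<subseteq> {1..n} \<and> card \<sigma> = Suc i \<and> total_degree t + Suc i = Suc j"
    using c(1,4) by simp
qed

lemma kchain_monomial_mult:
  assumes "kchain n i j z" "E \<subseteq> {1..n}"
  shows "kchain n i (j + card E) (\<lambda>\<sigma>. single (sqfree E) c * z \<sigma>)"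
  unfolding kchain_def
proof (intro allI ballI)
  fix \<sigma> t assume "t \<in> keys (single (sqfree E) c * z \<sigma>)"
  then obtain s where s: "s \<in> keys (z \<sigma>)" "t = sqfree E + s"
    by (rule in_keys_single_multD)
  have "finite E" using assms(2) finite_subset by blast
  then show "keys t \<subseteq> {1..n} \<and> \<sigma> \<subseteq> {1..n} \<and> card \<sigma> = i \<and> total_degree t + i = j + card E"
    using kchainD[OF assms(1) s(1)] s assms(2) by (auto simp: keys_add_nat total_degree_add)
qed

text \<open>
  Vanishing of the Koszul homology \<open>H\<^sub>i(X\<^sub>1, \<dots>, X\<^sub>n; S/I)\<close> in degree \<open>j\<close>, phrased with chains over
  \<open>S\<close> that are cycles and boundaries modulo \<open>I\<close>.
\<close>

definition koszul_exact :: "nat \<Rightarrow> 'k::field mpoly set \<Rightarrow> nat \<Rightarrow> nat \<Rightarrow> bool" where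
  "koszul_exact n I i j \<longleftrightarrow> (\<forall>z. kchain n i j z \<and> (\<forall>\<tau>. kdiff n z \<tau> \<in> I) \<longrightarrow>
     (\<exists>w. kchain n (Suc i) j w \<and> (\<forall>\<sigma>. z \<sigma> - kdiff n w \<sigma> \<in> I)))"

lemma koszul_exactD:
  assumes "koszul_exact n I i j" "kchain n i j z" "\<And>\<tau>. kdiff n z \<tau> \<in> I"
  obtains w where "kchain n (Suc i) j w" "\<And>\<sigma>. z \<sigma> - kdiff n w \<sigma> \<in> I"
  using assms unfolding koszul_exact_def by blast

text \<open>
  One step of a filtration of \<open>k[\<Gamma>]\<close>: the kernel of \<open>k[\<Gamma>] \<rightarrow> k[\<Gamma>']\<close> is the cyclic module
  generated by \<open>X\<^sup>E\<close>, and the annihilator of \<open>X\<^sup>E\<close> is generated by the variables outside \<open>F\<close>.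
\<close>

lemma koszul_exact_step:
  fixes \<Gamma> :: "nat set set"
  assumes \<Gamma>: "down_closed \<Gamma>" and E: "E \<subseteq> {1..n}" "E \<subseteq> F" and F: "F \<in> \<Gamma>"
    and EF: "\<And>G. G \<in> \<Gamma> \<Longrightarrow> E \<subseteq> G \<Longrightarrow> G \<subseteq> F"
    and Q: "koszul_exact n (mon_ideal {G \<in> \<Gamma>. \<not> E \<subseteq> G} :: 'k::field mpoly set) i j"
    and H: "\<And>y :: nat set \<Rightarrow> 'k mpoly. kchain n i (j - card E) y \<Longrightarrow> (\<And>\<tau>. kdiff n y \<tau> \<in> mon_ideal (Pow F)) \<Longrightarrow>
      \<exists>w. kchain n (Suc i) j w \<and>
        (\<forall>\<sigma>. single (sqfree E) 1 * y \<sigma> - kdiff n w \<sigma> \<in> mon_ideal \<Gamma>)"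
  shows "koszul_exact n (mon_ideal \<Gamma> :: 'k mpoly set) i j"
  unfolding koszul_exact_def
proof safe
  fix z :: "nat set \<Rightarrow> 'k mpoly"
  assume z: "kchain n i j z" and dz: "\<forall>\<tau>. kdiff n z \<tau> \<in> mon_ideal \<Gamma>"
  have finE: "finite E" using E(1) finite_subset by blast
  define \<Gamma>' where "\<Gamma>' = {G \<in> \<Gamma>. \<not> E \<subseteq> G}"
  have "mon_ideal \<Gamma> \<subseteq> (mon_ideal \<Gamma>' :: 'k mpoly set)" by (rule mon_ideal_mono) (auto simp: \<Gamma>'_def)
  then have "kdiff n z \<tau> \<in> mon_ideal \<Gamma>'" for \<tau> using dz by blast
  from koszul_exactD[OF Q[folded \<Gamma>'_def] z this]
  obtain w where w: "kchain n (Suc i) j w" and zw: "\<And>\<sigma>. z \<sigma> - kdiff n w \<sigma> \<in> mon_ideal \<Gamma>'"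
    by blast
  \<comment> \<open>Modulo the ideal of \<open>\<Gamma>'\<close> nothing of \<open>a\<close> is
    left, so its monomials with support in \<Gamma>, collected in \<open>a1\<close>, are all
    multiples of \<open>X\<^sup>E\<close>; the rest \<open>a2\<close> lies in the ideal of \<Gamma>.
    Thus \<open>a1\<close> represents a class of the kernel.\<close>
  define a where "a \<sigma> = z \<sigma> - kdiff n w \<sigma>" for \<sigma>
  define a1 where "a1 \<sigma> = restrict_poly (\<lambda>t. keys t \<in> \<Gamma>) (a \<sigma>)" for \<sigma>
  define a2 where "a2 \<sigma> = a \<sigma> - a1 \<sigma>" for \<sigma>
  have a: "kchain n i j a"
    unfolding a_def by (intro kchain_diff z kchain_kdiff w)
  have "kdiff n a \<tau> = kdiff n z \<tau>" for \<tau>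
    unfolding a_def by (simp add: kdiff_diff kdiff_kdiff)
  then have da: "kdiff n a \<tau> \<in> mon_ideal \<Gamma>" for \<tau> using dz by simp
  have a2: "a2 \<sigma> \<in> mon_ideal \<Gamma>" for \<sigma>
    by (simp add: a2_def a1_def mon_ideal_def lookup_minus lookup_restrict_poly)
  have "\<exists>y. a1 \<sigma> = single (sqfree E) 1 * y" for \<sigma>
  proof -
    have "\<exists>t. u = sqfree E + t" if "u \<in> keys (a1 \<sigma>)" for u
    proof -
      from that have u: "keys u \<in> \<Gamma>" "u \<in> keys (a \<sigma>)" by (auto simp: a1_def keys_restrict_poly)
      then have "E \<subseteq> keys u" using zw[of \<sigma>] by (auto simp: a_def \<Gamma>'_def mon_ideal_def in_keys_iff)
      from minus_sqfree[OF finE this] have "u = sqfree E + (u - sqfree E)" by (simp add: add.commute)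
      then show ?thesis by blast
    qed
    then show ?thesis using monomial_dividesI[of "a1 \<sigma>" "sqfree E"] by metis
  qed
  then obtain y where y: "\<And>\<sigma>. a1 \<sigma> = single (sqfree E) 1 * y \<sigma>" by metis
  have cy: "kchain n i (j - card E) y"
    unfolding kchain_def
  proof (intro allI ballI)
    fix \<sigma> t assume "t \<in> keys (y \<sigma>)"
    then have "sqfree E + t \<in> keys (a1 \<sigma>)"
      unfolding y in_keys_iff lookup_single_mult by simp
    then have "sqfree E + t \<in> keys (a \<sigma>)" by (simp add: a1_def keys_restrict_poly)
    from kchainD[OF a this] show "keys t \<subseteq> {1..n} \<and> \<sigma> \<subseteq> {1..n} \<and> card \<sigma> = i \<and> total_degree t + i = j - card E"
      using finE by (simp add: keys_add_nat total_degree_add)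
  qed
  \<comment> \<open>Dividing by \<open>X\<^sup>E\<close> keeps the cycle condition: if
    \<open>keys t \<subseteq> F\<close>, then the support of the product of \<open>X\<^sup>E\<close>
    with that monomial stays inside the face \<open>F\<close>, where the coefficients of the
    boundary of \<open>a1\<close> are known to vanish.\<close>
  have dy: "kdiff n y \<tau> \<in> mon_ideal (Pow F)" for \<tau>
    unfolding mon_ideal_def
  proof safe
    fix t :: "nat \<Rightarrow>\<^sub>0 nat" assume t: "keys t \<subseteq> F"
    have "kdiff n a \<tau> = kdiff n a1 \<tau> + kdiff n a2 \<tau>"
      by (simp add: a2_def flip: kdiff_add)
    moreover have "kdiff n a2 \<tau> \<in> mon_ideal \<Gamma>" by (intro kdiff_in_mon_ideal \<Gamma> a2)
    ultimately have "kdiff n a1 \<tau> \<in> mon_ideal \<Gamma>"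
      using da[of \<tau>] mon_ideal_closed(4)[of "kdiff n a \<tau>" \<Gamma> "kdiff n a2 \<tau>"] by simp
    moreover have "kdiff n a1 \<tau> = single (sqfree E) 1 * kdiff n y \<tau>"
      unfolding kdiff_mult[symmetric] y[symmetric] ..
    moreover have "keys (sqfree E + t) \<in> \<Gamma>"
      using t E(2) finE by (intro down_closedD[OF \<Gamma> F]) (auto simp: keys_add_nat)
    ultimately have "lookup (single (sqfree E) 1 * kdiff n y \<tau>) (sqfree E + t) = 0"
      by (auto simp: mon_ideal_def)
    then show "lookup (kdiff n y \<tau>) t = 0" by (simp add: lookup_single_mult)
  qed
  from H[OF cy dy] obtain w' where w': "kchain n (Suc i) j w'"
    and yw: "\<And>\<sigma>. single (sqfree E) 1 * y \<sigma> - kdiff n w' \<sigma> \<in> mon_ideal \<Gamma>" by blast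
  show "\<exists>w. kchain n (Suc i) j w \<and> (\<forall>\<sigma>. z \<sigma> - kdiff n w \<sigma> \<in> mon_ideal \<Gamma>)"
  proof (intro exI conjI allI)
    show "kchain n (Suc i) j (\<lambda>\<sigma>. w \<sigma> + w' \<sigma>)" by (intro kchain_add w w')
    fix \<sigma>
    have "z \<sigma> - kdiff n (\<lambda>\<sigma>. w \<sigma> + w' \<sigma>) \<sigma> = (a1 \<sigma> - kdiff n w' \<sigma>) + a2 \<sigma>"
      by (simp add: kdiff_add a2_def a_def)
    also have "\<dots> \<in> mon_ideal \<Gamma>" unfolding y using yw a2 by blast
    finally show "z \<sigma> - kdiff n (\<lambda>\<sigma>. w \<sigma> + w' \<sigma>) \<sigma> \<in> mon_ideal \<Gamma>" .
  qed
qed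

text \<open>Induction on \<open>F\<close>: killing the new variable \<open>X\<^sub>v\<close> leaves
  the polynomial ring of the smaller set, and the kernel is a copy of the big ring shifted by one.
  The induction hypothesis does not cover this kernel, but since \<open>X\<^sub>v\<close>
  annihilates Koszul homology, its classes become boundaries in the big ring. This is why
  \<open>koszul_exact_step\<close> asks for a boundary only after multiplication by
  \<open>X\<^sup>E\<close>, modulo the ideal of \<Gamma>.\<close>

lemma koszul_exact_Pow:
  assumes "finite F" "F \<subseteq> {1..n}" "j \<noteq> i"
  shows "koszul_exact n (mon_ideal (Pow F) :: 'k::field mpoly set) i j"
  using assms(1,2)
proof (induction F rule: finite_induct)
  case empty
  \<comment> \<open>A nonzero constant coefficient would force \<open>j = i\<close>.\<close>
  have "z \<sigma> \<in> mon_ideal {{}}" if "kchain n i j z" for z :: "nat set \<Rightarrow> 'k mpoly" and \<sigma>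
  proof -
    have "lookup (z \<sigma>) 0 = 0"
      using kchainD(4)[OF that, of 0 \<sigma>] assms(3) by (auto simp: in_keys_iff)
    then show ?thesis by (auto simp: mon_ideal_def)
  qed
  then show ?case
    unfolding koszul_exact_def by (auto intro!: exI[of _ "\<lambda>_. 0"] simp: kdiff_def)
next
  case (insert v F)
  have v: "v \<in> {1..n}" using insert.prems by auto
  show ?case
  proof (rule koszul_exact_step[where E = "{v}" and F = "insert v F"])
    have "{G \<in> Pow (insert v F). \<not> {v} \<subseteq> G} = Pow F" using insert.hyps by auto
    then show "koszul_exact n (mon_ideal {G \<in> Pow (insert v F). \<not> {v} \<subseteq> G} :: 'k mpoly set) i j"
      using insert.IH insert.prems by simp
  next
    fix y :: "nat set \<Rightarrow> 'k mpoly"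
    assume y: "kchain n i (j - card {v}) y" "\<And>\<tau>. kdiff n y \<tau> \<in> mon_ideal (Pow (insert v F))"
    show "\<exists>w. kchain n (Suc i) j w \<and>
        (\<forall>\<sigma>. single (sqfree {v}) 1 * y \<sigma> - kdiff n w \<sigma> \<in> mon_ideal (Pow (insert v F)))"
    proof (cases "j = 0")
      \<comment> \<open>Here the truncated difference \<open>j - card {v}\<close> is still
        \<open>0\<close>, but \<open>i \<noteq> 0\<close>, so no monomial fits the degree of
        \<open>y\<close>.\<close>
      case True
      then have "y \<sigma> = 0" for \<sigma>
        using kchainD(4)[OF y(1), of _ \<sigma>] assms(3) by (cases "y \<sigma> = 0") (auto simp flip: keys_eq_empty)
      then show ?thesis by (auto intro!: exI[of _ "\<lambda>_. 0"] simp: kdiff_def)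
    next
      case False
      have "single (sqfree {v}) 1 * y \<sigma> - kdiff n (kwedge v y) \<sigma> = kwedge v (kdiff n y) \<sigma>" for \<sigma>
        using kdiff_kwedge[OF v, of y \<sigma>] by (simp add: indeterminate_def algebra_simps)
      moreover have "kwedge v (kdiff n y) \<sigma> \<in> mon_ideal (Pow (insert v F))" for \<sigma>
        by (intro kwedge_in_mon_ideal y) simp
      moreover have "kchain n (Suc i) j (kwedge v y)"
        using kchain_kwedge[OF y(1) v] False by simp
      ultimately show ?thesis by metis
    qed
  qed (use insert.prems in auto)
qed

lemma koszul_exact_interval:
  fixes \<Gamma> :: "nat set set"
  assumes \<Gamma>: "down_closed \<Gamma>" and F: "F \<subseteq> {1..n}" "F \<in> \<Gamma>" and E: "E \<subseteq> F"
    and EF: "\<And>G. G \<in> \<Gamma> \<Longrightarrow> E \<subseteq> G \<Longrightarrow> G \<subseteq> F"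
    and Q: "koszul_exact n (mon_ideal {G \<in> \<Gamma>. \<not> E \<subseteq> G} :: 'k::field mpoly set) i j"
    and j: "i + card E < j"
  shows "koszul_exact n (mon_ideal \<Gamma> :: 'k mpoly set) i j"
proof (rule koszul_exact_step[OF \<Gamma> _ E F(2) EF Q])
  show En: "E \<subseteq> {1..n}" using E F by blast
  have finE: "finite E" using En finite_subset by blast
  fix y :: "nat set \<Rightarrow> 'k mpoly"
  assume y: "kchain n i (j - card E) y" "\<And>\<tau>. kdiff n y \<tau> \<in> mon_ideal (Pow F)"
  have "koszul_exact n (mon_ideal (Pow F) :: 'k mpoly set) i (j - card E)"
    using F(1) j finite_subset by (intro koszul_exact_Pow) auto
  then obtain w where w: "kchain n (Suc i) (j - card E) w"
    and yw: "\<And>\<sigma>. y \<sigma> - kdiff n w \<sigma> \<in> mon_ideal (Pow F)"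
    using koszul_exactD y by metis
  show "\<exists>w. kchain n (Suc i) j w \<and>
      (\<forall>\<sigma>. single (sqfree E) 1 * y \<sigma> - kdiff n w \<sigma> \<in> mon_ideal \<Gamma>)"
  proof (intro exI conjI allI)
    show "kchain n (Suc i) j (\<lambda>\<sigma>. single (sqfree E) 1 * w \<sigma>)"
      using kchain_monomial_mult[OF w En, of 1] j by simp
    fix \<sigma>
    have "single (sqfree E) 1 * y \<sigma> - kdiff n (\<lambda>\<sigma>. single (sqfree E) 1 * w \<sigma>) \<sigma>
        = single (sqfree E) 1 * (y \<sigma> - kdiff n w \<sigma>)"
      by (simp add: kdiff_mult right_diff_distrib)
    \<comment> \<open>Multiplication by \<open>X\<^sup>E\<close> maps
      \<open>mon_ideal (Pow F)\<close> into \<open>mon_ideal \<Gamma>\<close>, because a member of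
      \<Gamma> that contains \<open>E\<close> lies inside \<open>F\<close>.\<close>
    also have "\<dots> \<in> mon_ideal \<Gamma>"
      unfolding mon_ideal_def
    proof safe
      fix t :: "nat \<Rightarrow>\<^sub>0 nat" assume t: "keys t \<in> \<Gamma>"
      show "lookup (single (sqfree E) 1 * (y \<sigma> - kdiff n w \<sigma>)) t = 0"
      proof (cases "\<exists>s. t = sqfree E + s")
        case True
        then obtain s where s: "t = sqfree E + s" by blast
        have "keys t \<subseteq> F" using s finE by (intro EF t) (auto simp: keys_add_nat)
        then have "keys s \<subseteq> F" by (simp add: s keys_add_nat)
        then show ?thesis using yw[of \<sigma>] unfolding s lookup_single_mult by (simp add: mon_ideal_def)
      next
        case False
        then show ?thesis by (simp add: lookup_single_mult_if)
      qed
    qed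
    finally show "single (sqfree E) 1 * y \<sigma> - kdiff n (\<lambda>\<sigma>. single (sqfree E) 1 * w \<sigma>) \<sigma> \<in> mon_ideal \<Gamma>" .
  qed
qed

text \<open>
  If every codimension one face of \<open>F\<close> lay in another top-dimensional face, these \<open>d\<close> faces
  would be distinct and different from \<open>F\<close>.
\<close>

lemma free_face_exists:
  assumes fin: "finite \<Gamma>" and dim: "\<And>G. G \<in> \<Gamma> \<Longrightarrow> finite G \<and> card G \<le> d"
    and few: "card {G \<in> \<Gamma>. card G = d} \<le> d" and F: "F \<in> \<Gamma>" "card F = d"
  obtains v where "v \<in> F" "\<And>G. G \<in> \<Gamma> \<Longrightarrow> F - {v} \<subseteq> G \<Longrightarrow> card G = d \<Longrightarrow> G = F"
proof (rule ccontr)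
  assume "\<not> thesis"
  with that have "\<forall>v\<in>F. \<exists>G. G \<in> \<Gamma> \<and> F - {v} \<subseteq> G \<and> card G = d \<and> G \<noteq> F" by blast
  then obtain g where g: "\<And>v. v \<in> F \<Longrightarrow> g v \<in> \<Gamma> \<and> F - {v} \<subseteq> g v \<and> card (g v) = d \<and> g v \<noteq> F"
    by metis
  have notin: "\<not> F \<subseteq> g v" if "v \<in> F" for v
    using g[OF that] dim[of "g v"] F card_subset_eq[of "g v" F] by metis
  \<comment> \<open>\<open>F - {u}\<close> and \<open>F - {v}\<close> together cover
    \<open>F\<close>, so a common value would contain \<open>F\<close>.\<close>
  have "inj_on g F"
  proof (rule inj_onI, rule ccontr)
    fix u v assume uv: "u \<in> F" "v \<in> F" "g u = g v" "u \<noteq> v"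
    then have "F \<subseteq> g u" using g[of u] g[of v] by auto
    with notin[OF uv(1)] show False by blast
  qed
  then have "card (g ` F) = d" using card_image F by blast
  moreover have "F \<notin> g ` F" using g by blast
  moreover have "finite (g ` F)" using dim F by blast
  ultimately have "card (insert F (g ` F)) = Suc d" by simp
  moreover have "insert F (g ` F) \<subseteq> {G \<in> \<Gamma>. card G = d}" using g F by auto
  moreover have "finite {G \<in> \<Gamma>. card G = d}" using fin by simp
  ultimately show False using card_mono few by (metis not_less_eq_eq)
qed

text \<open>Induction on the number of faces. The bounds on the size and on the number of faces with
  \<open>d\<close> elements pass to every smaller family, so after each removal a free face can be
  sought afresh.\<close>

lemma koszul_exact_few_facets:
  assumes "down_closed \<Gamma>" "\<Gamma> \<subseteq> Pow {1..n}" "\<And>G. G \<in> \<Gamma> \<Longrightarrow> card G \<le> d"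
    and "card {G \<in> \<Gamma>. card G = d} \<le> d" "i + d \<le> j" "d \<ge> 1"
  shows "koszul_exact n (mon_ideal \<Gamma> :: 'k::field mpoly set) i j"
  using assms(1-4)
proof (induction "card \<Gamma>" arbitrary: \<Gamma> rule: less_induct)
  case (less \<Gamma>)
  have fin: "finite \<Gamma>" using less.prems(2) finite_subset by blast
  have finG: "finite G" if "G \<in> \<Gamma>" for G
    using that less.prems(2) finite_subset[of G "{1..n}"] by auto
  have reduce: ?case if F: "F \<in> \<Gamma>" "E \<subseteq> F" "card E < d" "\<And>G. G \<in> \<Gamma> \<Longrightarrow> E \<subseteq> G \<Longrightarrow> G \<subseteq> F" for E F
  proof (rule koszul_exact_interval[OF less.prems(1) _ F(1,2,4)])
    let ?\<Gamma>' = "{G \<in> \<Gamma>. \<not> E \<subseteq> G}"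
    have *: "?\<Gamma>' \<subseteq> \<Gamma>" "F \<in> \<Gamma> - ?\<Gamma>'" using F by auto
    show "koszul_exact n (mon_ideal ?\<Gamma>' :: 'k mpoly set) i j"
    proof (rule less.hyps)
      show "card ?\<Gamma>' < card \<Gamma>" using * fin by (intro psubset_card_mono) auto
      show "down_closed ?\<Gamma>'" using less.prems(1) unfolding down_closed_def by blast
      show "card {G \<in> ?\<Gamma>'. card G = d} \<le> d"
        using less.prems(4) card_mono[of "{G \<in> \<Gamma>. card G = d}" "{G \<in> ?\<Gamma>'. card G = d}"] fin * by force
    qed (use less.prems in auto)
    show "F \<subseteq> {1..n}" using F less.prems by auto
    show "i + card E < j" using F assms(5) by simp
  qed
  show ?case
  proof (cases "\<exists>F\<in>\<Gamma>. card F = d")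
    case True
    then obtain F where F: "F \<in> \<Gamma>" "card F = d" by blast
    have "\<And>G. G \<in> \<Gamma> \<Longrightarrow> finite G \<and> card G \<le> d" using finG less.prems(3) by blast
    from free_face_exists[OF fin this less.prems(4) F]
    obtain v where v: "v \<in> F" "\<And>G. G \<in> \<Gamma> \<Longrightarrow> F - {v} \<subseteq> G \<Longrightarrow> card G = d \<Longrightarrow> G = F" by blast
    have c: "card (F - {v}) = d - 1" using v F finG by simp
    \<comment> \<open>Above \<open>F - {v}\<close>, faces with \<open>d\<close> elements equal
      \<open>F\<close> by the choice of \<open>v\<close>, and smaller ones equal
      \<open>F - {v}\<close> by size; so the interval from \<open>F - {v}\<close> to
      \<open>F\<close> can be removed.\<close>
    show ?thesis
    proof (rule reduce[OF F(1)])
      show "F - {v} \<subseteq> F" by blast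
      show "card (F - {v}) < d" using c assms(6) by simp
      fix G assume G: "G \<in> \<Gamma>" "F - {v} \<subseteq> G"
      show "G \<subseteq> F"
      proof (cases "card G = d")
        case True
        then show ?thesis using v G by blast
      next
        case False
        then have "card G \<le> card (F - {v})" using less.prems(3)[OF G(1)] c by simp
        then have "F - {v} = G" using G finG card_seteq by blast
        then show ?thesis by blast
      qed
    qed
  next
    case no_top: False
    show ?thesis
    proof (cases "\<Gamma> = {}")
      case True
      then show ?thesis by (auto simp: koszul_exact_def intro: exI[of _ "\<lambda>_. 0"])
    next
      case False
      \<comment> \<open>Once all faces have fewer than \<open>d\<close> elements, a maximal face is
        an interval by itself, with \<open>E = F\<close>.\<close>
      then obtain F where F: "F \<in> \<Gamma>" "\<And>G. G \<in> \<Gamma> \<Longrightarrow> F \<subseteq> G \<Longrightarrow> F = G"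
        using finite_has_maximal[OF fin] by blast
      moreover have "card F < d" using less.prems(3)[OF F(1)] no_top F by force
      ultimately show ?thesis by (intro reduce[of F F]) auto
    qed
  qed
qed

section \<open>The Stanley--Reisner ring and its dimension\<close>

lemma poly_mapping_expansion: "p = (\<Sum>t\<in>keys p. single t (lookup p t))"
  by (intro poly_mapping_eqI)
    (simp add: lookup_sum lookup_single when_def in_keys_iff)

lemma domain_poly_ring: "domain (poly_ring n :: 'k::field mpoly ring)"
proof (intro domainI cringI abelian_groupI comm_monoidI)
  fix p :: "'k mpoly" assume "p \<in> carrier (poly_ring n)"
  then show "\<exists>q\<in>carrier (poly_ring n). q \<oplus>\<^bsub>poly_ring n\<^esub> p = \<zero>\<^bsub>poly_ring n\<^esub>"
    by (intro bexI[of _ "- p"]) auto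
qed (auto simp: algebra_simps)

lemma ring_poly_ring: "ring (poly_ring n :: 'k::field mpoly ring)"
  using domain_poly_ring domain.axioms cring.axioms by blast

lemma a_minus_poly_ring [simp]:
  assumes "p \<in> carrier (poly_ring n)"
  shows "\<ominus>\<^bsub>poly_ring n\<^esub> p = - (p :: 'k::field mpoly)"
proof -
  interpret ring "poly_ring n :: 'k mpoly ring" by (rule ring_poly_ring)
  show ?thesis using minus_equality[of "- p" p] assms by simp
qed

lemma mon_ideal_mult_right:
  "down_closed \<Gamma> \<Longrightarrow> p \<in> mon_ideal \<Gamma> \<Longrightarrow> p * q \<in> mon_ideal \<Gamma>"
  using mon_ideal_mult[of \<Gamma> p q] by (simp add: mult.commute)

lemma ideal_mon_ideal:
  assumes "down_closed \<Gamma>"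
  shows "ideal (mon_ideal \<Gamma> \<inter> carrier (poly_ring n)) (poly_ring n :: 'k::field mpoly ring)"
proof (rule idealI[OF ring_poly_ring])
  interpret ring "poly_ring n :: 'k mpoly ring" by (rule ring_poly_ring)
  show "subgroup (mon_ideal \<Gamma> \<inter> carrier (poly_ring n)) (add_monoid (poly_ring n :: 'k mpoly ring))"
  proof (rule add.subgroupI)
    fix p :: "'k mpoly" assume p: "p \<in> mon_ideal \<Gamma> \<inter> carrier (poly_ring n)"
    then show "\<ominus>\<^bsub>poly_ring n\<^esub> p \<in> mon_ideal \<Gamma> \<inter> carrier (poly_ring n)" by auto
  qed auto
qed (use assms in \<open>auto intro: mon_ideal_mult mon_ideal_mult_right\<close>)

text \<open>An ideal containing the monomials in \<open>Y\<close> contains all their multiples, and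
  by \<open>gen\<close> these span the right-hand side. Serves both the ideal of nonfaces and the
  ideal of all variables.\<close>

lemma genideal_eq_mon_ideal:
  fixes Y :: "'k::field mpoly set"
  assumes \<Gamma>: "down_closed \<Gamma>"
    and Y: "Y \<subseteq> mon_ideal \<Gamma> \<inter> carrier (poly_ring n)"
    and gen: "\<And>t. keys t \<subseteq> {1..n} \<Longrightarrow> keys t \<notin> \<Gamma> \<Longrightarrow> \<exists>s t'. t = t' + s \<and> single s 1 \<in> Y"
  shows "genideal (poly_ring n) Y = mon_ideal \<Gamma> \<inter> carrier (poly_ring n)"
proof
  interpret ring "poly_ring n :: 'k mpoly ring" by (rule ring_poly_ring)
  show "genideal (poly_ring n) Y \<subseteq> mon_ideal \<Gamma> \<inter> carrier (poly_ring n)"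
    by (rule genideal_minimal[OF ideal_mon_ideal[OF \<Gamma>] Y])
  have YS: "Y \<subseteq> carrier (poly_ring n)" using Y by blast
  interpret J: ideal "genideal (poly_ring n) Y" "poly_ring n :: 'k mpoly ring"
    by (rule genideal_ideal[OF YS])
  have sum: "sum f T \<in> genideal (poly_ring n) Y" if "\<And>t. t \<in> T \<Longrightarrow> f t \<in> genideal (poly_ring n) Y"
    for f :: "(nat \<Rightarrow>\<^sub>0 nat) \<Rightarrow> 'k mpoly" and T
    using that
    by (induction T rule: infinite_finite_induct)
      (use J.a_closed J.zero_closed in simp_all)
  show "mon_ideal \<Gamma> \<inter> carrier (poly_ring n) \<subseteq> genideal (poly_ring n) Y"
  proof
    fix p :: "'k mpoly" assume p: "p \<in> mon_ideal \<Gamma> \<inter> carrier (poly_ring n)"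
    have "single t (lookup p t) \<in> genideal (poly_ring n) Y" if "t \<in> keys p" for t
    proof -
      have "keys t \<subseteq> {1..n}" "keys t \<notin> \<Gamma>"
        using p that by (auto simp: poly_carrier_iff mon_ideal_def in_keys_iff)
      moreover from gen[OF this] obtain s t' where st: "t = t' + s" "single s 1 \<in> Y" by blast
      ultimately have "single t' (lookup p t) \<in> carrier (poly_ring n)" by (simp add: keys_add_nat)
      moreover have "single s 1 \<in> genideal (poly_ring n) Y" using genideal_self[OF YS] st by blast
      ultimately have "single t' (lookup p t) * single s 1 \<in> genideal (poly_ring n) Y"
        using J.I_l_closed by simp
      then show ?thesis by (simp add: mult_single st)
    qed
    from sum[of "keys p" "\<lambda>t. single t (lookup p t)", OF this] show "p \<in> genideal (poly_ring n) Y"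
      by (simp flip: poly_mapping_expansion)
  qed
qed

lemma prod_indeterminate: "finite G \<Longrightarrow> (\<Prod>i\<in>G. indeterminate i) = (single (sqfree G) 1 :: 'k::field mpoly)"
  by (induction G rule: finite_induct) (auto simp: sqfree_def indeterminate_def mult_single)

lemma simplicial_complex_down_closed: "simplicial_complex n \<Delta> \<Longrightarrow> down_closed \<Delta>"
  by (auto simp: simplicial_complex_def down_closed_def)

lemma stanley_reisner_ideal_eq:
  assumes "simplicial_complex n \<Delta>"
  shows "stanley_reisner_ideal n \<Delta> = (mon_ideal \<Delta> \<inter> carrier (poly_ring n) :: 'k::field mpoly set)"
  unfolding stanley_reisner_ideal_def
proof (rule genideal_eq_mon_ideal)
  show dc: "down_closed \<Delta>" by (rule simplicial_complex_down_closed[OF assms])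
  have fin: "finite G" if "G \<subseteq> {1..n}" for G using that finite_subset by blast
  show "{\<Prod>i\<in>G. indeterminate i | G. G \<subseteq> {1..n} \<and> G \<notin> \<Delta>}
      \<subseteq> (mon_ideal \<Delta> \<inter> carrier (poly_ring n) :: 'k mpoly set)"
    by (auto simp: prod_indeterminate[OF fin] mon_ideal_def lookup_single when_def fin
        intro!: poly_carrier_single)
  fix t :: "nat \<Rightarrow>\<^sub>0 nat" assume t: "keys t \<subseteq> {1..n}" "keys t \<notin> \<Delta>"
  have "t = (t - sqfree (keys t)) + sqfree (keys t)" by (simp add: minus_sqfree)
  moreover have "single (sqfree (keys t)) 1
      \<in> {\<Prod>i\<in>G. indeterminate i :: 'k mpoly | G. G \<subseteq> {1..n} \<and> G \<notin> \<Delta>}"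
    using t by (auto intro!: exI[of _ "keys t"] simp: prod_indeterminate)
  ultimately show "\<exists>s t'. t = t' + s \<and> single s 1
      \<in> {\<Prod>i\<in>G. indeterminate i :: 'k mpoly | G. G \<subseteq> {1..n} \<and> G \<notin> \<Delta>}" by blast
qed

lemma irrelevant_ideal_eq:
  "irrelevant_ideal n = ({p. lookup p 0 = 0} \<inter> carrier (poly_ring n) :: 'k::field mpoly set)"
proof -
  \<comment> \<open>The complex whose only face is the empty set: the monomials with empty support
    are the constants.\<close>
  have "irrelevant_ideal n = (mon_ideal {{}} \<inter> carrier (poly_ring n) :: 'k mpoly set)"
    unfolding irrelevant_ideal_def
  proof (rule genideal_eq_mon_ideal)
    show "down_closed {{}}" by (simp add: down_closed_def)
    show "indeterminate ` {1..n} \<subseteq> (mon_ideal {{}} \<inter> carrier (poly_ring n) :: 'k mpoly set)"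
      by (auto simp: mon_ideal_def indeterminate_def lookup_single when_def
          simp del: keys_eq_empty)
    fix t :: "nat \<Rightarrow>\<^sub>0 nat" assume t: "keys t \<subseteq> {1..n}" "keys t \<notin> {{}}"
    then obtain v where v: "v \<in> keys t" by blast
    then have "t = (t - sqfree {v}) + single v 1" using minus_sqfree[of "{v}" t] by simp
    then show "\<exists>s t'. t = t' + s \<and> single s 1 \<in> (indeterminate ` {1..n} :: 'k mpoly set)"
      using v t by (metis image_eqI indeterminate_def subsetD)
  qed
  also have "mon_ideal {{}} = ({p. lookup p 0 = 0} :: 'k mpoly set)"
    by (auto simp: mon_ideal_def)
  finally show ?thesis .
qed

section \<open>Quotient rings computed through residue classes of polynomials\<close>

abbreviation residue_class :: "nat \<Rightarrow> 'k::field mpoly set \<Rightarrow> 'k mpoly \<Rightarrow> 'k mpoly set" where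
  "residue_class n I p \<equiv> I +>\<^bsub>poly_ring n\<^esub> p"

context
  fixes n :: nat and I :: "'k::field mpoly set"
  assumes I: "ideal I (poly_ring n)"
begin

interpretation ideal I "poly_ring n :: 'k mpoly ring" by (rule I)

lemma ideal_poly_closed:
  "0 \<in> I" "p \<in> I \<Longrightarrow> q \<in> I \<Longrightarrow> p + q \<in> I" "p \<in> I \<Longrightarrow> - p \<in> I"
  "p \<in> I \<Longrightarrow> q \<in> I \<Longrightarrow> p - q \<in> I"
  "p \<in> carrier (poly_ring n) \<Longrightarrow> q \<in> I \<Longrightarrow> p * q \<in> I" "p \<in> I \<Longrightarrow> p \<in> carrier (poly_ring n)"
proof -
  show "0 \<in> I" using additive_subgroup.zero_closed[OF is_additive_subgroup] by simp
  show add: "p \<in> I \<Longrightarrow> q \<in> I \<Longrightarrow> p + q \<in> I" for p q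
    using additive_subgroup.a_closed[OF is_additive_subgroup] by simp
  show "p \<in> carrier (poly_ring n) \<Longrightarrow> q \<in> I \<Longrightarrow> p * q \<in> I" for p q using I_l_closed by simp
  show carr: "p \<in> I \<Longrightarrow> p \<in> carrier (poly_ring n)" for p using a_Hcarr by simp
  show minus: "p \<in> I \<Longrightarrow> - p \<in> I" for p using I_l_closed[of p "- 1"] by auto
  show "p \<in> I \<Longrightarrow> q \<in> I \<Longrightarrow> p - q \<in> I" for p q
    using add[OF _ minus[of q], of p] by simp
qed

lemma residue_class_eq: "residue_class n I p = (\<lambda>q. q + p) ` I"
  by (auto simp: a_r_coset_def')

lemma residue_class_eq_iff: "residue_class n I p = residue_class n I q \<longleftrightarrow> p - q \<in> I"
proof
  assume "residue_class n I p = residue_class n I q"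
  moreover have "p \<in> residue_class n I p"
    unfolding residue_class_eq using ideal_poly_closed(1) by force
  ultimately show "p - q \<in> I" unfolding residue_class_eq by auto
next
  assume pq: "p - q \<in> I"
  have sub: "residue_class n I p \<subseteq> residue_class n I q" if "p - q \<in> I" for p q
    unfolding residue_class_eq
  proof
    fix x assume "x \<in> (\<lambda>r. r + p) ` I"
    then obtain r where r: "r \<in> I" "x = r + p" by blast
    then have "x = (r + (p - q)) + q" by simp
    then show "x \<in> (\<lambda>r. r + q) ` I" using ideal_poly_closed(2)[OF r(1) that] by blast
  qed
  have "q - p \<in> I" using ideal_poly_closed(3)[OF pq] by simp
  with sub[OF pq] sub[of q p] show "residue_class n I p = residue_class n I q" by blast
qed

lemma carrier_graded_quotient:
  "carrier (graded_quotient n I) = residue_class n I ` carrier (poly_ring n)"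
  by (auto simp: graded_quotient_def Let_def FactRing_def A_RCOSETS_def')

lemma component_graded_quotient:
  "component (graded_quotient n I) m = residue_class n I ` poly_component n m"
  by (simp add: graded_quotient_def Let_def)

lemma zero_graded_quotient: "zero (graded_quotient n I) = residue_class n I 0"
  unfolding residue_class_eq by (simp add: graded_quotient_def Let_def FactRing_def)

lemma one_graded_quotient: "one (graded_quotient n I) = residue_class n I 1"
  by (simp add: graded_quotient_def Let_def FactRing_def)

lemma add_graded_quotient:
  assumes "p \<in> carrier (poly_ring n)" "q \<in> carrier (poly_ring n)"
  shows "add (graded_quotient n I) (residue_class n I p) (residue_class n I q) = residue_class n I (p + q)"
  using ring_hom_add[OF rcos_ring_hom assms] by (simp add: graded_quotient_def Let_def)

lemma mult_graded_quotient:
  assumes "p \<in> carrier (poly_ring n)" "q \<in> carrier (poly_ring n)"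
  shows "mult (graded_quotient n I) (residue_class n I p) (residue_class n I q) = residue_class n I (p * q)"
  using ring_hom_mult[OF rcos_ring_hom assms] by (simp add: graded_quotient_def Let_def)

lemma smult_graded_quotient:
  assumes "p \<in> carrier (poly_ring n)" "q \<in> carrier (poly_ring n)"
  shows "smult (graded_quotient n I) p (residue_class n I q) = residue_class n I (p * q)"
  using ring_hom_mult[OF rcos_ring_hom assms] by (simp add: graded_quotient_def Let_def)

lemmas graded_quotient_simps = carrier_graded_quotient zero_graded_quotient one_graded_quotient
  add_graded_quotient mult_graded_quotient smult_graded_quotient

lemma cring_graded_quotient: "cring (graded_quotient n I)"
proof (intro cringI abelian_groupI comm_monoidI)
  fix x assume "x \<in> carrier (graded_quotient n I)"
  then obtain p where "p \<in> carrier (poly_ring n)" "x = residue_class n I p"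
    by (auto simp: carrier_graded_quotient)
  then show "\<exists>y\<in>carrier (graded_quotient n I).
      y \<oplus>\<^bsub>graded_quotient n I\<^esub> x = \<zero>\<^bsub>graded_quotient n I\<^esub>"
    by (intro bexI[of _ "residue_class n I (- p)"]) (auto simp: graded_quotient_simps)
qed (auto simp: graded_quotient_simps algebra_simps)

end

section \<open>Face primes and a lower bound for the Krull dimension\<close>

lemma mon_ideal_Pow_prime:
  assumes "p * q \<in> mon_ideal (Pow F)"
  shows "p \<in> mon_ideal (Pow F) \<or> q \<in> mon_ideal (Pow F)"
proof (rule ccontr)
  assume neg: "\<not> ?thesis"
  \<comment> \<open>Setting the variables outside \<open>F\<close> to zero changes neither factor
    modulo the ideal and reduces the claim to the absence of zero divisors among
    polynomials.\<close>
  define r where "r = restrict_poly (\<lambda>t. keys t \<subseteq> F) (p :: 'a mpoly)"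
  define s where "s = restrict_poly (\<lambda>t. keys t \<subseteq> F) (q :: 'a mpoly)"
  have nz: "r \<noteq> 0" "s \<noteq> 0"
    using neg by (auto simp: r_def s_def poly_mapping_eq_iff fun_eq_iff lookup_restrict_poly mon_ideal_def)
  have "p - r \<in> mon_ideal (Pow F)" "q - s \<in> mon_ideal (Pow F)"
    by (auto simp: r_def s_def mon_ideal_def lookup_minus lookup_restrict_poly)
  then have "(p - r) * q \<in> mon_ideal (Pow F)" "r * (q - s) \<in> mon_ideal (Pow F)"
    using mon_ideal_mult mon_ideal_mult_right down_closed_Pow by blast+
  then have "p * q - ((p - r) * q + r * (q - s)) \<in> mon_ideal (Pow F)"
    by (intro mon_ideal_closed(3,4) assms)
  then have rs: "r * s \<in> mon_ideal (Pow F)" by (simp add: algebra_simps)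
  have "keys t \<subseteq> F" if "t \<in> keys (r * s)" for t
  proof -
    from that keys_mult[of r s] obtain a b where "t = a + b" "a \<in> keys r" "b \<in> keys s"
      by blast
    then show ?thesis by (auto simp: r_def s_def keys_restrict_poly keys_add_nat)
  qed
  with rs have "lookup (r * s) t = 0" for t by (auto simp: mon_ideal_def in_keys_iff)
  then have "r * s = 0" by (intro poly_mapping_eqI) (simp del: mult_eq_0_iff)
  with nz show False by simp
qed

text \<open>All subsets of \<open>F\<close> are faces, so the ideal of \<open>F\<close> contains the
  Stanley--Reisner ideal and its primality descends to the quotient.\<close>

lemma primeideal_face:
  assumes "down_closed \<Delta>" "F \<in> \<Delta>"
  shows "primeideal (residue_class n (mon_ideal \<Delta> \<inter> carrier (poly_ring n)) `
      (mon_ideal (Pow F) \<inter> carrier (poly_ring n)))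
    (graded_quotient n (mon_ideal \<Delta> \<inter> carrier (poly_ring n) :: 'k::field mpoly set))"
    (is "primeideal ?P ?A")
proof -
  define I :: "'k mpoly set" where "I = mon_ideal \<Delta> \<inter> carrier (poly_ring n)"
  define M :: "'k mpoly set" where "M = mon_ideal (Pow F) \<inter> carrier (poly_ring n)"
  have I: "ideal I (poly_ring n)" unfolding I_def by (rule ideal_mon_ideal[OF assms(1)])
  have M: "ideal M (poly_ring n)" unfolding M_def by (rule ideal_mon_ideal) simp
  have "mon_ideal \<Delta> \<subseteq> (mon_ideal (Pow F) :: 'k mpoly set)"
    using assms by (intro mon_ideal_mono) (auto simp: down_closed_def)
  then have IM: "I \<subseteq> M" by (auto simp: I_def M_def)
  note simps = graded_quotient_simps[OF I]
  note Mc = ideal_poly_closed[OF M]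
  have mem: "residue_class n I p \<in> residue_class n I ` M \<longleftrightarrow> p \<in> M" for p
  proof
    assume "residue_class n I p \<in> residue_class n I ` M"
    then obtain q where q: "q \<in> M" "p - q \<in> I" by (auto simp: residue_class_eq_iff[OF I])
    then have "(p - q) + q \<in> M" using IM Mc(2) by blast
    then show "p \<in> M" by simp
  qed auto
  interpret A: cring ?A unfolding I_def[symmetric] by (rule cring_graded_quotient[OF I])
  have "primeideal (residue_class n I ` M) (graded_quotient n I)"
  proof (rule primeidealI)
    show "cring (graded_quotient n I)" by (rule cring_graded_quotient[OF I])
    show "ideal (residue_class n I ` M) (graded_quotient n I)"
    proof (rule idealI)
      show "ring (graded_quotient n I)" using A.ring_axioms by (simp add: I_def)
      show "subgroup (residue_class n I ` M) (add_monoid (graded_quotient n I))"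
      proof (rule A.add.subgroupI[folded I_def])
        fix x assume "x \<in> residue_class n I ` M"
        then obtain p where p: "p \<in> M" "x = residue_class n I p" by blast
        have "\<ominus>\<^bsub>graded_quotient n I\<^esub> x = residue_class n I (- p)"
          using p Mc by (intro A.minus_equality[folded I_def]) (auto simp: simps)
        then show "\<ominus>\<^bsub>graded_quotient n I\<^esub> x \<in> residue_class n I ` M" using p Mc by auto
      qed (use Mc in \<open>auto simp: simps\<close>)
      fix a x assume "a \<in> residue_class n I ` M" "x \<in> carrier (graded_quotient n I)"
      then obtain p q where p: "p \<in> M" "a = residue_class n I p"
        and q: "q \<in> carrier (poly_ring n)" "x = residue_class n I q" by (auto simp: simps)
      have "q * p \<in> M" "p \<in> carrier (poly_ring n)" using p q Mc by auto
      then show "x \<otimes>\<^bsub>graded_quotient n I\<^esub> a \<in> residue_class n I ` M"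
        "a \<otimes>\<^bsub>graded_quotient n I\<^esub> x \<in> residue_class n I ` M"
        using p q by (auto simp: simps mult.commute[of p q])
    qed
    have "(1 :: 'k mpoly) \<notin> M" by (auto simp: M_def mon_ideal_def lookup_one intro!: exI[of _ 0])
    then have "residue_class n I 1 \<in> carrier (graded_quotient n I) - residue_class n I ` M"
      using mem by (auto simp: simps)
    then show "carrier (graded_quotient n I) \<noteq> residue_class n I ` M" by blast
    fix x y assume "x \<in> carrier (graded_quotient n I)" "y \<in> carrier (graded_quotient n I)"
      "x \<otimes>\<^bsub>graded_quotient n I\<^esub> y \<in> residue_class n I ` M"
    then obtain p q where p: "p \<in> carrier (poly_ring n)" "x = residue_class n I p"
      and q: "q \<in> carrier (poly_ring n)" "y = residue_class n I q"
      and "residue_class n I (p * q) \<in> residue_class n I ` M"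
      by (auto simp: simps simp del: image_iff)
    then have pq: "p * q \<in> M" unfolding mem by simp
    then show "x \<in> residue_class n I ` M \<or> y \<in> residue_class n I ` M"
      using mon_ideal_Pow_prime[of p q F] p(1) q(1) unfolding p(2) q(2) mem by (auto simp: M_def)
  qed
  then show ?thesis by (simp add: I_def M_def)
qed

text \<open>Deleting the vertices of \<open>F\<close> one after the other enlarges the face prime,
  which gives a chain of \<open>card F + 1\<close> primes. Consecutive primes are separated by the
  variable of the deleted vertex \<open>v\<close>; since \<open>{v}\<close> is a face, the ideal has
  no coefficient there that could blur the difference.\<close>

lemma card_face_le_krull_dim:
  assumes \<Delta>: "down_closed \<Delta>" "\<Delta> \<subseteq> Pow {1..n}" and F: "F \<in> \<Delta>"
  shows "enat (card F)
    \<le> krull_dim (graded_quotient n (mon_ideal \<Delta> \<inter> carrier (poly_ring n) :: 'k::field mpoly set))"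
proof -
  define I :: "'k mpoly set" where "I = mon_ideal \<Delta> \<inter> carrier (poly_ring n)"
  have I: "ideal I (poly_ring n)" unfolding I_def by (rule ideal_mon_ideal[OF \<Delta>(1)])
  define M :: "nat set \<Rightarrow> 'k mpoly set" where "M G = mon_ideal (Pow G) \<inter> carrier (poly_ring n)" for G
  obtain xs where xs: "set xs = F" "distinct xs" "length xs = card F"
  proof -
    have "finite F" using F \<Delta>(2) finite_subset[of F "{1..n}"] by blast
    then obtain xs where "set xs = F" "distinct xs" using finite_distinct_list by blast
    with that distinct_card[of xs] show thesis by simp
  qed
  define P where "P i = residue_class n I ` M (set (drop i xs))" for i
  have face: "set (drop i xs) \<in> \<Delta>" for i
    using set_drop_subset[of i xs] xs(1) down_closedD[OF \<Delta>(1) F] by blast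
  have "primeideal (P i) (graded_quotient n I)" for i
    unfolding P_def M_def I_def by (rule primeideal_face[OF \<Delta>(1) face])
  moreover have "P i \<subset> P (Suc i)" if "i < card F" for i
  proof
    define v where "v = xs ! i"
    have dr: "drop i xs = v # drop (Suc i) xs"
      unfolding v_def by (rule Cons_nth_drop_Suc[symmetric]) (use that xs in simp)
    have "distinct (drop i xs)" using xs by simp
    then have v: "v \<notin> set (drop (Suc i) xs)" unfolding dr by simp
    have vF: "v \<in> F" using that xs unfolding v_def by (metis nth_mem)
    have "mon_ideal (Pow (set (drop i xs))) \<subseteq> (mon_ideal (Pow (set (drop (Suc i) xs))) :: 'k mpoly set)"
      by (rule mon_ideal_mono) (auto simp: dr)
    then show "P i \<subseteq> P (Suc i)" unfolding P_def M_def by blast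
    have X: "indeterminate v \<in> M (set (drop (Suc i) xs))"
    proof -
      have "v \<in> {1..n}" using vF \<Delta>(2) F by blast
      then have "indeterminate v \<in> (carrier (poly_ring n) :: 'k mpoly set)"
        by (rule poly_carrier_indeterminate)
      with v show ?thesis
        by (auto simp: M_def mon_ideal_def indeterminate_def lookup_single when_def)
    qed
    have "residue_class n I (indeterminate v) \<notin> P i"
    proof
      assume "residue_class n I (indeterminate v) \<in> P i"
      then obtain q where q: "q \<in> M (set (drop i xs))" "indeterminate v - q \<in> I"
        by (auto simp: P_def residue_class_eq_iff[OF I])
      have "lookup q (single v 1) = 0"
        using q(1) dr by (auto simp: M_def mon_ideal_def)
      moreover have "lookup (indeterminate v - q) (single v 1) = 0"
        using q(2) down_closedD[OF \<Delta>(1) F, of "{v}"] vF by (auto simp: I_def mon_ideal_def)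
      ultimately show False by (simp add: lookup_minus indeterminate_def)
    qed
    with X show "P i \<noteq> P (Suc i)" unfolding P_def by blast
  qed
  ultimately show ?thesis
    unfolding krull_dim_def I_def[symmetric] by (intro Sup_upper CollectI exI[of _ "card F"] conjI refl exI[of _ P]) auto
qed

text \<open>The zero ring has no prime ideals, and the supremum of the empty set in
  \<open>enat\<close> is \<open>0\<close>. In positive dimension this excludes the void
  complex.\<close>

lemma krull_dim_trivial:
  "krull_dim (graded_quotient n (carrier (poly_ring n) :: 'k::field mpoly set)) = 0"
proof -
  define I :: "'k mpoly set" where "I = carrier (poly_ring n)"
  have I: "ideal I (poly_ring n)" using ideal_mon_ideal[of "{}" n] by (simp add: I_def down_closed_def)
  have "residue_class n I p = residue_class n I 0" if "p \<in> carrier (poly_ring n)" for p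
    unfolding residue_class_eq_iff[OF I] using that by (simp add: I_def)
  then have c: "carrier (graded_quotient n I) = {residue_class n I 0}"
    unfolding carrier_graded_quotient[OF I] by blast
  have "\<not> primeideal P (graded_quotient n I)" for P
  proof
    assume "primeideal P (graded_quotient n I)"
    then interpret primeideal P "graded_quotient n I" .
    have "\<zero>\<^bsub>graded_quotient n I\<^esub> \<in> P" using additive_subgroup.zero_closed[OF is_additive_subgroup] .
    then have "carrier (graded_quotient n I) \<subseteq> P" by (simp add: c zero_graded_quotient[OF I])
    moreover have "P \<subseteq> carrier (graded_quotient n I)" using a_subset .
    ultimately show False using I_notcarr by blast
  qed
  then have *: "{enat l | l. \<exists>P. (\<forall>i\<le>l. primeideal (P i) (graded_quotient n I)) \<and> (\<forall>i<l. P i \<subset> P (Suc i))} = {}"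
    by auto
  show ?thesis unfolding krull_dim_def I_def[symmetric] * by (simp add: bot_enat_def)
qed

section \<open>Hilbert polynomial and multiplicity\<close>

text \<open>The binomial coefficient \<open>(m - 1) choose k\<close> as a polynomial in
  \<open>m\<close>, which counts the monomials of degree \<open>m\<close> whose support is a given
  set of \<open>k + 1\<close> variables.\<close>

definition gbinom_poly :: "nat \<Rightarrow> rat poly" where
  "gbinom_poly k = Polynomial.smult (1 / fact k) (\<Prod>i<k. [:- of_nat (Suc i), 1:])"

lemma degree_prod_monic_linear:
  "degree (\<Prod>i<k. [:- of_nat (Suc i), 1 :: rat:]) = k \<and> lead_coeff (\<Prod>i<k. [:- of_nat (Suc i), 1 :: rat:]) = 1"
proof (induction k)
  case (Suc k)
  define p where "p = (\<Prod>i<k. [:- of_nat (Suc i), 1 :: rat:])"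
  define l where "l = [:- of_nat (Suc k), 1 :: rat:]"
  have l: "l \<noteq> 0" "degree l = 1" "lead_coeff l = 1" by (simp_all add: l_def)
  have p: "degree p = k" "lead_coeff p = 1"
    using Suc unfolding p_def by (rule conjunct1, rule conjunct2)
  then have "p \<noteq> 0" by auto
  then have "degree (p * l) = Suc k" "lead_coeff (p * l) = 1"
    using p l degree_mult_eq[of p l] lead_coeff_mult[of p l] by simp_all
  then show ?case by (simp only: prod.lessThan_Suc p_def l_def)
qed simp

lemma degree_gbinom_poly: "degree (gbinom_poly k) = k"
  and coeff_gbinom_poly: "Polynomial.coeff (gbinom_poly k) k = 1 / fact k"
proof -
  define p where "p = (\<Prod>i<k. [:- of_nat (Suc i), 1 :: rat:])"
  have p: "degree p = k" "lead_coeff p = 1"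
    using degree_prod_monic_linear[of k] unfolding p_def by (rule conjunct1, rule conjunct2)
  then show "degree (gbinom_poly k) = k" "Polynomial.coeff (gbinom_poly k) k = 1 / fact k"
    unfolding gbinom_poly_def p_def[symmetric] by simp_all
qed

lemma poly_gbinom_poly:
  assumes "m \<ge> 1"
  shows "poly (gbinom_poly k) (of_nat m) = of_nat ((m - 1) choose k)"
proof -
  have "(of_nat ((m - 1) choose k) :: rat) = of_nat (m - 1) gchoose k"
    by (rule binomial_gbinomial)
  also have "\<dots> = (\<Prod>i=0..<k. of_nat (m - 1) - of_nat i) / fact k"
    by (simp add: gbinomial_prod_rev)
  also have "(\<Prod>i=0..<k. of_nat (m - 1) - of_nat i :: rat) = (\<Prod>i<k. - of_nat (Suc i) + of_nat m)"
    using assms by (intro prod.cong) (auto simp: of_nat_diff)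
  finally show ?thesis
    by (simp add: gbinom_poly_def poly_prod del: of_nat_Suc)
qed

text \<open>Lowering every exponent by one turns these monomials into lists of \<open>card F\<close>
  natural numbers with sum \<open>m - card F\<close>, to which stars and bars applies.\<close>

lemma card_monomials_with_support:
  fixes F :: "nat set"
  assumes F: "finite F" "F \<noteq> {}" and m: "m \<ge> 1"
  shows "finite {t. keys t = F \<and> total_degree t = m}"
    and "card {t. keys t = F \<and> total_degree t = m} = ((m - 1) choose (card F - 1))"
proof -
  define s where "s = card F"
  have s: "s \<ge> 1" using F by (auto simp: s_def Suc_le_eq card_gt_0_iff)
  obtain xs where xs: "set xs = F" "distinct xs" using finite_distinct_list[OF F(1)] by blast
  then have len: "length xs = s" by (simp add: s_def distinct_card[symmetric])
  define T where "T = {t. keys t = F \<and> total_degree t = m}"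
  \<comment> \<open>Written without subtraction, so that \<open>L\<close> is empty when
    \<open>m\<close> is smaller than \<open>card F\<close>.\<close>
  define L where "L = {l :: nat list. length l = s \<and> sum_list l + s = m}"
  define f where "f t = map (\<lambda>i. lookup t i - 1) xs" for t :: "nat \<Rightarrow>\<^sub>0 nat"
  define g where "g l = (\<Sum>j<s. single (xs ! j) (Suc (l ! j)))" for l :: "nat list"
  have look: "lookup (g l) (xs ! j) = Suc (l ! j)" if "j < s" for l j
  proof -
    have "lookup (g l) (xs ! j) = (\<Sum>i<s. if i = j then Suc (l ! i) else 0)"
      unfolding g_def lookup_sum using that xs len
      by (intro sum.cong) (auto simp: lookup_single when_def nth_eq_iff_index_eq)
    then show ?thesis using that by simp
  qed
  have keys_g: "keys (g l) = F" for l
  proof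
    show "keys (g l) \<subseteq> F"
    proof
      fix i assume "i \<in> keys (g l)"
      then obtain j where "j < s" "lookup (single (xs ! j) (Suc (l ! j))) i \<noteq> 0"
        unfolding g_def in_keys_iff lookup_sum by (metis (no_types, lifting) lessThan_iff sum.neutral)
      then show "i \<in> F" using xs len by (auto simp: lookup_single when_def split: if_splits)
    qed
    show "F \<subseteq> keys (g l)"
    proof
      fix i assume "i \<in> F"
      then obtain j where "j < s" "i = xs ! j" using xs len by (metis in_set_conv_nth)
      then show "i \<in> keys (g l)" using look by (simp add: in_keys_iff)
    qed
  qed
  have bij: "bij_betw f T L"
  proof (rule bij_betw_byWitness[where f' = g])
    have tot: "total_degree t = (\<Sum>j<s. lookup t (xs ! j))" if "keys t = F" for t
    proof -
      have "total_degree t = sum_list (map (lookup t) xs)"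
        using xs that by (simp add: total_degree_def sum_list_distinct_conv_sum_set)
      also have "\<dots> = (\<Sum>j<s. lookup t (xs ! j))"
        by (simp add: sum_list_sum_nth len atLeast0LessThan)
      finally show ?thesis .
    qed
    show "\<forall>t\<in>T. g (f t) = t"
    proof
      fix t assume t: "t \<in> T"
      show "g (f t) = t"
      proof (rule poly_mapping_eqI)
        fix i
        show "lookup (g (f t)) i = lookup t i"
        proof (cases "i \<in> F")
          case True
          then obtain j where j: "j < s" "i = xs ! j" using xs len by (metis in_set_conv_nth)
          moreover have "lookup t i > 0" using True t by (auto simp: T_def in_keys_iff)
          ultimately show ?thesis using look len by (simp add: f_def)
        next
          case False
          then have "i \<notin> keys (g (f t))" "i \<notin> keys t" using keys_g t by (simp_all add: T_def)
          then show ?thesis by (simp add: in_keys_iff)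
        qed
      qed
    qed
    show "\<forall>l\<in>L. f (g l) = l"
      using look len by (auto simp: f_def L_def intro!: nth_equalityI)
    show "f ` T \<subseteq> L"
    proof
      fix l assume "l \<in> f ` T"
      then obtain t where t: "t \<in> T" "l = f t" by blast
      have pos: "lookup t (xs ! j) \<ge> 1" if "j < s" for j
        using t xs len that by (auto simp: T_def in_keys_iff Suc_le_eq)
      have "sum_list l + s = (\<Sum>j<s. (lookup t (xs ! j) - 1) + 1)"
        using len by (simp only: sum.distrib) (simp add: t f_def sum_list_sum_nth atLeast0LessThan)
      also have "\<dots> = (\<Sum>j<s. lookup t (xs ! j))"
        using pos by (intro sum.cong refl le_add_diff_inverse2) simp
      also have "\<dots> = m" using tot[of t] t(1) by (simp add: T_def)
      finally show "l \<in> L" using t len by (simp add: L_def f_def)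
    qed
    show "g ` L \<subseteq> T"
    proof
      fix t assume "t \<in> g ` L"
      then obtain l where l: "l \<in> L" "t = g l" by blast
      have "total_degree t = (\<Sum>j<s. l ! j + 1)" using tot[of t] l keys_g look by simp
      also have "\<dots> = sum_list l + s"
        using l by (simp only: sum.distrib) (simp add: L_def sum_list_sum_nth atLeast0LessThan)
      finally show "t \<in> T" using l keys_g by (simp add: T_def L_def)
    qed
  qed
  have "finite L"
    by (rule finite_subset[OF _ finite_lists_length_eq[of "{..m}" s]])
      (auto simp: L_def dest: member_le_sum_list)
  then show "finite {t. keys t = F \<and> total_degree t = m}"
    using bij bij_betw_finite by (auto simp: T_def)
  have "card L = ((m - 1) choose (s - 1))"
  proof (cases "s \<le> m")
    case True
    then have "L = {l. length l = s \<and> sum_list l = m - s}" by (auto simp: L_def)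
    then have "card L = ((m - 1) choose (m - s))"
      using card_length_sum_list[of s "m - s"] s True by simp
    also have "\<dots> = ((m - 1) choose (s - 1))"
      using binomial_symmetric[of "m - s" "m - 1"] s True by simp
    finally show ?thesis .
  next
    case False
    then have "L = {}" by (auto simp: L_def)
    then show ?thesis using False m by (simp add: binomial_eq_0)
  qed
  then show "card {t. keys t = F \<and> total_degree t = m} = ((m - 1) choose (card F - 1))"
    using bij_betw_same_card[OF bij] by (simp add: T_def s_def)
qed

section \<open>Hilbert function and multiplicity of a face ring\<close>

context
  fixes n :: nat and \<Delta> :: "nat set set"
  assumes \<Delta>: "down_closed \<Delta>" "\<Delta> \<subseteq> Pow {1..n}" "\<Delta> \<noteq> {}"
begin

definition face_ideal :: "'k::field mpoly set" where
  "face_ideal = mon_ideal \<Delta> \<inter> carrier (poly_ring n)"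

abbreviation face_ring :: "('k::field mpoly, 'k mpoly set) graded_module" where
  "face_ring \<equiv> graded_quotient n face_ideal"

lemma ideal_face_ideal: "ideal (face_ideal :: 'k::field mpoly set) (poly_ring n)"
  unfolding face_ideal_def by (rule ideal_mon_ideal[OF \<Delta>(1)])

definition coeff_field :: "'k::field mpoly set set" where
  "coeff_field = range (\<lambda>c. residue_class n face_ideal (single 0 c))"

lemma empty_face: "{} \<in> \<Delta>"
  using \<Delta> by (auto simp: down_closed_def)

text \<open>The dimension in \<open>hilbert_function\<close> is taken over this subfield. Constants
  embed because the empty set is a face, so the ideal contains no nonzero constant.\<close>

lemma subfield_coeff_field: "subfield (coeff_field :: 'k::field mpoly set set) face_ring"
proof -
  note simps = graded_quotient_simps[OF ideal_face_ideal]
  interpret A: cring "face_ring :: ('k mpoly, 'k mpoly set) graded_module"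
    by (rule cring_graded_quotient[OF ideal_face_ideal])
  have minus: "\<ominus>\<^bsub>face_ring\<^esub> residue_class n face_ideal (single 0 c)
      = residue_class n face_ideal (single 0 (- c) :: 'k mpoly)" for c
    by (rule A.minus_equality) (auto simp: simps simp flip: single_add)
  have sub: "subring (coeff_field :: 'k mpoly set set) face_ring"
    by (rule A.subringI)
      (auto simp: coeff_field_def simps minus mult_single simp flip: single_add single_one
        intro: range_eqI)
  show ?thesis
  proof (rule A.subfieldI)
    show "subcring (coeff_field :: 'k mpoly set set) face_ring" by (rule A.subcringI'[OF sub])
    have one: "single 0 c * single 0 (1 / c) = (1 :: 'k mpoly)" "single 0 (1 / c) * single 0 c = (1 :: 'k mpoly)"
      if "c \<noteq> 0" for c using that by (simp_all add: mult_single)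
    have zero: "residue_class n face_ideal (single 0 c :: 'k mpoly) = residue_class n face_ideal 0 \<longleftrightarrow> c = 0" for c
      unfolding residue_class_eq_iff[OF ideal_face_ideal]
      using empty_face by (auto simp: face_ideal_def mon_ideal_def dest: spec[of _ 0])
    have nz: "residue_class n face_ideal (1 :: 'k mpoly) \<noteq> residue_class n face_ideal 0"
      using zero[of 1] by simp
    show "Units (face_ring\<lparr>carrier := coeff_field :: 'k mpoly set set\<rparr>) = coeff_field - {\<zero>\<^bsub>face_ring\<^esub>}"
    proof (intro equalityI subsetI)
      fix x :: "'k mpoly set" assume "x \<in> Units (face_ring\<lparr>carrier := coeff_field\<rparr>)"
      then have x: "x \<in> coeff_field" and "\<exists>y\<in>coeff_field. y \<otimes>\<^bsub>face_ring\<^esub> x = \<one>\<^bsub>face_ring\<^esub>"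
        by (auto simp: Units_def)
      then obtain a b where a: "x = residue_class n face_ideal (single 0 a)"
        and "residue_class n face_ideal (single 0 b) \<otimes>\<^bsub>face_ring\<^esub> x = \<one>\<^bsub>face_ring\<^esub>"
        unfolding coeff_field_def by blast
      then have "residue_class n face_ideal (single 0 (b * a)) = residue_class n face_ideal 1"
        by (simp add: simps mult_single)
      with nz have "b * a \<noteq> 0" by (metis single_zero)
      then have "residue_class n face_ideal (single 0 a) \<noteq> residue_class n face_ideal 0"
        unfolding zero by simp
      with a x show "x \<in> coeff_field - {\<zero>\<^bsub>face_ring\<^esub>}"
        by (simp add: simps)
    next
      fix x :: "'k mpoly set" assume "x \<in> coeff_field - {\<zero>\<^bsub>face_ring\<^esub>}"
      then obtain a where a: "x = residue_class n face_ideal (single 0 a)"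
        and nonzero: "x \<noteq> residue_class n face_ideal 0"
        unfolding coeff_field_def simps by blast
      have a0: "a \<noteq> 0" using nonzero unfolding a zero .
      have "residue_class n face_ideal (single 0 (1 / a) :: 'k mpoly) \<in> coeff_field"
        by (auto simp: coeff_field_def)
      moreover have "residue_class n face_ideal (single 0 (1 / a)) \<otimes>\<^bsub>face_ring\<^esub> x = \<one>\<^bsub>face_ring\<^esub>"
        "x \<otimes>\<^bsub>face_ring\<^esub> residue_class n face_ideal (single 0 (1 / a)) = \<one>\<^bsub>face_ring\<^esub>"
        using a0 by (simp_all add: a simps one)
      moreover have "x \<in> coeff_field" unfolding a coeff_field_def by blast
      ultimately show "x \<in> Units (face_ring\<lparr>carrier := coeff_field\<rparr>)"
        unfolding Units_def by auto
    qed
  qed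
qed

text \<open>Each further monomial \<open>t\<close> raises the dimension by one: the coefficient at
  \<open>t\<close> vanishes on the ideal and on all polynomials supported in \<open>T\<close>, so
  the class of \<open>t\<close> is independent of the earlier ones.\<close>

lemma dimension_monomials:
  assumes "finite T" "\<And>t. t \<in> T \<Longrightarrow> keys t \<in> \<Delta>"
  shows "ring.dimension face_ring (card T) coeff_field
    (residue_class n face_ideal ` {p :: 'k::field mpoly. keys p \<subseteq> T})"
  using assms
proof (induction T rule: finite_induct)
  note simps = graded_quotient_simps[OF ideal_face_ideal]
  interpret A: cring "face_ring :: ('k mpoly, 'k mpoly set) graded_module"
    by (rule cring_graded_quotient[OF ideal_face_ideal])
  {
    case empty
    have "residue_class n face_ideal ` {p :: 'k mpoly. keys p \<subseteq> {}} = {\<zero>\<^bsub>face_ring\<^esub>}"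
      by (auto simp: simps)
    then show ?case using A.zero_dim by simp
  next
    case (insert t T)
    let ?E = "residue_class n face_ideal ` {p :: 'k mpoly. keys p \<subseteq> T}"
    define v where "v = residue_class n face_ideal (single t 1 :: 'k mpoly)"
    have car: "p \<in> carrier (poly_ring n)" if "keys p \<subseteq> insert t T" for p :: "'k mpoly"
      using that insert.prems \<Delta>(2) unfolding poly_carrier_iff by blast
    have cart: "single t c \<in> carrier (poly_ring n)" for c :: 'k by (rule car) auto
    have v: "v \<in> carrier face_ring" using cart by (auto simp: v_def simps)
    have "v \<notin> ?E"
    proof
      assume "v \<in> ?E"
      then obtain p :: "'k mpoly" where p: "keys p \<subseteq> T" "single t 1 - p \<in> face_ideal"
        by (auto simp: v_def residue_class_eq_iff[OF ideal_face_ideal])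
      have "lookup p t = 0" using p(1) insert.hyps by (auto simp: in_keys_iff)
      moreover have "lookup (single t 1 - p) t = 0"
        using p(2) insert.prems by (auto simp: face_ideal_def mon_ideal_def)
      ultimately show False by (simp add: lookup_minus)
    qed
    moreover have "A.line_extension coeff_field v ?E
        = residue_class n face_ideal ` {p :: 'k mpoly. keys p \<subseteq> insert t T}"
    proof (intro equalityI subsetI)
      fix x assume "x \<in> A.line_extension coeff_field v ?E"
      then obtain c :: 'k and p :: "'k mpoly" where p: "keys p \<subseteq> T"
        "x = residue_class n face_ideal (single 0 c) \<otimes>\<^bsub>face_ring\<^esub> v \<oplus>\<^bsub>face_ring\<^esub> residue_class n face_ideal p"
        by (auto simp: A.line_extension_mem_iff coeff_field_def)
      have "p \<in> carrier (poly_ring n)" using p by (intro car) auto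
      then have "x = residue_class n face_ideal (single t c + p)"
        using p(2) cart by (simp add: v_def simps mult_single)
      moreover have "keys (single t c + p) \<subseteq> insert t T"
        using p(1) keys_add[of "single t c" p] by (auto split: if_splits)
      ultimately show "x \<in> residue_class n face_ideal ` {p. keys p \<subseteq> insert t T}" by blast
    next
      fix x assume "x \<in> residue_class n face_ideal ` {p :: 'k mpoly. keys p \<subseteq> insert t T}"
      then obtain p :: "'k mpoly" where p: "keys p \<subseteq> insert t T" "x = residue_class n face_ideal p" by blast
      define q where "q = p - single t (lookup p t)"
      have q: "keys q \<subseteq> T"
        using p(1) by (auto simp: q_def in_keys_iff lookup_minus lookup_single when_def split: if_splits)
      have "q \<in> carrier (poly_ring n)" using q by (intro car) auto
      then have "x = residue_class n face_ideal (single 0 (lookup p t)) \<otimes>\<^bsub>face_ring\<^esub> v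
          \<oplus>\<^bsub>face_ring\<^esub> residue_class n face_ideal q"
        using cart by (simp add: p(2) v_def simps mult_single q_def)
      then show "x \<in> A.line_extension coeff_field v ?E"
        unfolding A.line_extension_mem_iff coeff_field_def using q by blast
    qed
    ultimately show ?case
      using A.Suc_dim[OF v _ insert.IH] insert.prems insert.hyps by simp
  }
qed

text \<open>The monomials supported on faces give a basis of each component and are counted support
  by support; for positive \<open>m\<close> the empty support does not occur.\<close>

lemma hilbert_function_face_ring:
  assumes "m \<ge> 1"
  shows "hilbert_function (face_ring :: ('k::field mpoly, 'k mpoly set) graded_module) m
    = (\<Sum>F\<in>\<Delta> - {{}}. (m - 1) choose (card F - 1))"
proof -
  note simps = graded_quotient_simps[OF ideal_face_ideal]
  interpret A: cring "face_ring :: ('k mpoly, 'k mpoly set) graded_module"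
    by (rule cring_graded_quotient[OF ideal_face_ideal])
  define T where "T F = {t. keys t = F \<and> total_degree t = m}" for F
  define U where "U = (\<Union>F\<in>\<Delta> - {{}}. T F)"
  have fin\<Delta>: "finite \<Delta>" using \<Delta>(2) finite_subset by blast
  have finF: "finite F" if "F \<in> \<Delta>" for F using that \<Delta>(2) finite_subset[of F "{1..n}"] by auto
  have T: "finite (T F)" "card (T F) = ((m - 1) choose (card F - 1))" if "F \<in> \<Delta> - {{}}" for F
    using card_monomials_with_support[OF finF _ assms] that by (auto simp: T_def)
  have cardU: "card U = (\<Sum>F\<in>\<Delta> - {{}}. card (T F))"
    unfolding U_def using fin\<Delta> T by (intro card_UN_disjoint) (auto simp: T_def)
  have U: "t \<in> U \<longleftrightarrow> keys t \<in> \<Delta> \<and> total_degree t = m" for t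
    using assms by (auto simp: U_def T_def)
  have "component face_ring m = residue_class n face_ideal ` {p :: 'k mpoly. keys p \<subseteq> U}"
  proof (intro equalityI subsetI)
    fix x assume "x \<in> component (face_ring :: ('k mpoly, 'k mpoly set) graded_module) m"
    then obtain p :: "'k mpoly" where p: "p \<in> poly_component n m" "x = residue_class n face_ideal p"
      by (auto simp: component_graded_quotient[OF ideal_face_ideal])
    define q where "q = restrict_poly (\<lambda>t. keys t \<in> \<Delta>) p"
    have "keys q \<subseteq> U" using p(1) by (auto simp: q_def keys_restrict_poly U poly_component_def)
    moreover have "p - q \<in> face_ideal"
      using p(1) by (auto simp: face_ideal_def mon_ideal_def q_def lookup_minus lookup_restrict_poly
          poly_component_def poly_carrier_iff_lookup)
    then have "x = residue_class n face_ideal q"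
      unfolding p(2) residue_class_eq_iff[OF ideal_face_ideal] .
    ultimately show "x \<in> residue_class n face_ideal ` {p :: 'k mpoly. keys p \<subseteq> U}" by blast
  next
    fix x assume "x \<in> residue_class n face_ideal ` {p :: 'k mpoly. keys p \<subseteq> U}"
    then obtain p :: "'k mpoly" where p: "keys p \<subseteq> U" "x = residue_class n face_ideal p" by blast
    then have "p \<in> poly_component n m"
      using \<Delta>(2) by (fastforce simp: poly_component_def poly_carrier_iff U)
    then show "x \<in> component face_ring m"
      by (auto simp: component_graded_quotient[OF ideal_face_ideal] p(2))
  qed
  moreover have "A.dimension (card U) coeff_field (residue_class n face_ideal ` {p :: 'k mpoly. keys p \<subseteq> U})"
    using fin\<Delta> T by (intro dimension_monomials) (auto simp: U, auto simp: U_def)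
  ultimately have "A.dim coeff_field (component face_ring m) = card U"
    using A.dimI[OF subfield_coeff_field] unfolding over_def by simp
  moreover have "range (\<lambda>c :: 'k. const_poly c \<odot>\<^bsub>face_ring\<^esub> \<one>\<^bsub>face_ring\<^esub>) = coeff_field"
    by (simp add: coeff_field_def simps const_poly_def)
  ultimately show ?thesis
    unfolding hilbert_function_def by (simp add: cardU T)
qed

text \<open>A nonempty face with \<open>c\<close> vertices contributes a polynomial of degree
  \<open>c - 1\<close> and leading coefficient \<open>1 / fact (c - 1)\<close>, so exactly the faces
  with \<open>d\<close> vertices reach the top coefficient.\<close>

lemma multiplicity_face_ring:
  assumes dim: "\<And>F. F \<in> \<Delta> \<Longrightarrow> card F \<le> d" and top: "F0 \<in> \<Delta>" "card F0 = d" and d: "d \<ge> 1"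
  shows "algebra_multiplicity (face_ring :: ('k::field mpoly, 'k mpoly set) graded_module)
    = of_nat (card {F \<in> \<Delta>. card F = d})"
proof -
  let ?A = "face_ring :: ('k mpoly, 'k mpoly set) graded_module"
  have fin\<Delta>: "finite \<Delta>" using \<Delta>(2) finite_subset by blast
  define P where "P = (\<Sum>F\<in>\<Delta> - {{}}. gbinom_poly (card F - 1))"
  have P: "of_nat (hilbert_function ?A m) = poly P (of_nat m)" if "m \<ge> 1" for m
    using that by (simp add: hilbert_function_face_ring P_def poly_sum poly_gbinom_poly)
  have "hilbert_polynomial ?A = P"
    unfolding hilbert_polynomial_def
  proof (rule the_equality)
    show "\<exists>N. \<forall>m\<ge>N. of_nat (hilbert_function ?A m) = poly P (of_nat m)" using P by blast
    fix Q :: "rat poly" assume "\<exists>N. \<forall>m\<ge>N. of_nat (hilbert_function ?A m) = poly Q (of_nat m)"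
    then obtain N where N: "\<And>m. m \<ge> N \<Longrightarrow> of_nat (hilbert_function ?A m) = poly Q (of_nat m)" by blast
    \<comment> \<open>Two candidates agree at infinitely many arguments and therefore coincide,
      which the description by \<open>THE\<close> requires.\<close>
    have "(of_nat ` {max 1 N..} :: rat set) \<subseteq> {x. poly (Q - P) x = 0}"
    proof
      fix x :: rat assume "x \<in> of_nat ` {max 1 N..}"
      then obtain m where "x = of_nat m" "m \<ge> 1" "m \<ge> N" by auto
      then show "x \<in> {x. poly (Q - P) x = 0}" using N[of m] P[of m] by simp
    qed
    moreover have "infinite (of_nat ` {max 1 N..} :: rat set)"
      by (subst finite_image_iff) (auto simp: inj_on_def infinite_Ici)
    ultimately show "Q = P" using poly_roots_finite[of "Q - P"] finite_subset by auto
  qed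
  moreover have "degree P \<le> d - 1"
    unfolding P_def using dim by (intro degree_sum_le) (auto simp: fin\<Delta> degree_gbinom_poly diff_le_mono)
  moreover have c: "Polynomial.coeff P (d - 1) = of_nat (card {F \<in> \<Delta>. card F = d}) / fact (d - 1)"
  proof -
    have "Polynomial.coeff P (d - 1) = (\<Sum>F\<in>\<Delta> - {{}}. if card F = d then 1 / fact (d - 1) else 0)"
      unfolding P_def coeff_sum
    proof (intro sum.cong refl)
      fix F assume F: "F \<in> \<Delta> - {{}}"
      show "Polynomial.coeff (gbinom_poly (card F - 1)) (d - 1) = (if card F = d then 1 / fact (d - 1) else 0)"
      proof (cases "card F = d")
        case False
        have "finite F" using F \<Delta>(2) finite_subset[of F "{1..n}"] by auto
        then have "card F - 1 < d - 1" using F False dim[of F] card_gt_0_iff[of F] by force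
        then show ?thesis using False by (simp add: coeff_eq_0 degree_gbinom_poly)
      qed (simp add: coeff_gbinom_poly)
    qed
    also have "\<dots> = of_nat (card {F \<in> \<Delta> - {{}}. card F = d}) / fact (d - 1)"
      using fin\<Delta> by (simp add: sum.If_cases Int_def)
    also have "{F \<in> \<Delta> - {{}}. card F = d} = {F \<in> \<Delta>. card F = d}" using d by auto
    finally show ?thesis .
  qed
  moreover have "card {F \<in> \<Delta>. card F = d} > 0" using top fin\<Delta> by (auto simp: card_gt_0_iff)
  ultimately show ?thesis
    unfolding algebra_multiplicity_def
    using le_degree[of P "d - 1"] by (simp add: antisym)
qed

end

section \<open>Degree bounds for minimal resolutions\<close>

lemma graded_free_simps:
  "zero (graded_free n r \<delta>) = (\<lambda>b. 0)"
  "add (graded_free n r \<delta>) = (\<lambda>f g b. f b + g b)"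
  "smult (graded_free n r \<delta>) = (\<lambda>p f b. p * f b)"
  by (simp_all add: graded_free_def)

lemma graded_free_carrier_iff:
  "f \<in> carrier (graded_free n r \<delta>) \<longleftrightarrow> (\<forall>b. f b \<in> carrier (poly_ring n)) \<and> (\<forall>b\<ge>r. f b = 0)"
  unfolding graded_free_def by (auto, metis not_le poly_carrier_closed(1))

lemma poly_component_iff:
  "p \<in> poly_component n m \<longleftrightarrow> (\<forall>t\<in>keys p. keys t \<subseteq> {1..n} \<and> total_degree t = m)"
  by (auto simp: poly_component_def poly_carrier_iff)

lemma graded_free_component_iff:
  "f \<in> component (graded_free n r \<delta>) m \<longleftrightarrow>
    f \<in> carrier (graded_free n r \<delta>) \<and> (\<forall>b. \<forall>t\<in>keys (f b). total_degree t + \<delta> b = m)"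
proof -
  have "(f b = 0 \<or> \<delta> b \<le> m \<and> f b \<in> poly_component n (m - \<delta> b)) \<longleftrightarrow>
      f b \<in> carrier (poly_ring n) \<and> (\<forall>t\<in>keys (f b). total_degree t + \<delta> b = m)" for b
    by (cases "f b = 0") (fastforce simp: poly_component_iff poly_carrier_iff simp flip: keys_eq_empty)+
  then show ?thesis
    unfolding graded_free_carrier_iff by (auto simp: graded_free_def) (metis keys_zero empty_iff not_le poly_carrier_closed(1))+
qed

definition hpart :: "(nat \<Rightarrow> nat) \<Rightarrow> nat \<Rightarrow> (nat \<Rightarrow> 'k::field mpoly) \<Rightarrow> nat \<Rightarrow> 'k mpoly" where
  "hpart \<delta> m f b = restrict_poly (\<lambda>t. total_degree t + \<delta> b = m) (f b)"

lemma restrict_poly_0 [simp]: "restrict_poly P 0 = 0"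
  by (rule poly_mapping_eqI) (simp add: lookup_restrict_poly)

lemma hpart_component:
  "f \<in> carrier (graded_free n r \<delta>) \<Longrightarrow> hpart \<delta> m f \<in> component (graded_free n r \<delta>) m"
  by (auto simp: graded_free_component_iff graded_free_carrier_iff hpart_def keys_restrict_poly
      poly_carrier_iff)

text \<open>Allowing every larger \<open>D'\<close> makes it possible to insert a prescribed degree
  into the index set.\<close>

lemma hpart_sum:
  assumes "f \<in> carrier (graded_free n r \<delta>)"
  obtains D where "finite D" "\<And>D'. finite D' \<Longrightarrow> D \<subseteq> D' \<Longrightarrow> f = (\<lambda>b. \<Sum>m\<in>D'. hpart \<delta> m f b)"
proof
  define D where "D = (\<Union>b<r. (\<lambda>t. total_degree t + \<delta> b) ` keys (f b))"
  show "finite D" by (simp add: D_def)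
  fix D' assume D': "finite D'" "D \<subseteq> D'"
  show "f = (\<lambda>b. \<Sum>m\<in>D'. hpart \<delta> m f b)"
  proof (intro ext poly_mapping_eqI)
    fix b t
    have "total_degree t + \<delta> b \<in> D'" if "lookup (f b) t \<noteq> 0"
    proof -
      have "b < r" using assms that by (metis graded_free_carrier_iff lookup_zero not_le)
      then have "total_degree t + \<delta> b \<in> D"
        unfolding D_def using that by (intro UN_I image_eqI[where x = t]) (simp_all add: in_keys_iff)
      then show ?thesis using D' by blast
    qed
    then show "lookup (f b) t = lookup (\<Sum>m\<in>D'. hpart \<delta> m f b) t"
      using D'(1) by (auto simp: lookup_sum hpart_def lookup_restrict_poly)
  qed
qed

lemma graded_free_zero_carrier [simp]: "(\<lambda>b. 0) \<in> carrier (graded_free n r \<delta>)"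
  by (simp add: graded_free_carrier_iff)

lemma graded_free_sum_carrier:
  assumes "\<And>v. v \<in> A \<Longrightarrow> c v \<in> carrier (poly_ring n)" "\<And>v. v \<in> A \<Longrightarrow> g v \<in> carrier (graded_free n r \<delta>)"
  shows "(\<lambda>b. \<Sum>v\<in>A. c v * g v b) \<in> carrier (graded_free n r \<delta>)"
  using assms by (auto simp: graded_free_carrier_iff intro!: poly_carrier_sum poly_carrier_mult)

lemma graded_homD:
  assumes "h \<in> graded_hom n M N"
  shows "x \<in> carrier M \<Longrightarrow> h x \<in> carrier N"
    "x \<in> carrier M \<Longrightarrow> y \<in> carrier M \<Longrightarrow> h (x \<oplus>\<^bsub>M\<^esub> y) = h x \<oplus>\<^bsub>N\<^esub> h y"
    "p \<in> carrier (poly_ring n) \<Longrightarrow> x \<in> carrier M \<Longrightarrow> h (p \<odot>\<^bsub>M\<^esub> x) = p \<odot>\<^bsub>N\<^esub> h x"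
    "x \<in> component M m \<Longrightarrow> h x \<in> component N m"
  using assms by (auto simp: graded_hom_def image_subset_iff)

text \<open>Homomorphisms are linear on the carrier only. The weighted form covers zero (the empty
  sum), differences and Koszul differentials alike.\<close>

lemma graded_hom_sum:
  assumes h: "h \<in> graded_hom n (graded_free n r \<delta>) (graded_free n s \<epsilon>)"
    and A: "finite A" "\<And>v. v \<in> A \<Longrightarrow> c v \<in> carrier (poly_ring n)"
      "\<And>v. v \<in> A \<Longrightarrow> g v \<in> carrier (graded_free n r \<delta>)"
  shows "h (\<lambda>b. \<Sum>v\<in>A. c v * g v b) = (\<lambda>b. \<Sum>v\<in>A. c v * h (g v) b)"
  using A
proof (induction A rule: finite_induct)
  case empty
  show ?case using graded_homD(3)[OF h, of 0 "\<lambda>b. 0"] by (simp add: graded_free_simps)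
next
  case (insert x A)
  have x: "(\<lambda>b. c x * g x b) \<in> carrier (graded_free n r \<delta>)"
    using insert.prems graded_free_sum_carrier[of "{x}" c n g r \<delta>] by simp
  have A: "(\<lambda>b. \<Sum>v\<in>A. c v * g v b) \<in> carrier (graded_free n r \<delta>)"
    using insert.prems by (intro graded_free_sum_carrier) auto
  have "h (\<lambda>b. \<Sum>v\<in>insert x A. c v * g v b) = h (\<lambda>b. c x * g x b + (\<Sum>v\<in>A. c v * g v b))"
    using insert.hyps by simp
  also have "\<dots> = (\<lambda>b. h (\<lambda>b. c x * g x b) b + h (\<lambda>b. \<Sum>v\<in>A. c v * g v b) b)"
    using graded_homD(2)[OF h x A] by (simp add: graded_free_simps)
  also have "h (\<lambda>b. c x * g x b) = (\<lambda>b. c x * h (g x) b)"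
    using graded_homD(3)[OF h, of "c x" "g x"] insert.prems by (simp add: graded_free_simps)
  also have "h (\<lambda>b. \<Sum>v\<in>A. c v * g v b) = (\<lambda>b. \<Sum>v\<in>A. c v * h (g v) b)"
    using insert by simp
  finally show ?case using insert.hyps by simp
qed

lemma component_subset_carrier: "f \<in> component (graded_free n r \<delta>) m \<Longrightarrow> f \<in> carrier (graded_free n r \<delta>)"
  by (simp add: graded_free_component_iff)

text \<open>The parts of \<open>f\<close> have homogeneous images of the respective degrees, so
  comparing coefficients isolates one of them. The purpose is to replace a preimage of a homogeneous
  element by a homogeneous one.\<close>

lemma graded_hom_hpart:
  assumes h: "h \<in> graded_hom n (graded_free n r \<delta>) (graded_free n s \<epsilon>)"
    and f: "f \<in> carrier (graded_free n r \<delta>)"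
  shows "h (hpart \<delta> m f) = hpart \<epsilon> m (h f)"
proof -
  obtain D where D: "finite D" "\<And>D'. finite D' \<Longrightarrow> D \<subseteq> D' \<Longrightarrow> f = (\<lambda>b. \<Sum>m\<in>D'. hpart \<delta> m f b)"
    using hpart_sum[OF f] by metis
  define D' where "D' = insert m D"
  have D': "finite D'" "f = (\<lambda>b. \<Sum>k\<in>D'. 1 * hpart \<delta> k f b)"
    using D by (simp_all add: D'_def subset_insertI)
  have hf: "h f = (\<lambda>b. \<Sum>k\<in>D'. h (hpart \<delta> k f) b)"
    by (subst D'(2), subst graded_hom_sum[OF h D'(1)])
      (use f in \<open>auto intro: component_subset_carrier hpart_component\<close>)
  show ?thesis
  proof (intro ext poly_mapping_eqI)
    fix b t
    have comp: "h (hpart \<delta> k f) \<in> component (graded_free n s \<epsilon>) k" for k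
      using graded_homD(4)[OF h hpart_component[OF f]] .
    have "lookup (h (hpart \<delta> k f) b) t = 0" if "total_degree t + \<epsilon> b \<noteq> k" for k
      using comp[of k] that unfolding graded_free_component_iff by (metis in_keys_iff)
    then have "lookup (h f b) t = (\<Sum>k\<in>D'. if total_degree t + \<epsilon> b = k then lookup (h (hpart \<delta> k f) b) t else 0)"
      unfolding hf lookup_sum by (intro sum.cong) auto
    then have *: "lookup (h f b) t = lookup (h (hpart \<delta> (total_degree t + \<epsilon> b) f) b) t"
      if "total_degree t + \<epsilon> b \<in> D'" using D'(1) that by simp
    show "lookup (h (hpart \<delta> m f) b) t = lookup (hpart \<epsilon> m (h f) b) t"
    proof (cases "total_degree t + \<epsilon> b = m")
      case True
      then show ?thesis using * by (simp add: D'_def hpart_def lookup_restrict_poly)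
    next
      case False
      then have "lookup (h (hpart \<delta> m f) b) t = 0"
        using comp[of m] unfolding graded_free_component_iff by (metis in_keys_iff)
      then show ?thesis using False by (simp add: hpart_def lookup_restrict_poly)
    qed
  qed
qed

section \<open>Koszul chains with coefficients in graded free modules\<close>

definition fchain :: "nat \<Rightarrow> nat \<Rightarrow> (nat \<Rightarrow> nat) \<Rightarrow> nat \<Rightarrow> nat \<Rightarrow> (nat set \<Rightarrow> nat \<Rightarrow> 'k::field mpoly) \<Rightarrow> bool" where
  "fchain n r \<delta> i j z \<longleftrightarrow> (\<forall>\<sigma> b. \<forall>t\<in>keys (z \<sigma> b). b < r \<and>
     keys t \<subseteq> {1..n} \<and> \<sigma> \<subseteq> {1..n} \<and> card \<sigma> = i \<and> total_degree t + i + \<delta> b = j)"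

definition fdiff :: "nat \<Rightarrow> (nat set \<Rightarrow> nat \<Rightarrow> 'k::field mpoly) \<Rightarrow> nat set \<Rightarrow> nat \<Rightarrow> 'k mpoly" where
  "fdiff n z \<tau> b = kdiff n (\<lambda>\<sigma>. z \<sigma> b) \<tau>"

text \<open>The analogue of \<open>koszul_exact\<close> for the quotient of a graded free module by a submodule \<open>U\<close>.\<close>

definition fexact :: "nat \<Rightarrow> nat \<Rightarrow> (nat \<Rightarrow> nat) \<Rightarrow> (nat \<Rightarrow> 'k::field mpoly) set \<Rightarrow> nat \<Rightarrow> nat \<Rightarrow> bool" where
  "fexact n r \<delta> U i j \<longleftrightarrow> (\<forall>z. fchain n r \<delta> i j z \<and> (\<forall>\<tau>. fdiff n z \<tau> \<in> U) \<longrightarrow>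
     (\<exists>w. fchain n r \<delta> (Suc i) j w \<and> (\<forall>\<sigma>. (\<lambda>b. z \<sigma> b - fdiff n w \<sigma> b) \<in> U)))"

lemma fchainD:
  assumes "fchain n r \<delta> i j z" "t \<in> keys (z \<sigma> b)"
  shows "b < r" "keys t \<subseteq> {1..n}" "\<sigma> \<subseteq> {1..n}" "card \<sigma> = i" "total_degree t + i + \<delta> b = j"
  using assms by (auto simp: fchain_def)

lemma fchain_kchain: "fchain n r \<delta> i j z \<Longrightarrow> kchain n i (j - \<delta> b) (\<lambda>\<sigma>. z \<sigma> b)"
  by (fastforce simp: fchain_def kchain_def)

lemma fchain_carrier: "fchain n r \<delta> i j z \<Longrightarrow> z \<sigma> \<in> carrier (graded_free n r \<delta>)"
  unfolding fchain_def graded_free_carrier_iff poly_carrier_iff keys_eq_empty[symmetric]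
  by (meson equals0I not_le)

lemma fchain_component:
  "fchain n r \<delta> i j z \<Longrightarrow> z \<sigma> \<in> component (graded_free n r \<delta>) (j - i)"
  by (auto simp: graded_free_component_iff fchain_carrier dest!: fchainD(5))

lemma fchain_diff:
  assumes "fchain n r \<delta> i j y" "fchain n r \<delta> i j z"
  shows "fchain n r \<delta> i j (\<lambda>\<sigma> b. y \<sigma> b - z \<sigma> b)"
proof -
  have "t \<in> keys (y \<sigma> b) \<or> t \<in> keys (z \<sigma> b)" if "t \<in> keys (y \<sigma> b - z \<sigma> b)" for t \<sigma> b
    using that by (auto simp: in_keys_iff lookup_minus)
  then show ?thesis using assms unfolding fchain_def by blast
qed

lemma fchainI:
  assumes "\<And>\<sigma>. z \<sigma> \<in> carrier (graded_free n r \<delta>)"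
    and "\<And>\<sigma>. z \<sigma> \<noteq> (\<lambda>b. 0) \<Longrightarrow> \<sigma> \<subseteq> {1..n} \<and> card \<sigma> = i \<and> i \<le> j \<and> z \<sigma> \<in> component (graded_free n r \<delta>) (j - i)"
  shows "fchain n r \<delta> i j z"
  unfolding fchain_def
proof (intro allI ballI)
  fix \<sigma> b t assume t: "t \<in> keys (z \<sigma> b)"
  then have nz: "z \<sigma> b \<noteq> 0" by auto
  then have "z \<sigma> \<noteq> (\<lambda>b. 0)" by metis
  from assms(2)[OF this] assms(1)[of \<sigma>] t nz
  show "b < r \<and> keys t \<subseteq> {1..n} \<and> \<sigma> \<subseteq> {1..n} \<and> card \<sigma> = i \<and> total_degree t + i + \<delta> b = j"
    by (fastforce simp: graded_free_component_iff graded_free_carrier_iff poly_carrier_iff not_le[symmetric])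
qed

lemma ksign_carrier: "ksign v \<tau> \<in> carrier (poly_ring n)"
  using ksign_eq[of v \<tau>] poly_carrier_closed(2) poly_carrier_closed(3)[OF poly_carrier_closed(2)] by metis

lemma graded_hom_fdiff:
  assumes h: "h \<in> graded_hom n (graded_free n r \<delta>) (graded_free n s \<epsilon>)"
    and z: "\<And>\<sigma>. z \<sigma> \<in> carrier (graded_free n r \<delta>)"
  shows "h (fdiff n z \<tau>) = fdiff n (\<lambda>\<sigma>. h (z \<sigma>)) \<tau>"
proof -
  have "h (\<lambda>b. \<Sum>v\<in>{1..n} - \<tau>. (ksign v \<tau> * indeterminate v) * z (insert v \<tau>) b)
      = (\<lambda>b. \<Sum>v\<in>{1..n} - \<tau>. (ksign v \<tau> * indeterminate v) * h (z (insert v \<tau>)) b)"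
    by (intro graded_hom_sum[OF h] z poly_carrier_mult ksign_carrier poly_carrier_indeterminate) auto
  then show ?thesis unfolding fdiff_def[abs_def] kdiff_def by (simp only: mult.assoc)
qed

text \<open>For \<open>\<Gamma> = Pow {1..n}\<close> the ideal contains no nonzero polynomial in
  \<open>X\<^sub>1, \<dots>, X\<^sub>n\<close>, so the congruence supplied by
  \<open>koszul_exact_Pow\<close> is an equality.\<close>

lemma koszul_acyclic:
  fixes z :: "nat set \<Rightarrow> 'k::field mpoly"
  assumes z: "kchain n i j z" "\<And>\<tau>. kdiff n z \<tau> = 0" "j \<noteq> i"
  obtains w where "kchain n (Suc i) j w" "\<And>\<sigma>. kdiff n w \<sigma> = z \<sigma>"
proof -
  have "koszul_exact n (mon_ideal (Pow {1..n}) :: 'k mpoly set) i j"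
    using assms(3) by (intro koszul_exact_Pow) auto
  then obtain w where w: "kchain n (Suc i) j w" "\<And>\<sigma>. z \<sigma> - kdiff n w \<sigma> \<in> mon_ideal (Pow {1..n})"
    using koszul_exactD[OF _ z(1)] z(2) by (metis mon_ideal_closed(1))
  have "kdiff n w \<sigma> = z \<sigma>" for \<sigma>
  proof -
    have "kchain n i j (\<lambda>\<sigma>. z \<sigma> - kdiff n w \<sigma>)" by (intro kchain_diff z kchain_kdiff w)
    from kchainD(1)[OF this, of _ \<sigma>] have "keys t \<subseteq> {1..n}" if "lookup (z \<sigma> - kdiff n w \<sigma>) t \<noteq> 0" for t
      using that by (simp add: in_keys_iff)
    moreover have "lookup (z \<sigma> - kdiff n w \<sigma>) t = 0" if "keys t \<subseteq> {1..n}" for t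
      using w(2)[of \<sigma>] that by (simp add: mon_ideal_def)
    ultimately have "z \<sigma> - kdiff n w \<sigma> = 0" by (intro poly_mapping_eqI) (metis lookup_zero)
    then show ?thesis by simp
  qed
  with w(1) that show thesis by blast
qed

text \<open>Each coordinate \<open>b\<close> is a copy of \<open>S\<close> shifted by
  \<open>\<delta> b\<close>. The degree assumption keeps \<open>j - \<delta> b\<close> above
  \<open>i\<close>, the only degree in which homology can occur.\<close>

lemma fchain_acyclic:
  assumes z: "fchain n r \<delta> i j z" "\<And>\<tau>. fdiff n z \<tau> = (\<lambda>b. 0)" and \<delta>: "\<And>b. b < r \<Longrightarrow> \<delta> b + i < j"
  obtains w where "fchain n r \<delta> (Suc i) j w" "\<And>\<sigma>. fdiff n w \<sigma> = z \<sigma>"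
proof -
  have "\<exists>w. kchain n (Suc i) (j - \<delta> b) w \<and> (\<forall>\<sigma>. kdiff n w \<sigma> = z \<sigma> b)" if b: "b < r" for b
  proof -
    have "kdiff n (\<lambda>\<sigma>. z \<sigma> b) \<tau> = 0" for \<tau> using z(2)[of \<tau>] by (metis fdiff_def)
    then show ?thesis
    proof (rule koszul_acyclic[OF fchain_kchain[OF z(1), of b]])
      show "j - \<delta> b \<noteq> i" using \<delta>[OF b] by simp
    qed blast
  qed
  then obtain w where w: "\<And>b. b < r \<Longrightarrow> kchain n (Suc i) (j - \<delta> b) (w b)"
    "\<And>b \<sigma>. b < r \<Longrightarrow> kdiff n (w b) \<sigma> = z \<sigma> b" by metis
  define w' where "w' \<sigma> b = (if b < r then w b \<sigma> else 0)" for \<sigma> b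
  have z0: "z \<sigma> b = 0" if "b \<ge> r" for \<sigma> b
    using fchain_carrier[OF z(1)] that by (simp add: graded_free_carrier_iff)
  have "fchain n r \<delta> (Suc i) j w'"
    unfolding fchain_def
  proof (intro allI ballI)
    fix \<sigma> b t assume "t \<in> keys (w' \<sigma> b)"
    then have b: "b < r" "t \<in> keys (w b \<sigma>)" by (auto simp: w'_def split: if_splits)
    from kchainD[OF w(1)[OF b(1)] b(2)] \<delta>[OF b(1)] b(1)
    show "b < r \<and> keys t \<subseteq> {1..n} \<and> \<sigma> \<subseteq> {1..n} \<and> card \<sigma> = Suc i \<and> total_degree t + Suc i + \<delta> b = j"
      by auto
  qed
  moreover have "fdiff n w' \<sigma> = z \<sigma>" for \<sigma>
  proof
    fix b show "fdiff n w' \<sigma> b = z \<sigma> b"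
      using w(2)[of b] z0[of b] by (cases "b < r") (auto simp: fdiff_def w'_def kdiff_def)
  qed
  ultimately show thesis using that by blast
qed

text \<open>
  Dimension shift: with \<open>U = \<phi>(F')\<close> and \<open>K = ker \<phi>\<close>, the sequence \<open>0 \<rightarrow> F'/K \<rightarrow> F \<rightarrow> F/U \<rightarrow> 0\<close> gives
  \<open>H\<^sub>i(F'/K) \<cong> H\<^bsub>i+1\<^esub>(F/U)\<close> in the degrees in which \<open>F\<close> is acyclic.
\<close>

lemma fexact_step:
  fixes \<phi> :: "(nat \<Rightarrow> 'k::field mpoly) \<Rightarrow> nat \<Rightarrow> 'k mpoly"
  assumes \<phi>: "\<phi> \<in> graded_hom n (graded_free n s \<epsilon>) (graded_free n r \<delta>)"
    and ex: "fexact n r \<delta> (\<phi> ` carrier (graded_free n s \<epsilon>)) (Suc i) j"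
    and \<delta>: "\<And>b. b < r \<Longrightarrow> \<delta> b + i < j"
  shows "fexact n s \<epsilon> {f \<in> carrier (graded_free n s \<epsilon>). \<phi> f = (\<lambda>b. 0)} i j"
  unfolding fexact_def
proof safe
  fix z assume z: "fchain n s \<epsilon> i j z"
    and dz: "\<forall>\<tau>. fdiff n z \<tau> \<in> {f \<in> carrier (graded_free n s \<epsilon>). \<phi> f = (\<lambda>b. 0)}"
  let ?U = "\<phi> ` carrier (graded_free n s \<epsilon>)"
  note zc = fchain_carrier[OF z]
  have \<phi>0: "\<phi> (\<lambda>b. 0) = (\<lambda>b. 0)" using graded_hom_sum[OF \<phi>, of "{}"] by simp
  have \<phi>z: "fchain n r \<delta> i j (\<lambda>\<sigma>. \<phi> (z \<sigma>))"
  proof (rule fchainI)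
    show "\<phi> (z \<sigma>) \<in> carrier (graded_free n r \<delta>)" for \<sigma> using graded_homD(1)[OF \<phi> zc] .
    fix \<sigma> assume "\<phi> (z \<sigma>) \<noteq> (\<lambda>b. 0)"
    then have "z \<sigma> \<noteq> (\<lambda>b. 0)" using \<phi>0 by metis
    then obtain b t where "t \<in> keys (z \<sigma> b)" by (metis keys_eq_empty ex_in_conv ext)
    from fchainD[OF z this] graded_homD(4)[OF \<phi> fchain_component[OF z]]
    show "\<sigma> \<subseteq> {1..n} \<and> card \<sigma> = i \<and> i \<le> j \<and> \<phi> (z \<sigma>) \<in> component (graded_free n r \<delta>) (j - i)"
      by auto
  qed
  \<comment> \<open>The connecting homomorphism on chains: \<open>\<phi>\<close> kills the boundary
    of \<open>z\<close>, so the image of \<open>z\<close> is a cycle over a free module and hence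
    the boundary of some \<open>w\<close>, which is a cycle modulo \<open>U\<close> one step
    higher.\<close>
  have "fdiff n (\<lambda>\<sigma>. \<phi> (z \<sigma>)) \<tau> = (\<lambda>b. 0)" for \<tau>
    using graded_hom_fdiff[OF \<phi>, of z \<tau>] zc dz by simp
  from fchain_acyclic[OF \<phi>z this \<delta>] obtain w
    where w: "fchain n r \<delta> (Suc i) j w" "\<And>\<sigma>. fdiff n w \<sigma> = \<phi> (z \<sigma>)" by metis
  have "fdiff n w \<tau> \<in> ?U" for \<tau> using w(2) zc by auto
  then obtain w' where w': "fchain n r \<delta> (Suc (Suc i)) j w'"
    and ww': "\<And>\<sigma>. (\<lambda>b. w \<sigma> b - fdiff n w' \<sigma> b) \<in> ?U"
    using ex w(1) unfolding fexact_def by blast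
  \<comment> \<open>\<open>u\<close> has the same boundary as \<open>w\<close> but takes values in
    \<open>U\<close>, so it lifts along \<open>\<phi>\<close> to a chain \<open>x\<close>; then
    \<open>\<phi>\<close> takes the same values on \<open>z\<close> and on the boundary of
    \<open>x\<close>.\<close>
  define u where "u \<sigma> = (\<lambda>b. w \<sigma> b - fdiff n w' \<sigma> b)" for \<sigma>
  have "fchain n r \<delta> (Suc i) j (fdiff n w')"
    unfolding fchain_def
  proof (intro allI ballI)
    fix \<tau> b t assume t: "t \<in> keys (fdiff n w' \<tau> b)"
    have "\<exists>\<sigma>. w' \<sigma> b \<noteq> 0"
    proof (rule ccontr)
      assume "\<nexists>\<sigma>. w' \<sigma> b \<noteq> 0"
      then have "fdiff n w' \<tau> b = 0" by (simp add: fdiff_def kdiff_def)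
      with t show False by simp
    qed
    then obtain \<sigma> s' where "s' \<in> keys (w' \<sigma> b)" by (metis keys_eq_empty ex_in_conv)
    note c = fchainD[OF w' this]
    have "t \<in> keys (kdiff n (\<lambda>\<sigma>. w' \<sigma> b) \<tau>)" using t by (simp add: fdiff_def)
    from kchainD[OF kchain_kdiff[OF fchain_kchain[OF w']] this] c
    show "b < r \<and> keys t \<subseteq> {1..n} \<and> \<tau> \<subseteq> {1..n} \<and> card \<tau> = Suc i \<and> total_degree t + Suc i + \<delta> b = j"
      by auto
  qed
  then have u: "fchain n r \<delta> (Suc i) j u" unfolding u_def by (intro fchain_diff w)
  \<comment> \<open>The lift is chosen homogeneous, and zero where \<open>u\<close> vanishes, so
    that the chosen values again form a chain on sets with \<open>Suc i\<close> elements.\<close>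
  have "\<exists>f. f \<in> component (graded_free n s \<epsilon>) (j - Suc i) \<and> \<phi> f = u \<sigma> \<and> (u \<sigma> = (\<lambda>b. 0) \<longrightarrow> f = (\<lambda>b. 0))" for \<sigma>
  proof (cases "u \<sigma> = (\<lambda>b. 0)")
    case True
    then show ?thesis using \<phi>0 by (intro exI[of _ "\<lambda>b. 0"]) (auto simp: graded_free_component_iff)
  next
    case False
    obtain f where f: "f \<in> carrier (graded_free n s \<epsilon>)" "u \<sigma> = \<phi> f"
      using ww'[of \<sigma>] unfolding u_def by blast
    have "hpart \<delta> (j - Suc i) (u \<sigma>) = u \<sigma>"
    proof (intro ext poly_mapping_eqI)
      fix b t
      show "lookup (hpart \<delta> (j - Suc i) (u \<sigma>) b) t = lookup (u \<sigma> b) t"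
        using fchain_component[OF u, of \<sigma>]
        unfolding graded_free_component_iff hpart_def lookup_restrict_poly
        by (metis in_keys_iff)
    qed
    then have "\<phi> (hpart \<epsilon> (j - Suc i) f) = u \<sigma>"
      unfolding graded_hom_hpart[OF \<phi> f(1)] f(2) .
    then show ?thesis using False hpart_component[OF f(1)] by blast
  qed
  then obtain x where x: "\<And>\<sigma>. x \<sigma> \<in> component (graded_free n s \<epsilon>) (j - Suc i)" "\<And>\<sigma>. \<phi> (x \<sigma>) = u \<sigma>"
    "\<And>\<sigma>. u \<sigma> = (\<lambda>b. 0) \<Longrightarrow> x \<sigma> = (\<lambda>b. 0)" by metis
  have xc: "x \<sigma> \<in> carrier (graded_free n s \<epsilon>)" for \<sigma> using x(1) component_subset_carrier by blast
  have xch: "fchain n s \<epsilon> (Suc i) j x"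
  proof (rule fchainI[OF xc])
    fix \<sigma> assume "x \<sigma> \<noteq> (\<lambda>b. 0)"
    then have "u \<sigma> \<noteq> (\<lambda>b. 0)" using x(3) by blast
    then obtain b t where "t \<in> keys (u \<sigma> b)" by (metis keys_eq_empty ex_in_conv ext)
    from fchainD[OF u this] x(1)
    show "\<sigma> \<subseteq> {1..n} \<and> card \<sigma> = Suc i \<and> Suc i \<le> j \<and> x \<sigma> \<in> component (graded_free n s \<epsilon>) (j - Suc i)"
      by auto
  qed
  have zx: "(\<lambda>b. z \<sigma> b - fdiff n x \<sigma> b) \<in> carrier (graded_free n s \<epsilon>)"
    "\<phi> (\<lambda>b. z \<sigma> b - fdiff n x \<sigma> b) = (\<lambda>b. 0)" for \<sigma>
  proof -
    have dx: "fdiff n x \<sigma> \<in> carrier (graded_free n s \<epsilon>)"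
    proof -
      have "(\<lambda>b. \<Sum>v\<in>{1..n} - \<sigma>. (ksign v \<sigma> * indeterminate v) * x (insert v \<sigma>) b) \<in> carrier (graded_free n s \<epsilon>)"
        by (intro graded_free_sum_carrier xc poly_carrier_mult ksign_carrier poly_carrier_indeterminate) auto
      then show ?thesis unfolding fdiff_def[abs_def] kdiff_def by (simp only: mult.assoc)
    qed
    \<comment> \<open>Differences are written as weighted sums with two terms, to which
      \<open>graded_hom_sum\<close> applies.\<close>
    let ?c = "\<lambda>k::nat. if k = 0 then 1 else - 1 :: 'k mpoly"
    let ?g = "\<lambda>k::nat. if k = 0 then z \<sigma> else fdiff n x \<sigma>"
    have eq: "(\<lambda>b. y b - y' b) = (\<lambda>b. \<Sum>k<2. ?c k * (if k = 0 then y else y') b)" for y y' :: "nat \<Rightarrow> 'k mpoly"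
      by (auto simp: numeral_2_eq_2)
    have c: "?c k \<in> carrier (poly_ring n)" "?g k \<in> carrier (graded_free n s \<epsilon>)" for k
      using zc dx by auto
    show "(\<lambda>b. z \<sigma> b - fdiff n x \<sigma> b) \<in> carrier (graded_free n s \<epsilon>)"
      unfolding eq by (intro graded_free_sum_carrier c)
    have "\<phi> (\<lambda>b. z \<sigma> b - fdiff n x \<sigma> b) = (\<lambda>b. \<Sum>k<2. ?c k * \<phi> (?g k) b)"
      unfolding eq by (intro graded_hom_sum[OF \<phi>] c) simp
    also have "\<dots> = (\<lambda>b. \<phi> (z \<sigma>) b - fdiff n (\<lambda>\<sigma>. \<phi> (x \<sigma>)) \<sigma> b)"
      using graded_hom_fdiff[OF \<phi>, of x \<sigma>] xc by (auto simp: numeral_2_eq_2)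
    also have "\<dots> = (\<lambda>b. 0)"
    proof
      fix b
      have "fdiff n (\<lambda>\<sigma>. \<phi> (x \<sigma>)) \<sigma> b = fdiff n w \<sigma> b - fdiff n (fdiff n w') \<sigma> b"
        unfolding x(2) u_def fdiff_def by (rule kdiff_diff)
      also have "fdiff n (fdiff n w') \<sigma> b = 0" by (simp add: fdiff_def kdiff_kdiff)
      finally show "\<phi> (z \<sigma>) b - fdiff n (\<lambda>\<sigma>. \<phi> (x \<sigma>)) \<sigma> b = 0" by (simp add: w(2))
    qed
    finally show "\<phi> (\<lambda>b. z \<sigma> b - fdiff n x \<sigma> b) = (\<lambda>b. 0)" .
  qed
  show "\<exists>w. fchain n s \<epsilon> (Suc i) j w \<and>
      (\<forall>\<sigma>. (\<lambda>b. z \<sigma> b - fdiff n w \<sigma> b) \<in> {f \<in> carrier (graded_free n s \<epsilon>). \<phi> f = (\<lambda>b. 0)})"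
    using xch zx by blast
qed

text \<open>A form of Nakayama's lemma. A basis vector of degree \<open>j\<close> is a cycle at the
  empty set; exactness would make it an element of \<open>U\<close> plus a boundary, and neither of
  these has a constant term in coordinate \<open>b\<close>.\<close>

lemma fexact_degree:
  fixes U :: "(nat \<Rightarrow> 'k::field mpoly) set"
  assumes ex: "fexact n r \<delta> U 0 j" and U0: "(\<lambda>b. 0) \<in> U"
    and Um: "\<And>f. f \<in> U \<Longrightarrow> lookup (f b) 0 = 0" and b: "b < r"
  shows "\<delta> b \<noteq> j"
proof
  assume \<delta>: "\<delta> b = j"
  define z :: "nat set \<Rightarrow> nat \<Rightarrow> 'k mpoly" where "z \<sigma> c = (if \<sigma> = {} \<and> c = b then 1 else 0)" for \<sigma> c
  have "fchain n r \<delta> 0 j z" using b \<delta> by (auto simp: fchain_def z_def)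
  moreover have "fdiff n z \<tau> = (\<lambda>b. 0)" for \<tau> by (auto simp: fdiff_def kdiff_def z_def)
  then have "\<forall>\<tau>. fdiff n z \<tau> \<in> U" using U0 by metis
  ultimately obtain w where "\<And>\<sigma>. (\<lambda>b. z \<sigma> b - fdiff n w \<sigma> b) \<in> U"
    using ex unfolding fexact_def by blast
  from Um[OF this[of "{}"]] have "lookup (kdiff n (\<lambda>\<sigma>. w \<sigma> b) {}) 0 = 1"
    by (simp add: lookup_minus z_def fdiff_def)
  moreover have "lookup (indeterminate v * p) 0 = 0" for v and p :: "'k mpoly"
  proof -
    have "0 \<noteq> single v 1 + t" for t :: "nat \<Rightarrow>\<^sub>0 nat"
    proof
      assume "0 = single v 1 + t"
      then have "lookup 0 v = lookup (single v 1 + t) v" by simp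
      then show False by (simp add: lookup_add)
    qed
    then show ?thesis by (simp add: indeterminate_def lookup_single_mult_if)
  qed
  ultimately show False by (simp add: kdiff_def lookup_sum ksign_def)
qed


section \<open>The augmentation, and induction along a minimal resolution\<close>

context
  fixes n :: nat and \<Delta> :: "nat set set" and I :: "'k::field mpoly set"
  assumes \<Delta>: "down_closed \<Delta>" and I_eq: "I = mon_ideal \<Delta> \<inter> carrier (poly_ring n)"
begin

lemma ideal_I: "ideal I (poly_ring n)"
  unfolding I_eq by (rule ideal_mon_ideal[OF \<Delta>])

lemmas quotient_simps = graded_quotient_simps[OF ideal_I]

text \<open>Counterpart of \<open>graded_hom_sum\<close> for maps into the quotient, with values
  given by polynomial representatives.\<close>

lemma graded_hom_quotient_sum:
  assumes h: "h \<in> graded_hom n (graded_free n r \<delta>) (graded_quotient n I)"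
    and A: "finite A" "\<And>v. v \<in> A \<Longrightarrow> c v \<in> carrier (poly_ring n)"
      "\<And>v. v \<in> A \<Longrightarrow> g v \<in> carrier (graded_free n r \<delta>)"
      "\<And>v. v \<in> A \<Longrightarrow> p v \<in> carrier (poly_ring n)"
      "\<And>v. v \<in> A \<Longrightarrow> h (g v) = residue_class n I (p v)"
  shows "h (\<lambda>b. \<Sum>v\<in>A. c v * g v b) = residue_class n I (\<Sum>v\<in>A. c v * p v)"
  using A
proof (induction A rule: finite_induct)
  case empty
  have "h (\<lambda>b. 0) \<in> carrier (graded_quotient n I)" using graded_homD(1)[OF h] by simp
  then obtain p where "p \<in> carrier (poly_ring n)" "h (\<lambda>b. 0) = residue_class n I p"
    by (auto simp: quotient_simps)
  then show ?case
    using graded_homD(3)[OF h, of 0 "\<lambda>b. 0"] by (simp add: graded_free_simps quotient_simps)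
next
  case (insert x A)
  have x: "(\<lambda>b. c x * g x b) \<in> carrier (graded_free n r \<delta>)"
    using insert.prems graded_free_sum_carrier[of "{x}" c n g r \<delta>] by simp
  have A: "(\<lambda>b. \<Sum>v\<in>A. c v * g v b) \<in> carrier (graded_free n r \<delta>)"
    using insert.prems by (intro graded_free_sum_carrier) auto
  have pc: "(\<Sum>v\<in>A. c v * p v) \<in> carrier (poly_ring n)"
    using insert.prems by (intro poly_carrier_sum poly_carrier_mult) auto
  have "h (\<lambda>b. \<Sum>v\<in>insert x A. c v * g v b) = h (\<lambda>b. c x * g x b + (\<Sum>v\<in>A. c v * g v b))"
    using insert.hyps by simp
  also have "\<dots> = h (\<lambda>b. c x * g x b) \<oplus>\<^bsub>graded_quotient n I\<^esub> h (\<lambda>b. \<Sum>v\<in>A. c v * g v b)"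
    using graded_homD(2)[OF h x A] by (simp add: graded_free_simps)
  also have "h (\<lambda>b. c x * g x b) = residue_class n I (c x * p x)"
    using graded_homD(3)[OF h, of "c x" "g x"] insert.prems by (simp add: graded_free_simps quotient_simps)
  also have "h (\<lambda>b. \<Sum>v\<in>A. c v * g v b) = residue_class n I (\<Sum>v\<in>A. c v * p v)"
    using insert by simp
  finally show ?case using insert.hyps insert.prems pc by (simp add: quotient_simps)
qed

lemma lift_component:
  assumes h: "h \<in> graded_hom n (graded_free n r \<delta>) (graded_quotient n I)"
    and f: "f \<in> component (graded_free n r \<delta>) m"
  obtains p where "p \<in> poly_component n m" "p \<in> carrier (poly_ring n)" "h f = residue_class n I p"
proof -
  have "h f \<in> residue_class n I ` poly_component n m"
    using graded_homD(4)[OF h f] by (simp add: component_graded_quotient[OF ideal_I])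
  with that show thesis by (auto simp: poly_component_def)
qed

text \<open>The degree zero part of any preimage of \<open>1\<close> works: a monomial ideal is
  homogeneous, so the degree zero part of a congruence is again a congruence. Multiplying
  \<open>e\<close> by polynomials lifts chains over the quotient to an arbitrary first term
  \<open>F\<^sub>0\<close>.\<close>

lemma lift_one:
  assumes h: "h \<in> graded_hom n (graded_free n r \<delta>) (graded_quotient n I)"
    and surj: "h ` carrier (graded_free n r \<delta>) = carrier (graded_quotient n I)"
  obtains e where "e \<in> component (graded_free n r \<delta>) 0" "h e = residue_class n I 1"
proof -
  have "residue_class n I 1 \<in> h ` carrier (graded_free n r \<delta>)"
    unfolding surj carrier_graded_quotient[OF ideal_I] by (intro imageI poly_carrier_closed)
  then obtain f where f: "f \<in> carrier (graded_free n r \<delta>)" "h f = residue_class n I 1"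
    by (elim imageE) simp
  obtain D where D: "finite D" "\<And>D'. finite D' \<Longrightarrow> D \<subseteq> D' \<Longrightarrow> f = (\<lambda>b. \<Sum>m\<in>D'. hpart \<delta> m f b)"
    using hpart_sum[OF f(1)] by metis
  define D' where "D' = insert 0 D"
  have D': "finite D'" "f = (\<lambda>b. \<Sum>k\<in>D'. 1 * hpart \<delta> k f b)"
    using D by (simp_all add: D'_def subset_insertI)
  have "\<exists>p. p \<in> poly_component n m \<and> p \<in> carrier (poly_ring n) \<and> h (hpart \<delta> m f) = residue_class n I p" for m
    using lift_component[OF h hpart_component[OF f(1)], of m] by blast
  then obtain p where p: "\<And>m. p m \<in> poly_component n m" "\<And>m. p m \<in> carrier (poly_ring n)"
    "\<And>m. h (hpart \<delta> m f) = residue_class n I (p m)"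
    by metis
  have "h f = residue_class n I (\<Sum>m\<in>D'. 1 * p m)"
    by (subst D'(2), rule graded_hom_quotient_sum[OF h D'(1)])
      (use f p in \<open>auto intro: component_subset_carrier hpart_component\<close>)
  then have "1 - (\<Sum>m\<in>D'. p m) \<in> I"
    using f(2) residue_class_eq_iff[OF ideal_I, of 1 "\<Sum>m\<in>D'. p m"] by simp
  then have "restrict_poly (\<lambda>t. total_degree t = 0) (1 - (\<Sum>m\<in>D'. p m)) \<in> I"
    unfolding I_eq by (auto simp: mon_ideal_def lookup_restrict_poly poly_carrier_iff_lookup)
  moreover have "restrict_poly (\<lambda>t. total_degree t = 0) (1 - (\<Sum>m\<in>D'. p m)) = 1 - p 0"
  proof (rule poly_mapping_eqI)
    fix t
    have "lookup (p m) t = 0" if "total_degree t \<noteq> m" for m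
      using p(1)[of m] that unfolding poly_component_iff by (metis in_keys_iff)
    then have "lookup (\<Sum>m\<in>D'. p m) t = (\<Sum>m\<in>D'. if total_degree t = m then lookup (p m) t else 0)"
      unfolding lookup_sum by (intro sum.cong) auto
    then have "lookup (\<Sum>m\<in>D'. p m) t = lookup (p 0) t" if "total_degree t = 0"
      using D'(1) that by (simp add: D'_def)
    moreover have "lookup (1 - p 0) t = 0" if "total_degree t \<noteq> 0"
    proof -
      have "t \<noteq> 0" using that by auto
      moreover have "lookup (p 0) t = 0"
        using p(1)[of 0] that unfolding poly_component_iff by (metis in_keys_iff)
      ultimately show ?thesis by (simp add: lookup_minus lookup_one when_def)
    qed
    ultimately show "lookup (restrict_poly (\<lambda>t. total_degree t = 0) (1 - (\<Sum>m\<in>D'. p m))) t = lookup (1 - p 0) t"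
      by (auto simp: lookup_restrict_poly lookup_minus)
  qed
  ultimately have "residue_class n I 1 = residue_class n I (p 0)"
    by (simp add: residue_class_eq_iff[OF ideal_I])
  then show thesis using that[of "hpart \<delta> 0 f"] hpart_component[OF f(1)] p(3) by simp
qed

text \<open>\<open>F\<^sub>0\<close> modulo the kernel is \<open>k[\<Delta>]\<close>. Cycles are
  sent to representatives of their images, and the resulting chain \<open>w\<close> returns as the
  multiples \<open>w \<sigma> * e\<close> of a preimage \<open>e\<close> of \<open>1\<close>, whose
  degree zero preserves all degrees.\<close>

lemma fexact_kernel:
  assumes h: "h \<in> graded_hom n (graded_free n r \<delta>) (graded_quotient n I)"
    and surj: "h ` carrier (graded_free n r \<delta>) = carrier (graded_quotient n I)"
    and ex: "koszul_exact n (mon_ideal \<Delta> :: 'k mpoly set) i j"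
  shows "fexact n r \<delta> {f \<in> carrier (graded_free n r \<delta>). h f = residue_class n I 0} i j"
  unfolding fexact_def
proof safe
  let ?U = "{f \<in> carrier (graded_free n r \<delta>). h f = residue_class n I 0}"
  fix z assume z: "fchain n r \<delta> i j z" and dz: "\<forall>\<tau>. fdiff n z \<tau> \<in> ?U"
  obtain e where e: "e \<in> component (graded_free n r \<delta>) 0" "h e = residue_class n I 1"
    using lift_one[OF h surj] .
  have ec: "e \<in> carrier (graded_free n r \<delta>)" using e component_subset_carrier by blast
  \<comment> \<open>Zero values get the representative \<open>0\<close>; any other choice could
    violate the condition on the sets \<sigma> that carry a chain.\<close>
  have "\<exists>p. p \<in> poly_component n (j - i) \<and> h (z \<sigma>) = residue_class n I p \<and> (z \<sigma> = (\<lambda>b. 0) \<longrightarrow> p = 0)" for \<sigma>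
  proof (cases "z \<sigma> = (\<lambda>b. 0)")
    case True
    have "h (\<lambda>b. 0) = residue_class n I 0" using graded_hom_quotient_sum[OF h, of "{}"] by simp
    then show ?thesis using True by (intro exI[of _ 0]) (simp add: poly_component_iff)
  next
    case False
    then show ?thesis using lift_component[OF h fchain_component[OF z, of \<sigma>]] by metis
  qed
  then obtain p where p: "\<And>\<sigma>. p \<sigma> \<in> poly_component n (j - i)" "\<And>\<sigma>. h (z \<sigma>) = residue_class n I (p \<sigma>)"
    "\<And>\<sigma>. z \<sigma> = (\<lambda>b. 0) \<Longrightarrow> p \<sigma> = 0" by metis
  have pc: "p \<sigma> \<in> carrier (poly_ring n)" for \<sigma> using p(1) by (auto simp: poly_component_def)
  have pch: "kchain n i j p"
    unfolding kchain_def
  proof (intro allI ballI)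
    fix \<sigma> t assume t: "t \<in> keys (p \<sigma>)"
    then have "z \<sigma> \<noteq> (\<lambda>b. 0)" using p(3) by force
    then obtain b t' where "t' \<in> keys (z \<sigma> b)" by (metis keys_eq_empty ex_in_conv ext)
    from fchainD[OF z this] p(1)[of \<sigma>] t
    show "keys t \<subseteq> {1..n} \<and> \<sigma> \<subseteq> {1..n} \<and> card \<sigma> = i \<and> total_degree t + i = j"
      by (auto simp: poly_component_iff)
  qed
  have car_diff: "kdiff n w \<tau> \<in> carrier (poly_ring n)" if "kchain n i' j' w" for w :: "nat set \<Rightarrow> 'k mpoly" and i' j' \<tau>
    unfolding kdiff_def using kchainD(1)[OF that]
    by (intro poly_carrier_sum poly_carrier_mult ksign_carrier poly_carrier_indeterminate)
      (auto simp: poly_carrier_iff)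
  have dp: "kdiff n p \<tau> \<in> mon_ideal \<Delta>" for \<tau>
  proof -
    have "h (\<lambda>b. \<Sum>v\<in>{1..n} - \<tau>. (ksign v \<tau> * indeterminate v) * z (insert v \<tau>) b)
        = residue_class n I (\<Sum>v\<in>{1..n} - \<tau>. (ksign v \<tau> * indeterminate v) * p (insert v \<tau>))"
      by (intro graded_hom_quotient_sum[OF h] fchain_carrier[OF z] pc p(2) poly_carrier_mult
          ksign_carrier poly_carrier_indeterminate) auto
    then have "h (fdiff n z \<tau>) = residue_class n I (kdiff n p \<tau>)"
      unfolding fdiff_def[abs_def] kdiff_def by (simp only: mult.assoc)
    then have "kdiff n p \<tau> - 0 \<in> I"
      using dz unfolding residue_class_eq_iff[OF ideal_I, symmetric] by auto
    then show ?thesis by (simp add: I_eq)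
  qed
  from koszul_exactD[OF ex pch dp] obtain w where w: "kchain n (Suc i) j w"
    and pw: "\<And>\<sigma>. p \<sigma> - kdiff n w \<sigma> \<in> mon_ideal \<Delta>" by blast
  have wc: "w \<sigma> \<in> carrier (poly_ring n)" for \<sigma>
    using kchainD(1)[OF w] by (auto simp: poly_carrier_iff)
  define x where "x \<sigma> = (\<lambda>b. w \<sigma> * e b)" for \<sigma>
  have "fchain n r \<delta> (Suc i) j x"
    unfolding fchain_def
  proof (intro allI ballI)
    fix \<sigma> b t assume "t \<in> keys (x \<sigma> b)"
    with keys_mult[of "w \<sigma>" "e b"] obtain s u where s: "t = s + u" "s \<in> keys (w \<sigma>)" "u \<in> keys (e b)"
      by (auto simp: x_def)
    have "total_degree u + \<delta> b = 0" using e(1) s(3) by (auto simp: graded_free_component_iff)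
    moreover have "b < r" using ec s(3) unfolding graded_free_carrier_iff
      by (metis keys_zero empty_iff not_le)
    ultimately show "b < r \<and> keys t \<subseteq> {1..n} \<and> \<sigma> \<subseteq> {1..n} \<and> card \<sigma> = Suc i \<and> total_degree t + Suc i + \<delta> b = j"
      using kchainD[OF w s(2)] ec s(3)
      by (auto simp: s(1) keys_add_nat total_degree_add graded_free_carrier_iff poly_carrier_iff)
  qed
  moreover have "(\<lambda>b. z \<sigma> b - fdiff n x \<sigma> b) \<in> ?U" for \<sigma>
  proof -
    have dw: "kdiff n w \<sigma> \<in> carrier (poly_ring n)" by (rule car_diff[OF w])
    have kx: "fdiff n x \<sigma> b = kdiff n w \<sigma> * e b" for b
      unfolding fdiff_def x_def using kdiff_mult[of n "e b" w \<sigma>] by (simp only: mult.commute[of "e b"])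
    let ?c = "\<lambda>k::nat. if k = 0 then 1 else - kdiff n w \<sigma>"
    let ?g = "\<lambda>k::nat. if k = 0 then z \<sigma> else e"
    let ?p = "\<lambda>k::nat. if k = 0 then p \<sigma> else 1"
    have "(\<lambda>b. z \<sigma> b - fdiff n x \<sigma> b) = (\<lambda>b. \<Sum>k<2. ?c k * ?g k b)"
      unfolding kx by (auto simp: numeral_2_eq_2)
    moreover have c: "?c k \<in> carrier (poly_ring n)" "?g k \<in> carrier (graded_free n r \<delta>)"
      "?p k \<in> carrier (poly_ring n)" "h (?g k) = residue_class n I (?p k)" for k
      using fchain_carrier[OF z] dw ec pc p(2) e(2) by auto
    moreover have "h (\<lambda>b. \<Sum>k<2. ?c k * ?g k b) = residue_class n I (\<Sum>k<2. ?c k * ?p k)"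
      by (intro graded_hom_quotient_sum[OF h] c) simp
    moreover have "(\<lambda>b. \<Sum>k<2. ?c k * ?g k b) \<in> carrier (graded_free n r \<delta>)"
      by (intro graded_free_sum_carrier c)
    moreover have "residue_class n I (\<Sum>k<2. ?c k * ?p k) = residue_class n I 0"
      using pw[of \<sigma>] dw pc unfolding residue_class_eq_iff[OF ideal_I]
      by (auto simp: numeral_2_eq_2 I_eq)
    ultimately show ?thesis by (simp only: mem_Collect_eq)
  qed
  ultimately show "\<exists>w. fchain n r \<delta> (Suc i) j w \<and> (\<forall>\<sigma>. (\<lambda>b. z \<sigma> b - fdiff n w \<sigma> b) \<in> ?U)"
    by blast
qed

text \<open>\<open>F\<^sub>l\<close> modulo \<open>U l\<close> is the \<open>l\<close>-th syzygy
  module, beginning with \<open>k[\<Delta>]\<close> itself. Each dimension shift trades one step of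
  the resolution for one Koszul degree, so its \<open>H\<^sub>i\<close> vanishes in degrees above
  \<open>i + l + q\<close>; the case \<open>i = 0\<close> bounds the generators.\<close>

lemma minimal_resolution_degree_bound:
  assumes res: "minimal_graded_free_resolution n (graded_quotient n I) r \<delta> \<phi> \<epsilon>"
    and ex: "\<And>i j. i + q < j \<Longrightarrow> koszul_exact n (mon_ideal \<Delta> :: 'k mpoly set) i j"
    and b: "b < r l"
  shows "\<delta> l b \<le> l + q"
proof -
  let ?F = "\<lambda>i. graded_free n (r i) (\<delta> i)"
  define U where "U l = \<phi> l ` carrier (?F (Suc l))" for l
  have \<epsilon>: "\<epsilon> \<in> graded_hom n (?F 0) (graded_quotient n I)"
    "\<epsilon> ` carrier (?F 0) = carrier (graded_quotient n I)"
    "{f \<in> carrier (?F 0). \<epsilon> f = residue_class n I 0} = U 0"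
    and \<phi>: "\<And>i. \<phi> i \<in> graded_hom n (?F (Suc i)) (?F i)"
    "\<And>i. {f \<in> carrier (?F (Suc i)). \<phi> i f = (\<lambda>b. 0)} = U (Suc i)"
    and min: "\<And>i f b. f \<in> carrier (?F (Suc i)) \<Longrightarrow> b < r i \<Longrightarrow> \<phi> i f b \<in> irrelevant_ideal n"
    using res unfolding minimal_graded_free_resolution_def Let_def U_def
    by (simp_all add: graded_free_simps quotient_simps)
  \<comment> \<open>Exactness at \<open>l\<close> is a premise here because the induction below uses
    the degree bound at \<open>l\<close> to reach \<open>Suc l\<close>.\<close>
  have deg: "\<delta> l b \<le> l + q" if ind: "\<And>i j. i + l + q < j \<Longrightarrow> fexact n (r l) (\<delta> l) (U l) i j" and b: "b < r l" for l b
  proof (rule ccontr)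
    assume "\<not> \<delta> l b \<le> l + q"
    then have "fexact n (r l) (\<delta> l) (U l) 0 (\<delta> l b)" by (intro ind) simp
    moreover have "(\<lambda>b. 0) \<in> U l"
    proof -
      have "\<phi> l (\<lambda>b. 0) = (\<lambda>b. 0)" using graded_hom_sum[OF \<phi>(1)[of l], of "{}"] by simp
      then show ?thesis unfolding U_def by (metis graded_free_zero_carrier image_eqI)
    qed
    moreover have "lookup (f b) 0 = 0" if "f \<in> U l" for f
      using that min[OF _ b] by (auto simp: U_def irrelevant_ideal_eq)
    ultimately show False using fexact_degree[OF _ _ _ b] by blast
  qed
  have exact: "fexact n (r l) (\<delta> l) (U l) i j" if "i + l + q < j" for l i j
    using that
  proof (induction l arbitrary: i j)
    case 0
    show ?case unfolding \<epsilon>(3)[symmetric]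
      using 0 by (intro fexact_kernel[OF \<epsilon>(1,2)] ex) simp
  next
    case (Suc l)
    show ?case unfolding \<phi>(2)[symmetric]
    proof (rule fexact_step[OF \<phi>(1)])
      show "fexact n (r l) (\<delta> l) (\<phi> l ` carrier (?F (Suc l))) (Suc i) j"
        unfolding U_def[symmetric] using Suc.prems by (intro Suc.IH) simp
      fix b assume "b < r l"
      then have "\<delta> l b \<le> l + q" using deg Suc.IH by blast
      then show "\<delta> l b + i < j" using Suc.prems by simp
    qed
  qed
  show ?thesis using deg[OF exact b] by simp
qed

end

section \<open>Existence of minimal resolutions\<close>

definition fscale :: "'k::field \<Rightarrow> (nat \<Rightarrow> 'k) \<Rightarrow> nat \<Rightarrow> 'k" where
  "fscale c f = (\<lambda>b. c * f b)"

interpretation fun_vs: vector_space "fscale :: 'k::field \<Rightarrow> (nat \<Rightarrow> 'k) \<Rightarrow> nat \<Rightarrow> 'k"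
  by unfold_locales (auto simp: fscale_def algebra_simps)

lemma sum_fun_apply: "sum f A b = (\<Sum>a\<in>A. f a b)" for f :: "'a \<Rightarrow> nat \<Rightarrow> 'k::field"
  by (induction A rule: infinite_finite_induct) auto

text \<open>A basis of \<open>W\<close> is extended to one of \<open>V\<close>, and \<open>B\<close>
  consists of the added vectors; the last conclusion is independence modulo \<open>W\<close>.
  Vanishing from \<open>r\<close> on makes \<open>V\<close> finite-dimensional.\<close>

lemma complementary_basis:
  fixes V W :: "(nat \<Rightarrow> 'k::field) set"
  assumes W: "W \<subseteq> V" "fun_vs.subspace W" and V: "\<And>c b. c \<in> V \<Longrightarrow> b \<ge> r \<Longrightarrow> c b = 0"
  obtains B where "finite B" "B \<subseteq> V" "V \<subseteq> fun_vs.span (W \<union> B)"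
    "\<And>a. (\<Sum>c\<in>B. fscale (a c) c) \<in> W \<Longrightarrow> \<forall>c\<in>B. a c = 0"
proof -
  define T :: "(nat \<Rightarrow> 'k) set" where "T = (\<lambda>b c. if c = b then 1 else 0) ` {..<r}"
  have VT: "V \<subseteq> fun_vs.span T"
  proof
    fix c assume c: "c \<in> V"
    have "c = (\<Sum>b<r. fscale (c b) (\<lambda>c. if c = b then 1 else 0))"
    proof
      fix x show "c x = (\<Sum>b<r. fscale (c b) (\<lambda>c. if c = b then 1 else 0)) x"
        using V[OF c, of x] by (simp add: sum_fun_apply fscale_def if_distrib cong: if_cong)
    qed
    also have "\<dots> \<in> fun_vs.span T"
      by (intro fun_vs.span_sum fun_vs.span_scale fun_vs.span_base) (simp add: T_def)
    finally show "c \<in> fun_vs.span T" .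
  qed
  obtain B0 where B0: "B0 \<subseteq> W" "fun_vs.independent B0" "W \<subseteq> fun_vs.span B0"
    by (rule fun_vs.maximal_independent_subset)
  obtain B1 where B1: "B0 \<subseteq> B1" "B1 \<subseteq> V" "fun_vs.independent B1" "V \<subseteq> fun_vs.span B1"
    using fun_vs.maximal_independent_subset_extend[of B0 V] B0 W by blast
  have fin: "finite B1"
    using fun_vs.independent_span_bound[of T B1] B1 VT by (auto simp: T_def)
  then have fin0: "finite B0" using B1 finite_subset by blast
  show thesis
  proof
    show "finite (B1 - B0)" using fin by simp
    show "B1 - B0 \<subseteq> V" using B1 by blast
    show "V \<subseteq> fun_vs.span (W \<union> (B1 - B0))"
      using B1(4) fun_vs.span_mono[of B1 "W \<union> (B1 - B0)"] B0(1) by blast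
    fix a assume "(\<Sum>c\<in>B1 - B0. fscale (a c) c) \<in> W"
    then have "(\<Sum>c\<in>B1 - B0. fscale (a c) c) \<in> fun_vs.span B0" using B0 by blast
    then obtain b where b: "(\<Sum>c\<in>B1 - B0. fscale (a c) c) = (\<Sum>c\<in>B0. fscale (b c) c)"
      unfolding fun_vs.span_finite[OF fin0] by blast
    define u where "u c = (if c \<in> B0 then - b c else a c)" for c
    have "(\<Sum>c\<in>B1. fscale (u c) c) = (\<Sum>c\<in>B1 - B0. fscale (u c) c) + (\<Sum>c\<in>B0. fscale (u c) c)"
      by (rule sum.subset_diff[OF B1(1) fin])
    also have "(\<Sum>c\<in>B1 - B0. fscale (u c) c) = (\<Sum>c\<in>B1 - B0. fscale (a c) c)"
      by (intro sum.cong) (auto simp: u_def)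
    also have "(\<Sum>c\<in>B0. fscale (u c) c) = - (\<Sum>c\<in>B0. fscale (b c) c)"
      unfolding sum_negf[symmetric] by (intro sum.cong) (auto simp: u_def)
    finally have "(\<Sum>c\<in>B1. fscale (u c) c) = 0" by (simp add: b fun_eq_iff)
    then have u0: "u c = 0" if "c \<in> B1" for c
      using fun_vs.independentD[OF B1(3) fin] that by blast
    show "\<forall>c\<in>B1 - B0. a c = 0"
    proof
      fix c assume "c \<in> B1 - B0"
      then show "a c = 0" using u0[of c] by (simp add: u_def)
    qed
  qed
qed

text \<open>
  A squarefree submodule of \<open>\<Oplus>\<^sub>b S(-\<sigma> b)\<close> with \<open>\<nat>\<^sup>n\<close>-graded basis degrees \<open>\<sigma> b \<subseteq> {1..n}\<close> is
  described by one space \<open>V \<tau>\<close> of coordinate vectors for each possible support \<open>\<tau>\<close> of a degree.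
  The last condition says that the submodule lies in the irrelevant ideal times the free module.
\<close>

definition sqdata :: "nat \<Rightarrow> nat \<Rightarrow> (nat \<Rightarrow> nat set) \<Rightarrow> (nat set \<Rightarrow> (nat \<Rightarrow> 'k::field) set) \<Rightarrow> bool" where
  "sqdata n r \<sigma> V \<longleftrightarrow>
    (\<forall>b<r. \<sigma> b \<subseteq> {1..n}) \<and>
    (\<forall>\<tau>\<subseteq>{1..n}. fun_vs.subspace (V \<tau>) \<and> (\<forall>c\<in>V \<tau>. \<forall>b. c b \<noteq> 0 \<longrightarrow> b < r \<and> \<sigma> b \<subset> \<tau>)) \<and>
    (\<forall>\<tau> \<tau>'. \<tau> \<subseteq> \<tau>' \<longrightarrow> \<tau>' \<subseteq> {1..n} \<longrightarrow> V \<tau> \<subseteq> V \<tau>')"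

text \<open>The relations, in multidegrees with support \<tau>, between generators
  \<open>C a\<close> of squarefree degree \<open>\<rho> a\<close>: in such a multidegree a generator
  has one monomial multiple if \<open>\<rho> a \<subseteq> \<tau>\<close> and none
  otherwise.\<close>

definition relation_space :: "nat \<Rightarrow> (nat \<Rightarrow> nat set) \<Rightarrow> (nat \<Rightarrow> nat \<Rightarrow> 'k::field) \<Rightarrow> nat set \<Rightarrow> (nat \<Rightarrow> 'k) set" where
  "relation_space s \<rho> C \<tau> =
    {c. (\<forall>a. c a \<noteq> 0 \<longrightarrow> a < s \<and> \<rho> a \<subseteq> \<tau>) \<and> (\<Sum>a<s. fscale (c a) (C a)) = 0}"

text \<open>Homogeneous generators, in squarefree degrees, of the submodule described by
  \<open>V\<close>. Their minimality is expressed separately, by \<open>sqdata\<close> for the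
  relations between them.\<close>

definition sqcover :: "nat \<Rightarrow> (nat set \<Rightarrow> (nat \<Rightarrow> 'k::field) set) \<Rightarrow> nat \<Rightarrow> (nat \<Rightarrow> nat set) \<Rightarrow> (nat \<Rightarrow> nat \<Rightarrow> 'k) \<Rightarrow> bool" where
  "sqcover n V s \<rho> C \<longleftrightarrow>
    (\<forall>a<s. \<rho> a \<subseteq> {1..n} \<and> C a \<in> V (\<rho> a)) \<and>
    (\<forall>\<tau>\<subseteq>{1..n}. \<forall>v\<in>V \<tau>. \<exists>c. (\<forall>a. c a \<noteq> 0 \<longrightarrow> a < s \<and> \<rho> a \<subseteq> \<tau>) \<and> v = (\<Sum>a<s. fscale (c a) (C a)))"

text \<open>The second assumption is minimality: it turns the inclusion
  \<open>\<rho> a \<subseteq> \<tau>\<close> of \<open>relation_space\<close> into the strict one of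
  \<open>sqdata\<close>, so that no coefficient of a relation is a unit.\<close>

lemma sqdata_relation_space:
  assumes "\<And>a. a < s \<Longrightarrow> \<rho> a \<subseteq> {1..n}"
    and "\<And>\<tau> c a. \<tau> \<subseteq> {1..n} \<Longrightarrow> c \<in> relation_space s \<rho> C \<tau> \<Longrightarrow> \<rho> a = \<tau> \<Longrightarrow> c a = (0 :: 'k::field)"
  shows "sqdata n s \<rho> (relation_space s \<rho> C)"
proof -
  have "fun_vs.subspace (relation_space s \<rho> C \<tau>)" for \<tau>
  proof (rule fun_vs.subspaceI)
    show "0 \<in> relation_space s \<rho> C \<tau>" by (simp add: relation_space_def)
    fix x y assume x: "x \<in> relation_space s \<rho> C \<tau>" and y: "y \<in> relation_space s \<rho> C \<tau>"
    have "x a \<noteq> 0 \<or> y a \<noteq> 0" if "x a + y a \<noteq> 0" for a using that by auto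
    then show "x + y \<in> relation_space s \<rho> C \<tau>"
      using x y by (fastforce simp: relation_space_def fun_vs.scale_left_distrib sum.distrib)
  next
    fix k x assume x: "x \<in> relation_space s \<rho> C \<tau>"
    have "(\<Sum>a<s. fscale (fscale k x a) (C a)) = fscale k (\<Sum>a<s. fscale (x a) (C a))"
      unfolding fun_vs.scale_sum_right by (simp add: fscale_def mult.assoc)
    then show "fscale k x \<in> relation_space s \<rho> C \<tau>"
      using x by (auto simp: relation_space_def) (auto simp: fscale_def)
  qed
  moreover have "a < s \<and> \<rho> a \<subset> \<tau>" if "\<tau> \<subseteq> {1..n}" "c \<in> relation_space s \<rho> C \<tau>" "c a \<noteq> 0" for \<tau> c a
    using assms(2)[OF that(1,2), of a] that by (auto simp: relation_space_def)
  moreover have "relation_space s \<rho> C \<tau> \<subseteq> relation_space s \<rho> C \<tau>'" if "\<tau> \<subseteq> \<tau>'" for \<tau> \<tau>'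
    using that by (auto simp: relation_space_def)
  ultimately show ?thesis unfolding sqdata_def using assms(1) by blast
qed

lemma span_image_coefficients:
  assumes "finite A" "v \<in> fun_vs.span (C ` A)"
  obtains c where "\<And>a. c a \<noteq> 0 \<Longrightarrow> a \<in> A" "v = (\<Sum>a\<in>A. fscale (c a :: 'k::field) (C a))"
proof -
  define L where "L = {\<Sum>a\<in>A. fscale (c a) (C a) | c. \<forall>a. c a \<noteq> (0::'k) \<longrightarrow> a \<in> A}"
  have "fun_vs.span (C ` A) \<subseteq> L"
  proof (rule fun_vs.span_minimal)
    show "C ` A \<subseteq> L"
    proof
      fix v assume "v \<in> C ` A"
      then obtain x where x: "x \<in> A" "v = C x" by blast
      have "v = (\<Sum>a\<in>A. fscale (if a = x then 1 else 0) (C a))"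
        using x assms(1) by (simp add: if_distrib[of "\<lambda>k. fscale k _"] cong: if_cong)
      then show "v \<in> L" using x(1) unfolding L_def
        by (intro CollectI exI[of _ "\<lambda>a. if a = x then 1 else 0"]) auto
    qed
    show "fun_vs.subspace L"
    proof (rule fun_vs.subspaceI)
      show "0 \<in> L" unfolding L_def by (intro CollectI exI[of _ "\<lambda>a. 0"]) simp
      fix x y assume "x \<in> L" "y \<in> L"
      then obtain c d where "x = (\<Sum>a\<in>A. fscale (c a) (C a))" "y = (\<Sum>a\<in>A. fscale (d a) (C a))"
        "\<forall>a. c a \<noteq> 0 \<longrightarrow> a \<in> A" "\<forall>a. d a \<noteq> 0 \<longrightarrow> a \<in> A" unfolding L_def by blast
      moreover from this have "a \<in> A" if "c a + d a \<noteq> 0" for a using that by (metis add_0)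
      ultimately show "x + y \<in> L" unfolding L_def
        by (intro CollectI exI[of _ "\<lambda>a. c a + d a"])
          (simp add: fun_vs.scale_left_distrib sum.distrib)
    next
      fix k x assume "x \<in> L"
      then obtain c where "x = (\<Sum>a\<in>A. fscale (c a) (C a))" "\<forall>a. c a \<noteq> 0 \<longrightarrow> a \<in> A"
        unfolding L_def by blast
      then show "fscale k x \<in> L" unfolding L_def
        by (intro CollectI exI[of _ "\<lambda>a. k * c a"]) (auto simp: fun_vs.scale_sum_right)
    qed
  qed
  with assms(2) that show thesis unfolding L_def by blast
qed

text \<open>For each support the new generators span a complement of what proper subsets already
  contribute. Induction over supports shows that they generate; independence modulo
  \<open>W \<tau>\<close> keeps them out of the relations in their own support.\<close>

lemma sqcover_exists:
  fixes V :: "nat set \<Rightarrow> (nat \<Rightarrow> 'k::field) set"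
  assumes V: "sqdata n r \<sigma> V"
  obtains s \<rho> C where "sqcover n V s \<rho> C" "sqdata n s \<rho> (relation_space s \<rho> C)"
proof -
  have sub: "fun_vs.subspace (V \<tau>)" if "\<tau> \<subseteq> {1..n}" for \<tau> using V that by (auto simp: sqdata_def)
  have mono: "V \<tau> \<subseteq> V \<tau>'" if "\<tau> \<subseteq> \<tau>'" "\<tau>' \<subseteq> {1..n}" for \<tau> \<tau>'
    using V that unfolding sqdata_def by blast
  define W where "W \<tau> = fun_vs.span (\<Union>\<tau>'\<in>{\<tau>'. \<tau>' \<subset> \<tau>}. V \<tau>')" for \<tau>
  have W: "W \<tau> \<subseteq> V \<tau>" if "\<tau> \<subseteq> {1..n}" for \<tau>
    unfolding W_def using mono that by (intro fun_vs.span_minimal sub) auto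
  define Q where "Q \<tau> B \<longleftrightarrow> finite B \<and> B \<subseteq> V \<tau> \<and> V \<tau> \<subseteq> fun_vs.span (W \<tau> \<union> B) \<and>
      (\<forall>a. (\<Sum>c\<in>B. fscale (a c) c) \<in> W \<tau> \<longrightarrow> (\<forall>c\<in>B. a c = 0))" for \<tau> B
  have "\<exists>B. Q \<tau> B" if \<tau>: "\<tau> \<subseteq> {1..n}" for \<tau>
  proof -
    show ?thesis
      unfolding Q_def
    proof (rule complementary_basis[of "W \<tau>" "V \<tau>" r])
      show "W \<tau> \<subseteq> V \<tau>" by (rule W[OF \<tau>])
      show "fun_vs.subspace (W \<tau>)" unfolding W_def by (rule fun_vs.subspace_span)
      show "c b = 0" if "c \<in> V \<tau>" "b \<ge> r" for c b
        using V \<tau> that unfolding sqdata_def by (meson not_le)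
    qed blast
  qed
  then obtain B where Q: "\<And>\<tau>. \<tau> \<subseteq> {1..n} \<Longrightarrow> Q \<tau> (B \<tau>)" by metis
  have B: "\<And>\<tau>. \<tau> \<subseteq> {1..n} \<Longrightarrow> finite (B \<tau>)" "\<And>\<tau>. \<tau> \<subseteq> {1..n} \<Longrightarrow> B \<tau> \<subseteq> V \<tau>"
    "\<And>\<tau>. \<tau> \<subseteq> {1..n} \<Longrightarrow> V \<tau> \<subseteq> fun_vs.span (W \<tau> \<union> B \<tau>)"
    "\<And>\<tau> a c. \<tau> \<subseteq> {1..n} \<Longrightarrow> (\<Sum>c\<in>B \<tau>. fscale (a c) c) \<in> W \<tau> \<Longrightarrow> c \<in> B \<tau> \<Longrightarrow> a c = 0"
    using Q unfolding Q_def by blast+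
  \<comment> \<open>Pairs of a degree and a vector, since one vector may be a new generator in
    several degrees.\<close>
  define X where "X = Sigma (Pow {1..n}) B"
  have "finite X" unfolding X_def using B(1) by auto
  then obtain h where h: "bij_betw h {..<card X} X"
    using ex_bij_betw_nat_finite lessThan_atLeast0 by metis
  define s where "s = card X"
  define \<rho> where "\<rho> a = fst (h a)" for a
  define C where "C a = snd (h a)" for a
  have hX: "h a \<in> X" if "a < s" for a using h that unfolding s_def bij_betw_def by blast
  have \<rho>: "\<rho> a \<subseteq> {1..n}" "C a \<in> B (\<rho> a)" if "a < s" for a
    using hX[OF that] by (auto simp: X_def \<rho>_def C_def)
  then have CV: "C a \<in> V (\<rho> a)" if "a < s" for a using B(2) that by blast
  define G where "G \<tau> = {a. a < s \<and> \<rho> a \<subseteq> \<tau>}" for \<tau>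
  have span: "V \<tau> \<subseteq> fun_vs.span (C ` G \<tau>)" if "\<tau> \<subseteq> {1..n}" for \<tau>
  proof -
    have "finite \<tau>" using that finite_subset by blast
    then show ?thesis using that
    proof (induction \<tau> rule: finite_psubset_induct)
      case (psubset \<tau>)
      have "V \<tau>' \<subseteq> fun_vs.span (C ` G \<tau>)" if "\<tau>' \<subset> \<tau>" for \<tau>'
      proof -
        have "V \<tau>' \<subseteq> fun_vs.span (C ` G \<tau>')" using psubset that by blast
        also have "\<dots> \<subseteq> fun_vs.span (C ` G \<tau>)"
          using that by (intro fun_vs.span_mono image_mono) (auto simp: G_def)
        finally show ?thesis .
      qed
      then have "W \<tau> \<subseteq> fun_vs.span (C ` G \<tau>)"
        unfolding W_def by (intro fun_vs.span_minimal) auto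
      moreover have "B \<tau> \<subseteq> fun_vs.span (C ` G \<tau>)"
      proof
        fix v assume "v \<in> B \<tau>"
        then have "(\<tau>, v) \<in> h ` {..<s}"
          using h psubset.prems by (auto simp: bij_betw_def X_def s_def)
        then obtain a where "a < s" "\<rho> a = \<tau>" "C a = v" by (auto simp: \<rho>_def C_def) (metis fst_conv snd_conv)
        then show "v \<in> fun_vs.span (C ` G \<tau>)" by (intro fun_vs.span_base) (auto simp: G_def)
      qed
      ultimately have "fun_vs.span (W \<tau> \<union> B \<tau>) \<subseteq> fun_vs.span (C ` G \<tau>)"
        by (intro fun_vs.span_minimal) auto
      then show ?case using B(3)[OF psubset.prems] by blast
    qed
  qed
  have restr: "(\<Sum>a<s. fscale (c a) (C a)) = (\<Sum>a\<in>G \<tau>. fscale (c a) (C a))"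
    if "\<And>a. c a \<noteq> 0 \<Longrightarrow> a \<in> G \<tau>" for c \<tau>
    using that by (intro sum.mono_neutral_right) (auto simp: G_def)
  show thesis
  proof
    show "sqcover n V s \<rho> C"
      unfolding sqcover_def
    proof (intro conjI allI impI ballI)
      fix \<tau> v assume v: "\<tau> \<subseteq> {1..n}" "v \<in> V \<tau>"
      have "finite (G \<tau>)" by (simp add: G_def)
      from span_image_coefficients[OF this] span[OF v(1)] v(2)
      obtain c where "\<And>a. c a \<noteq> 0 \<Longrightarrow> a \<in> G \<tau>" "v = (\<Sum>a\<in>G \<tau>. fscale (c a) (C a))" by blast
      then show "\<exists>c. (\<forall>a. c a \<noteq> 0 \<longrightarrow> a < s \<and> \<rho> a \<subseteq> \<tau>) \<and> v = (\<Sum>a<s. fscale (c a) (C a))"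
        using restr[of c \<tau>] by (intro exI[of _ c]) (auto simp: G_def)
    qed (use \<rho> CV in auto)
    show "sqdata n s \<rho> (relation_space s \<rho> C)"
    proof (rule sqdata_relation_space)
      fix \<tau> c a assume \<tau>: "\<tau> \<subseteq> {1..n}" and c: "c \<in> relation_space s \<rho> C \<tau>" and a: "\<rho> a = \<tau>"
      \<comment> \<open>The generators new in \<tau>. A relation expresses their contribution
        through generators of smaller support, hence by an element of
        \<open>W \<tau>\<close>.\<close>
      define H where "H = {a. a < s \<and> \<rho> a = \<tau>}"
      have "H \<subseteq> G \<tau>" "finite (G \<tau>)" by (auto simp: H_def G_def)
      then have "(\<Sum>a\<in>G \<tau>. fscale (c a) (C a))
          = (\<Sum>a\<in>G \<tau> - H. fscale (c a) (C a)) + (\<Sum>a\<in>H. fscale (c a) (C a))"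
        by (rule sum.subset_diff)
      moreover have "(\<Sum>a\<in>G \<tau>. fscale (c a) (C a)) = 0"
        using c restr[of c \<tau>] by (auto simp: relation_space_def G_def)
      ultimately have "(\<Sum>a\<in>H. fscale (c a) (C a)) = - (\<Sum>a\<in>G \<tau> - H. fscale (c a) (C a))"
        by (metis add.commute add_eq_0_iff)
      also have "\<dots> \<in> W \<tau>"
      proof -
        have "C a \<in> W \<tau>" if "a \<in> G \<tau> - H" for a
          unfolding W_def using that CV by (intro fun_vs.span_base) (auto simp: G_def H_def)
        then show ?thesis unfolding W_def
          by (intro fun_vs.span_neg fun_vs.span_sum fun_vs.span_scale)
      qed
      finally have inW: "(\<Sum>a\<in>H. fscale (c a) (C a)) \<in> W \<tau>" .
      have bij: "bij_betw C H (B \<tau>)"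
        unfolding bij_betw_def
      proof
        show inj: "inj_on C H"
        proof (rule inj_onI)
          fix a a' assume "a \<in> H" "a' \<in> H" "C a = C a'"
          then have "h a = h a'" "a < s" "a' < s" by (auto simp: H_def \<rho>_def C_def prod_eq_iff)
          then show "a = a'" using h by (auto simp: bij_betw_def s_def inj_on_def)
        qed
        show "C ` H = B \<tau>"
        proof (intro equalityI subsetI)
          fix v assume "v \<in> B \<tau>"
          then have "(\<tau>, v) \<in> h ` {..<s}"
            using h \<tau> by (auto simp: bij_betw_def X_def s_def)
          then obtain a where "a < s" "\<rho> a = \<tau>" "C a = v" by (auto simp: \<rho>_def C_def) (metis fst_conv snd_conv)
          then show "v \<in> C ` H" by (auto simp: H_def)
        qed (use \<rho> in \<open>auto simp: H_def\<close>)
      qed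
      define g where "g = inv_into H C"
      have g: "g (C a) = a" if "a \<in> H" for a
        unfolding g_def using that bij by (simp add: bij_betw_def)
      have "(\<Sum>v\<in>B \<tau>. fscale (c (g v)) v) = (\<Sum>a\<in>H. fscale (c (g (C a))) (C a))"
        by (rule sum.reindex_bij_betw[OF bij, symmetric])
      also have "\<dots> = (\<Sum>a\<in>H. fscale (c a) (C a))" by (intro sum.cong) (auto simp: g)
      finally have "(\<Sum>v\<in>B \<tau>. fscale (c (g v)) v) \<in> W \<tau>" using inW by simp
      from B(4)[OF \<tau> this] have *: "c (g v) = 0" if "v \<in> B \<tau>" for v using that .
      show "c a = 0"
      proof (cases "a < s")
        case True
        then have aH: "a \<in> H" using a by (simp add: H_def)
        then have "C a \<in> B \<tau>" using bij by (auto simp: bij_betw_def)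
        with * g[OF aH] show ?thesis by metis
      next
        case False
        then show ?thesis using c by (auto simp: relation_space_def)
      qed
    qed (use \<rho> in auto)
  qed
qed

text \<open>
  The coefficients of \<open>f\<close> in the multidegree \<open>u\<close>, where the \<open>b\<close>-th basis vector has multidegree \<open>\<sigma> b\<close>.
\<close>

definition cvec :: "nat \<Rightarrow> (nat \<Rightarrow> nat set) \<Rightarrow> (nat \<Rightarrow> 'k::field mpoly) \<Rightarrow> (nat \<Rightarrow>\<^sub>0 nat) \<Rightarrow> nat \<Rightarrow> 'k" where
  "cvec r \<sigma> f u b = (if b < r \<and> \<sigma> b \<subseteq> keys u then lookup (f b) (u - sqfree (\<sigma> b)) else 0)"

definition sqmod :: "nat \<Rightarrow> nat \<Rightarrow> (nat \<Rightarrow> nat set) \<Rightarrow> (nat set \<Rightarrow> (nat \<Rightarrow> 'k::field) set) \<Rightarrow> (nat \<Rightarrow> 'k mpoly) set" where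
  "sqmod n r \<sigma> V = {f \<in> carrier (graded_free n r (\<lambda>b. card (\<sigma> b))).
     \<forall>u. keys u \<subseteq> {1..n} \<longrightarrow> cvec r \<sigma> f u \<in> V (keys u)}"

text \<open>The \<open>a\<close>-th basis vector goes to the element of multidegree
  \<open>\<rho> a\<close> with coordinate vector \<open>C a\<close>; the monomials fill the gap
  between \<open>\<sigma> b\<close> and \<open>\<rho> a\<close>.\<close>

definition sqmap :: "nat \<Rightarrow> (nat \<Rightarrow> nat set) \<Rightarrow> nat \<Rightarrow> (nat \<Rightarrow> nat set) \<Rightarrow> (nat \<Rightarrow> nat \<Rightarrow> 'k::field)
    \<Rightarrow> (nat \<Rightarrow> 'k mpoly) \<Rightarrow> nat \<Rightarrow> 'k mpoly" where
  "sqmap r \<sigma> s \<rho> C f b =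
    (if b < r then \<Sum>a<s. single (sqfree (\<rho> a - \<sigma> b)) (C a b) * f a else 0)"

lemma cvec_add_sqfree:
  "b < r \<Longrightarrow> finite (\<sigma> b) \<Longrightarrow> cvec r \<sigma> f (t + sqfree (\<sigma> b)) b = lookup (f b) t"
  by (simp add: cvec_def keys_add_nat)

section \<open>The map of a squarefree cover: image, kernel, minimality\<close>

context
  fixes n r :: nat and \<sigma> :: "nat \<Rightarrow> nat set" and V :: "nat set \<Rightarrow> (nat \<Rightarrow> 'k::field) set"
    and s :: nat and \<rho> :: "nat \<Rightarrow> nat set" and C :: "nat \<Rightarrow> nat \<Rightarrow> 'k"
  assumes V: "sqdata n r \<sigma> V" and cov: "sqcover n V s \<rho> C"
begin

lemma cover_degrees:
  shows "b < r \<Longrightarrow> \<sigma> b \<subseteq> {1..n}" "b < r \<Longrightarrow> finite (\<sigma> b)"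
    "a < s \<Longrightarrow> \<rho> a \<subseteq> {1..n}" "a < s \<Longrightarrow> finite (\<rho> a)"
    "a < s \<Longrightarrow> C a b \<noteq> 0 \<Longrightarrow> b < r \<and> \<sigma> b \<subset> \<rho> a"
proof -
  show 1: "b < r \<Longrightarrow> \<sigma> b \<subseteq> {1..n}" for b using V by (auto simp: sqdata_def)
  then show "b < r \<Longrightarrow> finite (\<sigma> b)" using finite_subset by blast
  show 2: "a < s \<Longrightarrow> \<rho> a \<subseteq> {1..n}" for a using cov by (auto simp: sqcover_def)
  then show "a < s \<Longrightarrow> finite (\<rho> a)" using finite_subset by blast
  assume a: "a < s" and Cab: "C a b \<noteq> 0"
  have "C a \<in> V (\<rho> a)" using cov a by (simp add: sqcover_def)
  moreover have "\<forall>c\<in>V (\<rho> a). \<forall>b. c b \<noteq> 0 \<longrightarrow> b < r \<and> \<sigma> b \<subset> \<rho> a"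
    using V 2[OF a] by (simp add: sqdata_def)
  ultimately show "b < r \<and> \<sigma> b \<subset> \<rho> a" using Cab by blast
qed

abbreviation "cover_target \<equiv> graded_free n r (\<lambda>b. card (\<sigma> b)) :: ('k mpoly, nat \<Rightarrow> 'k mpoly) graded_module"
abbreviation "cover_source \<equiv> graded_free n s (\<lambda>a. card (\<rho> a)) :: ('k mpoly, nat \<Rightarrow> 'k mpoly) graded_module"
abbreviation "cover_map \<equiv> sqmap r \<sigma> s \<rho> C"

text \<open>In every multidegree the map acts on coordinate vectors through the matrix
  \<open>C\<close>, which turns questions about image and kernel into linear algebra.\<close>

lemma cvec_sqmap: "cvec r \<sigma> (cover_map f) u = (\<Sum>a<s. fscale (cvec s \<rho> f u a) (C a))"
proof
  fix b
  have C0: "C a b = 0 \<or> b < r \<and> \<sigma> b \<subset> \<rho> a" if "a < s" for a using cover_degrees(5)[OF that] by blast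
  show "cvec r \<sigma> (cover_map f) u b = (\<Sum>a<s. fscale (cvec s \<rho> f u a) (C a)) b"
  proof (cases "b < r \<and> \<sigma> b \<subseteq> keys u")
    case False
    have "cvec s \<rho> f u a * C a b = 0" if "a < s" for a
      using C0[OF that] False by (auto simp: cvec_def)
    then have "(\<Sum>a<s. fscale (cvec s \<rho> f u a) (C a)) b = 0"
      unfolding sum_fun_apply fscale_def by (intro sum.neutral) blast
    moreover have "cvec r \<sigma> (cover_map f) u b = 0" unfolding cvec_def using False by (rule if_not_P)
    ultimately show ?thesis by simp
  next
    case True
    then have fin\<sigma>: "finite (\<sigma> b)" using cover_degrees by blast
    define w where "w = u - sqfree (\<sigma> b)"
    have u: "u = w + sqfree (\<sigma> b)" unfolding w_def using minus_sqfree[OF fin\<sigma>] True by simp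
    have "lookup (single (sqfree (\<rho> a - \<sigma> b)) (C a b) * f a) w = cvec s \<rho> f u a * C a b" if a: "a < s" for a
    proof (cases "C a b = 0")
      case False
      then have sub: "\<sigma> b \<subseteq> \<rho> a" using C0[OF a] by blast
      have fin\<rho>: "finite (\<rho> a)" using cover_degrees a by blast
      have dec: "sqfree (\<rho> a - \<sigma> b) + sqfree (\<sigma> b) = sqfree (\<rho> a)" using sqfree_diff[OF fin\<rho> sub] .
      show ?thesis
      proof (cases "\<rho> a \<subseteq> keys u")
        case True
        define t where "t = u - sqfree (\<rho> a)"
        have "u = t + sqfree (\<rho> a)" unfolding t_def using minus_sqfree[OF fin\<rho> True] by simp
        then have "w + sqfree (\<sigma> b) = (sqfree (\<rho> a - \<sigma> b) + t) + sqfree (\<sigma> b)"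
          unfolding u[symmetric] dec[symmetric] by (simp add: add_ac)
        then have "w = sqfree (\<rho> a - \<sigma> b) + t" by simp
        then show ?thesis using True a by (simp add: lookup_single_mult cvec_def t_def)
      next
        case nsub: False
        have "w \<noteq> sqfree (\<rho> a - \<sigma> b) + t" for t
        proof
          assume "w = sqfree (\<rho> a - \<sigma> b) + t"
          then have "u = sqfree (\<rho> a) + t" unfolding u dec[symmetric] by (simp add: add_ac)
          then show False using nsub fin\<rho> by (simp add: keys_add_nat)
        qed
        then show ?thesis using nsub by (simp add: lookup_single_mult_if cvec_def)
      qed
    qed simp
    then show ?thesis using True
      by (simp add: cvec_def[of r] w_def[symmetric] sqmap_def lookup_sum sum_fun_apply fscale_def)
  qed
qed

text \<open>The coefficient of \<open>f b\<close> at \<open>t\<close> occurs in a coordinate vector,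
  namely in multidegree \<open>t + sqfree (\<sigma> b)\<close>.\<close>

lemma cvec_eq_0_imp:
  assumes f: "f \<in> carrier cover_target" and c: "\<And>u. keys u \<subseteq> {1..n} \<Longrightarrow> cvec r \<sigma> f u = cvec r \<sigma> g u"
    and g: "g \<in> carrier cover_target"
  shows "f = g"
proof (intro ext poly_mapping_eqI)
  fix b t
  show "lookup (f b) t = lookup (g b) t"
  proof (cases "b < r \<and> keys t \<subseteq> {1..n}")
    case True
    then have "finite (\<sigma> b)" "\<sigma> b \<subseteq> {1..n}" using cover_degrees by auto
    then have "cvec r \<sigma> f (t + sqfree (\<sigma> b)) b = cvec r \<sigma> g (t + sqfree (\<sigma> b)) b"
      using True by (subst c) (auto simp: keys_add_nat)
    then show ?thesis using True \<open>finite (\<sigma> b)\<close> by (simp add: cvec_add_sqfree)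
  next
    case False
    then have "f b = 0 \<and> g b = 0 \<or> lookup (f b) t = 0 \<and> lookup (g b) t = 0"
      using f g unfolding graded_free_carrier_iff poly_carrier_iff_lookup by (meson not_le)
    then show ?thesis by auto
  qed
qed

lemma sqmap_carrier: "f \<in> carrier cover_source \<Longrightarrow> cover_map f \<in> carrier cover_target"
proof -
  assume f: "f \<in> carrier cover_source"
  have "single (sqfree (\<rho> a - \<sigma> b)) (C a b) \<in> carrier (poly_ring n)" if "a < s" for a b
    using cover_degrees(3,4)[OF that] by (intro poly_carrier_single) auto
  then show ?thesis using f
    by (auto simp: graded_free_carrier_iff sqmap_def intro!: poly_carrier_sum poly_carrier_mult)
qed

lemma sqmap_hom: "cover_map \<in> graded_hom n cover_source cover_target"
  unfolding graded_hom_def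
proof (intro CollectI conjI ballI allI)
  show "cover_map \<in> carrier cover_source \<rightarrow> carrier cover_target" using sqmap_carrier by blast
  show "cover_map (x \<oplus>\<^bsub>cover_source\<^esub> y) = cover_map x \<oplus>\<^bsub>cover_target\<^esub> cover_map y" for x y
    by (auto simp: graded_free_simps sqmap_def distrib_left sum.distrib)
  show "cover_map (p \<odot>\<^bsub>cover_source\<^esub> x) = p \<odot>\<^bsub>cover_target\<^esub> cover_map x" for p x
    by (auto simp: graded_free_simps sqmap_def sum_distrib_left mult_ac)
  fix m
  show "cover_map ` component cover_source m \<subseteq> component cover_target m"
  proof
    fix g assume "g \<in> cover_map ` component cover_source m"
    then obtain f where f: "f \<in> component cover_source m" "g = cover_map f" by blast
    have "total_degree t + card (\<sigma> b) = m" if "t \<in> keys (cover_map f b)" for b t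
    proof -
      have b: "b < r" using that by (auto simp: sqmap_def split: if_splits)
      then have "(\<Sum>a<s. lookup (single (sqfree (\<rho> a - \<sigma> b)) (C a b) * f a) t) \<noteq> 0"
        using that by (simp add: sqmap_def in_keys_iff lookup_sum)
      then obtain a where a: "a < s" "t \<in> keys (single (sqfree (\<rho> a - \<sigma> b)) (C a b) * f a)"
        unfolding in_keys_iff by (meson lessThan_iff sum.neutral)
      then obtain t' where t': "t' \<in> keys (f a)" "t = sqfree (\<rho> a - \<sigma> b) + t'"
        by (metis in_keys_single_multD)
      have "C a b \<noteq> 0" using a(2) by auto
      then have sub: "\<sigma> b \<subseteq> \<rho> a" using cover_degrees(5)[OF a(1)] by blast
      have "total_degree t' + card (\<rho> a) = m" using f(1) t'(1) by (auto simp: graded_free_component_iff)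
      moreover have "card (\<rho> a) = card (\<rho> a - \<sigma> b) + card (\<sigma> b)"
        using sub cover_degrees(4)[OF a(1)] cover_degrees(2)[OF b] card_mono[OF _ sub] by (simp add: card_Diff_subset)
      moreover have "finite (\<rho> a - \<sigma> b)" using cover_degrees(4)[OF a(1)] by simp
      ultimately show ?thesis by (simp add: t'(2) total_degree_add)
    qed
    then show "g \<in> component cover_target m"
      using sqmap_carrier f component_subset_carrier unfolding graded_free_component_iff f(2) by blast
  qed
qed

lemma sqmap_image: "cover_map ` carrier cover_source = sqmod n r \<sigma> V"
proof (intro equalityI subsetI)
  fix g assume "g \<in> cover_map ` carrier cover_source"
  then obtain f where f: "f \<in> carrier cover_source" "g = cover_map f" by blast
  have "cvec r \<sigma> g u \<in> V (keys u)" if u: "keys u \<subseteq> {1..n}" for u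
  proof -
    have sub: "fun_vs.subspace (V (keys u))" using V u by (auto simp: sqdata_def)
    show ?thesis unfolding f(2) cvec_sqmap
    proof (rule fun_vs.subspace_sum[OF sub])
      fix a assume "a \<in> {..<s}"
      then have a: "a < s" by simp
      show "fscale (cvec s \<rho> f u a) (C a) \<in> V (keys u)"
      proof (cases "\<rho> a \<subseteq> keys u")
        case True
        have "C a \<in> V (\<rho> a)" using cov a by (auto simp: sqcover_def)
        then have "C a \<in> V (keys u)" using V True u unfolding sqdata_def by blast
        then show ?thesis by (rule fun_vs.subspace_scale[OF sub])
      next
        case False
        then show ?thesis using fun_vs.subspace_0[OF sub] by (simp add: cvec_def)
      qed
    qed
  qed
  then show "g \<in> sqmod n r \<sigma> V" using sqmap_carrier[OF f(1)] f(2) by (auto simp: sqmod_def)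
next
  fix g assume "g \<in> sqmod n r \<sigma> V"
  then have g: "g \<in> carrier cover_target" and gV: "\<And>u. keys u \<subseteq> {1..n} \<Longrightarrow> cvec r \<sigma> g u \<in> V (keys u)"
    by (auto simp: sqmod_def)
  \<comment> \<open>The last clause selects zero coordinates wherever \<open>g\<close> has none.
    Hence only finitely many multidegrees carry nonzero coordinates, and the separate choices
    assemble to polynomials.\<close>
  define Q where "Q u c \<longleftrightarrow> (\<forall>a. c a \<noteq> 0 \<longrightarrow> a < s \<and> \<rho> a \<subseteq> keys u) \<and>
    (keys u \<subseteq> {1..n} \<longrightarrow> cvec r \<sigma> g u = (\<Sum>a<s. fscale (c a) (C a))) \<and>
    (cvec r \<sigma> g u = 0 \<or> \<not> keys u \<subseteq> {1..n} \<longrightarrow> c = 0)" for u c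
  have "\<exists>c. Q u c" for u
  proof (cases "cvec r \<sigma> g u = 0 \<or> \<not> keys u \<subseteq> {1..n}")
    case True
    then have "Q u 0" by (auto simp: Q_def)
    then show ?thesis by blast
  next
    case False
    then obtain c where "\<forall>a. c a \<noteq> 0 \<longrightarrow> a < s \<and> \<rho> a \<subseteq> keys u"
      "cvec r \<sigma> g u = (\<Sum>a<s. fscale (c a) (C a))"
      using cov gV[of u] unfolding sqcover_def by blast
    then have "Q u c" using False by (simp add: Q_def)
    then show ?thesis by blast
  qed
  then obtain c where Q: "\<And>u. Q u (c u)" by metis
  have c: "\<And>u a. c u a \<noteq> 0 \<Longrightarrow> a < s \<and> \<rho> a \<subseteq> keys u"
    "\<And>u. keys u \<subseteq> {1..n} \<Longrightarrow> cvec r \<sigma> g u = (\<Sum>a<s. fscale (c u a) (C a))"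
    "\<And>u. cvec r \<sigma> g u = 0 \<or> \<not> keys u \<subseteq> {1..n} \<Longrightarrow> c u = 0"
    using Q unfolding Q_def by blast+
  define D where "D = (\<Union>b<r. (\<lambda>t. t + sqfree (\<sigma> b)) ` keys (g b))"
  have finD: "finite D" by (simp add: D_def)
  have D: "u \<in> D" if "c u a \<noteq> 0" for u a
  proof -
    have "cvec r \<sigma> g u \<noteq> 0" using c(3)[of u] that by auto
    then obtain b where b: "b < r" "\<sigma> b \<subseteq> keys u" "lookup (g b) (u - sqfree (\<sigma> b)) \<noteq> 0"
      by (auto simp: cvec_def fun_eq_iff split: if_splits)
    have "u = (u - sqfree (\<sigma> b)) + sqfree (\<sigma> b)"
      using minus_sqfree[OF cover_degrees(2)[OF b(1)] b(2)] by simp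
    moreover have "u - sqfree (\<sigma> b) \<in> keys (g b)" using b(3) by (simp add: in_keys_iff)
    ultimately have "u \<in> (\<lambda>t. t + sqfree (\<sigma> b)) ` keys (g b)" by (rule image_eqI)
    then show ?thesis unfolding D_def using b(1) by blast
  qed
  define f where "f a = (if a < s then Abs_poly_mapping (\<lambda>t. c (t + sqfree (\<rho> a)) a) else 0)" for a
  have lookf: "lookup (f a) t = c (t + sqfree (\<rho> a)) a" if "a < s" for a t
  proof -
    have "finite ((\<lambda>t. t + sqfree (\<rho> a)) -` D)"
      by (rule finite_vimageI[OF finD]) (simp add: inj_on_def)
    moreover have "{t. c (t + sqfree (\<rho> a)) a \<noteq> 0} \<subseteq> (\<lambda>t. t + sqfree (\<rho> a)) -` D" using D by auto
    ultimately have "finite {t. c (t + sqfree (\<rho> a)) a \<noteq> 0}" using finite_subset by blast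
    then show ?thesis using that by (simp add: f_def)
  qed
  have fF: "f \<in> carrier cover_source"
    unfolding graded_free_carrier_iff poly_carrier_iff_lookup
  proof (intro conjI allI impI)
    fix a and t :: "nat \<Rightarrow>\<^sub>0 nat" assume t: "\<not> keys t \<subseteq> {1..n}"
    show "lookup (f a) t = 0"
    proof (cases "a < s")
      case True
      have "\<not> keys (t + sqfree (\<rho> a)) \<subseteq> {1..n}" using t by (auto simp: keys_add_nat)
      then show ?thesis using c(3) lookf[OF True] by simp
    qed (simp add: f_def)
  qed (simp add: f_def)
  have cf: "cvec s \<rho> f u = c u" for u
  proof
    fix a
    show "cvec s \<rho> f u a = c u a"
    proof (cases "a < s \<and> \<rho> a \<subseteq> keys u")
      case True
      then have "u - sqfree (\<rho> a) + sqfree (\<rho> a) = u" using minus_sqfree cover_degrees(4) by blast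
      then show ?thesis using True lookf by (simp add: cvec_def)
    next
      case False
      then show ?thesis using c(1)[of u a] by (auto simp: cvec_def)
    qed
  qed
  have "cover_map f = g"
  proof (rule cvec_eq_0_imp[OF sqmap_carrier[OF fF] _ g])
    show "cvec r \<sigma> (cover_map f) u = cvec r \<sigma> g u" if "keys u \<subseteq> {1..n}" for u
      unfolding cvec_sqmap cf using c(2)[OF that] by simp
  qed
  with fF show "g \<in> cover_map ` carrier cover_source" by blast
qed

lemma sqmap_kernel: "{f \<in> carrier cover_source. cover_map f = (\<lambda>b. 0)} = sqmod n s \<rho> (relation_space s \<rho> C)"
proof -
  have "cover_map f = (\<lambda>b. 0) \<longleftrightarrow> (\<forall>u. keys u \<subseteq> {1..n} \<longrightarrow> cvec s \<rho> f u \<in> relation_space s \<rho> C (keys u))"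
    if f: "f \<in> carrier cover_source" for f
  proof -
    have 0: "cvec r \<sigma> (\<lambda>b. 0) u = 0" for u by (auto simp: cvec_def)
    have "cover_map f = (\<lambda>b. 0) \<longleftrightarrow> (\<forall>u. keys u \<subseteq> {1..n} \<longrightarrow> cvec r \<sigma> (cover_map f) u = 0)"
    proof (intro iffI allI impI)
      assume "\<forall>u. keys u \<subseteq> {1..n} \<longrightarrow> cvec r \<sigma> (cover_map f) u = 0"
      then show "cover_map f = (\<lambda>b. 0)"
        by (intro cvec_eq_0_imp[OF sqmap_carrier[OF f]]) (simp_all add: 0)
    qed (simp add: 0)
    also have "\<dots> \<longleftrightarrow> (\<forall>u. keys u \<subseteq> {1..n} \<longrightarrow> cvec s \<rho> f u \<in> relation_space s \<rho> C (keys u))"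
      unfolding cvec_sqmap by (auto simp: relation_space_def cvec_def)
    finally show ?thesis .
  qed
  then show ?thesis unfolding sqmod_def by blast
qed

text \<open>The constant term of coordinate \<open>b\<close> sits in multidegree
  \<open>\<sigma> b\<close>, where the strict inclusion in \<open>sqdata\<close> forces it to
  vanish.\<close>

lemma sqmap_minimal:
  assumes f: "f \<in> carrier cover_source" and b: "b < r"
  shows "cover_map f b \<in> irrelevant_ideal n"
proof -
  have fin: "finite (\<sigma> b)" "\<sigma> b \<subseteq> {1..n}" using cover_degrees b by auto
  have "cover_map f \<in> sqmod n r \<sigma> V" unfolding sqmap_image[symmetric] using f by (rule imageI)
  then have "keys (sqfree (\<sigma> b)) \<subseteq> {1..n} \<longrightarrow> cvec r \<sigma> (cover_map f) (sqfree (\<sigma> b)) \<in> V (keys (sqfree (\<sigma> b)))"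
    unfolding sqmod_def by blast
  then have "cvec r \<sigma> (cover_map f) (sqfree (\<sigma> b)) \<in> V (\<sigma> b)"
    unfolding keys_sqfree[OF fin(1)] using fin(2) by blast
  then have "cvec r \<sigma> (cover_map f) (0 + sqfree (\<sigma> b)) b = 0"
    using V fin(2) unfolding sqdata_def add_0 by blast
  then have "lookup (cover_map f b) 0 = 0" using cvec_add_sqfree b fin by metis
  then show ?thesis using sqmap_carrier[OF f] by (simp add: irrelevant_ideal_eq graded_free_carrier_iff)
qed

end


text \<open>The Stanley--Reisner ideal as a squarefree submodule of \<open>S\<close>, with a single
  basis vector in multidegree \<open>{}\<close>.\<close>

definition face_space :: "nat set set \<Rightarrow> nat set \<Rightarrow> (nat \<Rightarrow> 'k::field) set" where
  "face_space \<Delta> \<tau> = {c. \<forall>b. c b \<noteq> 0 \<longrightarrow> b < 1 \<and> \<tau> \<notin> \<Delta>}"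

text \<open>For a basis vector in degree \<open>{}\<close>, the strict inclusion in
  \<open>sqdata\<close> says that the empty support contributes nothing, and this holds because the
  empty set is a face.\<close>

lemma sqdata_face_space:
  assumes "down_closed \<Delta>" "{} \<in> \<Delta>"
  shows "sqdata n 1 (\<lambda>_. {}) (face_space \<Delta> :: nat set \<Rightarrow> (nat \<Rightarrow> 'k::field) set)"
proof -
  have "fun_vs.subspace (face_space \<Delta> \<tau> :: (nat \<Rightarrow> 'k) set)" for \<tau>
    by (rule fun_vs.subspaceI) (auto simp: face_space_def fscale_def, (metis add_0)+)
  moreover have "{} \<subset> \<tau>" if "c \<in> face_space \<Delta> \<tau>" "c b \<noteq> (0 :: 'k)" for \<tau> c b
    using that assms(2) by (auto simp: face_space_def)
  moreover have "face_space \<Delta> \<tau> \<subseteq> (face_space \<Delta> \<tau>' :: (nat \<Rightarrow> 'k) set)" if "\<tau> \<subseteq> \<tau>'" for \<tau> \<tau>'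
    using that down_closedD[OF assms(1)] by (auto simp: face_space_def)
  ultimately show ?thesis unfolding sqdata_def by (auto simp: face_space_def)
qed

lemma minimal_graded_free_resolution_exists:
  fixes n :: nat and \<Delta> :: "nat set set" and I :: "'k::field mpoly set"
  assumes \<Delta>: "down_closed \<Delta>" "{} \<in> \<Delta>"
    and I_def: "I = mon_ideal \<Delta> \<inter> carrier (poly_ring n)"
  obtains r \<delta> \<phi> \<epsilon> where "minimal_graded_free_resolution n (graded_quotient n I) r \<delta> \<phi> \<epsilon>"
proof -
  have I: "ideal I (poly_ring n)" unfolding I_def by (rule ideal_mon_ideal[OF \<Delta>(1)])
  note simps = graded_quotient_simps[OF I]
  \<comment> \<open>A state holds the rank, the multidegrees, the submodule to be covered next and
    the matrix into the preceding term; the matrix at stage \<open>0\<close> is a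
    placeholder.\<close>
  define P where "P i x \<longleftrightarrow> (case x of (r, \<sigma>, V, C) \<Rightarrow> sqdata n r \<sigma> V \<and>
      (i = 0 \<longrightarrow> r = 1 \<and> \<sigma> = (\<lambda>_. {}) \<and> V = face_space \<Delta>))"
    for i :: nat and x :: "nat \<times> (nat \<Rightarrow> nat set) \<times> (nat set \<Rightarrow> (nat \<Rightarrow> 'k) set) \<times> (nat \<Rightarrow> nat \<Rightarrow> 'k)"
  define Q where "Q x y \<longleftrightarrow> (case x of (r, \<sigma>, V, C) \<Rightarrow> case y of (s, \<rho>, V', D) \<Rightarrow>
      sqcover n V s \<rho> D \<and> V' = relation_space s \<rho> D)"
    for x y :: "nat \<times> (nat \<Rightarrow> nat set) \<times> (nat set \<Rightarrow> (nat \<Rightarrow> 'k) set) \<times> (nat \<Rightarrow> nat \<Rightarrow> 'k)"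
  have "\<exists>f. \<forall>i. P i (f i) \<and> Q (f i) (f (Suc i))"
  proof (rule dependent_nat_choice)
    have "P 0 (1, \<lambda>_. {}, face_space \<Delta>, undefined)"
      using sqdata_face_space[OF \<Delta>] by (simp add: P_def)
    then show "\<exists>x. P 0 x" by blast
    fix x i assume "P i x"
    then obtain r \<sigma> V C where x: "x = (r, \<sigma>, V, C)" and V: "sqdata n r \<sigma> V"
      by (cases x) (auto simp: P_def)
    obtain s \<rho> D where "sqcover n V s \<rho> D" "sqdata n s \<rho> (relation_space s \<rho> D)"
      by (rule sqcover_exists[OF V])
    then have "P (Suc i) (s, \<rho>, relation_space s \<rho> D, D) \<and> Q x (s, \<rho>, relation_space s \<rho> D, D)"
      by (simp add: P_def Q_def x)
    then show "\<exists>y. P (Suc i) y \<and> Q x y" by blast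
  qed
  then obtain f where f: "\<And>i. P i (f i)" "\<And>i. Q (f i) (f (Suc i))" by blast
  define r where "r i = fst (f i)" for i
  define \<sigma> where "\<sigma> i = fst (snd (f i))" for i
  define V where "V i = fst (snd (snd (f i)))" for i
  \<comment> \<open>The matrix of \<open>\<phi> i\<close> is stored with its source, hence the shift
    by one.\<close>
  define C where "C i = snd (snd (snd (f (Suc i))))" for i
  have sq: "sqdata n (r i) (\<sigma> i) (V i)" for i
    using f(1)[of i] by (auto simp: P_def r_def \<sigma>_def V_def split: prod.splits)
  have base: "r 0 = 1" "\<sigma> 0 = (\<lambda>_. {})" "V 0 = face_space \<Delta>"
    using f(1)[of 0] by (auto simp: P_def r_def \<sigma>_def V_def split: prod.splits)
  have cov: "sqcover n (V i) (r (Suc i)) (\<sigma> (Suc i)) (C i)"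
    and V_Suc: "V (Suc i) = relation_space (r (Suc i)) (\<sigma> (Suc i)) (C i)" for i
    using f(2)[of i] by (auto simp: Q_def r_def \<sigma>_def V_def C_def split: prod.splits)
  define \<delta> where "\<delta> i b = card (\<sigma> i b)" for i b
  have \<delta>: "\<delta> i = (\<lambda>b. card (\<sigma> i b))" for i by (simp add: \<delta>_def fun_eq_iff)
  define \<phi> where "\<phi> i = sqmap (r i) (\<sigma> i) (r (Suc i)) (\<sigma> (Suc i)) (C i)" for i
  define \<epsilon> where "\<epsilon> f = residue_class n I (f 0)" for f :: "nat \<Rightarrow> 'k mpoly"
  let ?F = "\<lambda>i. graded_free n (r i) (\<delta> i) :: ('k mpoly, nat \<Rightarrow> 'k mpoly) graded_module"
  have car0: "g 0 \<in> carrier (poly_ring n)" if "g \<in> carrier (?F 0)" for g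
    using that by (simp add: graded_free_carrier_iff)
  have e1: "\<epsilon> \<in> graded_hom n (?F 0) (graded_quotient n I)"
    unfolding graded_hom_def
  proof (intro CollectI conjI ballI allI)
    show "\<epsilon> \<in> carrier (?F 0) \<rightarrow> carrier (graded_quotient n I)"
      using car0 by (auto simp: \<epsilon>_def simps)
    show "\<epsilon> (x \<oplus>\<^bsub>?F 0\<^esub> y) = \<epsilon> x \<oplus>\<^bsub>graded_quotient n I\<^esub> \<epsilon> y" if "x \<in> carrier (?F 0)" "y \<in> carrier (?F 0)" for x y
      using that car0 by (simp add: \<epsilon>_def simps graded_free_simps)
    show "\<epsilon> (p \<odot>\<^bsub>?F 0\<^esub> x) = p \<odot>\<^bsub>graded_quotient n I\<^esub> \<epsilon> x"
      if "p \<in> carrier (poly_ring n)" "x \<in> carrier (?F 0)" for p x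
      using that car0 by (simp add: \<epsilon>_def simps graded_free_simps)
    show "\<epsilon> ` component (?F 0) m \<subseteq> component (graded_quotient n I) m" for m
      unfolding component_graded_quotient[OF I]
      by (auto simp: \<epsilon>_def graded_free_component_iff \<delta>_def base poly_component_def
          intro!: imageI car0)
  qed
  have e2: "\<epsilon> ` carrier (?F 0) = carrier (graded_quotient n I)"
  proof (intro equalityI subsetI)
    fix x assume "x \<in> carrier (graded_quotient n I)"
    then obtain p where p: "p \<in> carrier (poly_ring n)" "x = residue_class n I p" by (auto simp: simps)
    have "(\<lambda>b. if b = 0 then p else 0) \<in> carrier (?F 0)"
      using p by (auto simp: graded_free_carrier_iff base)
    moreover have "\<epsilon> (\<lambda>b. if b = 0 then p else 0) = x" by (simp add: \<epsilon>_def p)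
    ultimately show "x \<in> \<epsilon> ` carrier (?F 0)" by blast
  qed (use car0 in \<open>auto simp: \<epsilon>_def simps\<close>)
  have e3: "{g \<in> carrier (?F 0). \<epsilon> g = \<zero>\<^bsub>graded_quotient n I\<^esub>} = \<phi> 0 ` carrier (?F 1)"
  proof -
    have "\<epsilon> g = \<zero>\<^bsub>graded_quotient n I\<^esub> \<longleftrightarrow>
        (\<forall>u. keys u \<subseteq> {1..n} \<longrightarrow> cvec (r 0) (\<sigma> 0) g u \<in> V 0 (keys u))" if g: "g \<in> carrier (?F 0)" for g
    proof -
      have "\<epsilon> g = \<zero>\<^bsub>graded_quotient n I\<^esub> \<longleftrightarrow> g 0 \<in> I"
        by (simp add: \<epsilon>_def simps residue_class_eq_iff[OF I])
      also have "\<dots> \<longleftrightarrow> (\<forall>u. keys u \<in> \<Delta> \<longrightarrow> lookup (g 0) u = 0)"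
        using car0[OF g] by (simp add: I_def mon_ideal_def)
      also have "\<dots> \<longleftrightarrow> (\<forall>u. keys u \<subseteq> {1..n} \<longrightarrow> keys u \<in> \<Delta> \<longrightarrow> lookup (g 0) u = 0)"
        using car0[OF g] unfolding poly_carrier_iff_lookup by blast
      also have "\<dots> \<longleftrightarrow> (\<forall>u. keys u \<subseteq> {1..n} \<longrightarrow> cvec (r 0) (\<sigma> 0) g u \<in> V 0 (keys u))"
        by (auto simp: cvec_def base face_space_def)
      finally show ?thesis .
    qed
    then have "{g \<in> carrier (?F 0). \<epsilon> g = \<zero>\<^bsub>graded_quotient n I\<^esub>} = sqmod n (r 0) (\<sigma> 0) (V 0)"
      unfolding sqmod_def \<delta> by blast
    then show ?thesis
      using sqmap_image[OF sq cov, of 0] by (simp add: \<delta> \<phi>_def)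
  qed
  have e4: "{g \<in> carrier (?F (Suc i)). \<phi> i g = \<zero>\<^bsub>?F i\<^esub>} = \<phi> (Suc i) ` carrier (?F (Suc (Suc i)))" for i
    using sqmap_kernel[OF sq cov, of i] sqmap_image[OF sq cov, of "Suc i"]
    by (simp add: \<delta> \<phi>_def V_Suc graded_free_simps)
  have e5: "\<phi> i \<in> graded_hom n (?F (Suc i)) (?F i)" for i
    using sqmap_hom[OF sq cov, of i] by (simp add: \<delta> \<phi>_def)
  have e6: "\<phi> i g b \<in> irrelevant_ideal n" if "g \<in> carrier (?F (Suc i))" "b < r i" for i g b
    using sqmap_minimal[OF sq cov, of g i b] that by (simp add: \<delta> \<phi>_def)
  have "minimal_graded_free_resolution n (graded_quotient n I) r \<delta> \<phi> \<epsilon>"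
    unfolding minimal_graded_free_resolution_def Let_def
    by (intro conjI allI ballI impI e1 e2 e3 e4 e5 e6)
  then show thesis using that by blast
qed

section \<open>Linearity from the degree bound and the initial degree\<close>

theorem theorem2p7:
  fixes n d :: nat
    and \<Delta> :: "nat set set"
    and A :: "('k::field mpoly, 'k mpoly set) graded_module"
  assumes "simplicial_complex n \<Delta>"
    and "A = stanley_reisner_ring n \<Delta>"
    and "krull_dim A = enat d"
    and "d \<ge> 2"
    and "indeg n A = enat d"
    and "algebra_multiplicity A \<le> of_nat d"
  shows "has_q_linear_resolution d n A \<and> relation_type n A = enat d"
proof -
  define I :: "'k mpoly set" where "I = mon_ideal \<Delta> \<inter> carrier (poly_ring n)"
  have A: "A = graded_quotient n I"
    by (simp add: assms(2) stanley_reisner_ring_def stanley_reisner_ideal_eq[OF assms(1)] I_def)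
  have dc: "down_closed \<Delta>" by (rule simplicial_complex_down_closed[OF assms(1)])
  have sub: "\<Delta> \<subseteq> Pow {1..n}" using assms(1) by (simp add: simplicial_complex_def)
  have ne: "\<Delta> \<noteq> {}"
  proof
    assume "\<Delta> = {}"
    then have "krull_dim A = 0" using krull_dim_trivial[of n] by (simp add: A I_def)
    with assms(3,4) show False by (simp add: zero_enat_def)
  qed
  then have empty: "{} \<in> \<Delta>" using dc by (auto simp: down_closed_def)
  have dim: "card F \<le> d" if "F \<in> \<Delta>" for F
    using card_face_le_krull_dim[OF dc sub that, where 'k = 'k] assms(3) by (simp add: A I_def)
  have few: "card {F \<in> \<Delta>. card F = d} \<le> d"
  proof (cases "\<exists>F\<in>\<Delta>. card F = d")
    case True
    then obtain F where F: "F \<in> \<Delta>" "card F = d" by blast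
    have "algebra_multiplicity A = of_nat (card {F \<in> \<Delta>. card F = d})"
      using multiplicity_face_ring[OF dc sub ne dim F, where 'k = 'k] assms(4)
      by (simp add: A I_def face_ideal_def[OF dc sub ne])
    then show ?thesis using assms(6) by simp
  next
    case False
    then have "{F \<in> \<Delta>. card F = d} = {}" by blast
    then show ?thesis by (simp only: card.empty)
  qed
  obtain r \<delta> \<phi> \<epsilon> where "minimal_graded_free_resolution n A r \<delta> \<phi> \<epsilon>"
    using minimal_graded_free_resolution_exists[OF dc empty I_def] unfolding A by blast
  then have "\<exists>\<beta> r \<delta> \<phi> \<epsilon>. minimal_graded_free_resolution n A r \<delta> \<phi> \<epsilon> \<and>
      (\<forall>i j. \<beta> i j = card {b. b < r i \<and> \<delta> i b = j})"
    by (intro exI[of _ "\<lambda>i j. card {b. b < r i \<and> \<delta> i b = j}"] exI[of _ r] exI[of _ \<delta>]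
        exI[of _ \<phi>] exI[of _ \<epsilon>]) simp
  \<comment> \<open>The choice in \<open>betti\<close> is thereby realized by an actual minimal
    resolution, to which the degree bound applies.\<close>
  from someI_ex[OF this, folded betti_def] obtain r \<delta> \<phi> \<epsilon>
    where res: "minimal_graded_free_resolution n A r \<delta> \<phi> \<epsilon>"
      and betti: "\<And>i j. betti n A i j = card {b. b < r i \<and> \<delta> i b = j}" by blast
  have bound: "j \<le> i + (d - 1)" if "betti n A i j \<noteq> 0" for i j
  proof -
    from that obtain b where b: "b < r i" "\<delta> i b = j"
      unfolding betti by (metis (mono_tags, lifting) card.empty empty_Collect_eq)
    have "\<delta> i b \<le> i + (d - 1)"
    proof (rule minimal_resolution_degree_bound[OF dc I_def res[unfolded A] _ b(1)])
      fix i j assume "i + (d - 1) < j"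
      then show "koszul_exact n (mon_ideal \<Delta> :: 'k mpoly set) i j"
        using assms(4) by (intro koszul_exact_few_facets[OF dc sub dim few]) auto
    qed
    with b(2) show ?thesis by simp
  qed
  \<comment> \<open>A finite infimum in \<open>enat\<close> comes from a nonempty set and is
    attained, so the Betti number at \<open>(1, d)\<close> is nonzero. This one entry provides both
    lower bounds, \<open>d\<close> for the relation type and \<open>d - 1\<close> for the
    regularity.\<close>
  define J where "J = {enat j | j. betti n A 1 j \<noteq> 0}"
  have Inf_J: "Inf J = enat d" using assms(5) by (simp add: indeg_def J_def)
  then have "J \<noteq> {}" by (auto simp: top_enat_def)
  then obtain x where "x \<in> J" by blast
  then have "(LEAST x. x \<in> J) \<in> J" by (rule LeastI)
  with \<open>J \<noteq> {}\<close> have "Inf J \<in> J" by (simp add: Inf_enat_def)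
  then have top: "betti n A 1 d \<noteq> 0" unfolding Inf_J by (auto simp: J_def)
  have "relation_type n A = enat d"
    unfolding relation_type_def
  proof (rule antisym)
    show "Sup {enat j | j. betti n A 1 j \<noteq> 0} \<le> enat d"
      using bound[of 1] assms(4) by (intro Sup_least) fastforce
    show "enat d \<le> Sup {enat j | j. betti n A 1 j \<noteq> 0}"
      using top by (intro Sup_upper) blast
  qed
  moreover have "regularity n A = ereal (real d - 1)"
    unfolding regularity_def
  proof (rule antisym)
    show "Sup {ereal (real j - real i) | i j. betti n A i j \<noteq> 0} \<le> ereal (real d - 1)"
    proof (rule Sup_least)
      fix x assume "x \<in> {ereal (real j - real i) | i j. betti n A i j \<noteq> 0}"
      then obtain i j where x: "x = ereal (real j - real i)" and "betti n A i j \<noteq> 0" by blast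
      then have "j + 1 \<le> i + d" using bound[of i j] assms(4) by simp
      then have "real j + 1 \<le> real i + real d" by linarith
      then show "x \<le> ereal (real d - 1)" by (simp add: x)
    qed
    show "ereal (real d - 1) \<le> Sup {ereal (real j - real i) | i j. betti n A i j \<noteq> 0}"
      using top by (intro Sup_upper CollectI exI[of _ 1] exI[of _ d]) simp
  qed
  ultimately show ?thesis
    by (simp add: has_q_linear_resolution_def has_linear_resolution_def assms(5) one_ereal_def)
qed

end
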